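(* Let $m_1,m_2$ be positive integers, $n\ge 0$ an integer, and $\alpha_1,\alpha_2$ real numbers with $\alpha_1\alpha_2\neq 0$ and $\alpha_1\neq\alpha_2$. Let $\Omega=\{(x,y)\in\mathbb{R}^2 : (1-\alpha_1x)^{m_1}(1-\alpha_2x)^{m_2}\neq 0\}$. Let $K>0$, let $V\subset\Omega$ be compact, and let $D$ be a compact subset of $B_K=\{(a_{ij},b_{ij})_{0\le i+j\le n} : |a_{ij}|\le K,\ |b_{ij}|\le K\}$ such that for every $(a_{ij},b_{ij})\in D$ the first order Melnikov function $\Phi(h)$, $0\le h<H_0$ (defined in the context), is not identically zero. Then there exists $\varepsilon_0>0$ such that for all $\varepsilon$ with $0<|\varepsilon|<\varepsilon_0$ and all $(a_{ij},b_{ij})\in D$, the system $$\dot x=y+\frac{\varepsilon}{(1-\alpha_1x)^{m_1}(1-\alpha_2x)^{m_2}}\sum_{0\le i+j\le n}a_{ij}x^iy^j,\qquad \dot y=-x+\frac{\varepsilon}{(1-\alpha_1x)^{m_1}(1-\alpha_2x)^{m_2}}\sum_{0\le i+j\le n}b_{ij}x^iy^j$$ on $\Omega$ has at most $4\left(\left[\frac{n+1}{2}\right]+m_1+m_2\right)-7$ limit cycles in $V$.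
   Context: $[\cdot]$ denotes the integer part. The indices $i,j$ are nonnegative integers, and the coefficients $a_{ij},b_{ij}$ are real. Put $H_0=\min\left(\frac{1}{\alpha_1^2},\frac{1}{\alpha_2^2}\right)$. For $0\le h<H_0$ let $L_h$ be the circle $x=\sqrt h\,\sin t,\ y=\sqrt h\,\cos t$, $t\in[0,2\pi]$ (a periodic orbit of the system with $\varepsilon=0$; for $h=0$, the origin). The first order Melnikov function of the system is $$\Phi(h)=\oint_{L_h}\frac{1}{(1-\alpha_1x)^{m_1}(1-\alpha_2x)^{m_2}}\sum_{0\le i+j\le n}\left(a_{ij}x^{i+1}y^j+b_{ij}x^iy^{j+1}\right)dt,\qquad 0\le h<H_0 .$$ A limit cycle is an isolated periodic orbit; a limit cycle is in $V$ if it is contained in $V$. *)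

theory Defs
  imports "HOL-Analysis.Analysis"
begin

definition is_solution :: "(real \<times> real \<Rightarrow> real \<times> real) \<Rightarrow> (real \<times> real) set \<Rightarrow> (real \<Rightarrow> real \<times> real) \<Rightarrow> bool" where
  "is_solution F W \<gamma> \<longleftrightarrow> (\<forall>t. \<gamma> t \<in> W \<and> (\<gamma> has_vector_derivative F (\<gamma> t)) (at t))"

text \<open>Equilibria are excluded: the solution has to be non-constant. Orbits are point sets, so
  a closed orbit counts once, whatever its parametrisation.\<close>

definition periodic_orbit :: "(real \<times> real \<Rightarrow> real \<times> real) \<Rightarrow> (real \<times> real) set \<Rightarrow> (real \<times> real) set \<Rightarrow> bool" where
  "periodic_orbit F W C \<longleftrightarrow>
     (\<exists>\<gamma> T. T > 0 \<and> is_solution F W \<gamma> \<and> (\<forall>t. \<gamma> (t + T) = \<gamma> t) \<and>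
            (\<exists>t. \<gamma> t \<noteq> \<gamma> 0) \<and> C = range \<gamma>)"

text \<open>Isolation is relative to all periodic orbits of the system in \<open>W\<close>.\<close>

definition limit_cycle :: "(real \<times> real \<Rightarrow> real \<times> real) \<Rightarrow> (real \<times> real) set \<Rightarrow> (real \<times> real) set \<Rightarrow> bool" where
  "limit_cycle F W C \<longleftrightarrow>
     periodic_orbit F W C \<and>
     (\<exists>U. open U \<and> C \<subseteq> U \<and> (\<forall>C'. periodic_orbit F W C' \<and> C' \<subseteq> U \<longrightarrow> C' = C))"

definition den :: "nat \<Rightarrow> nat \<Rightarrow> real \<Rightarrow> real \<Rightarrow> real \<Rightarrow> real" where
  "den m1 m2 \<alpha>1 \<alpha>2 x = (1 - \<alpha>1 * x) ^ m1 * (1 - \<alpha>2 * x) ^ m2"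

definition Omega :: "nat \<Rightarrow> nat \<Rightarrow> real \<Rightarrow> real \<Rightarrow> (real \<times> real) set" where
  "Omega m1 m2 \<alpha>1 \<alpha>2 = {(x, y). den m1 m2 \<alpha>1 \<alpha>2 x \<noteq> 0}"

definition index_set :: "nat \<Rightarrow> (nat \<times> nat) set" where
  "index_set n = {(i, j). i + j \<le> n}"

lemma finite_index_set [simp]: "finite (index_set n)"
  by (rule finite_subset[of _ "{..n} \<times> {..n}"]) (auto simp: index_set_def)

definition perturbed_field ::
  "nat \<Rightarrow> nat \<Rightarrow> real \<Rightarrow> real \<Rightarrow> nat \<Rightarrow> (nat \<Rightarrow> nat \<Rightarrow> real) \<Rightarrow> (nat \<Rightarrow> nat \<Rightarrow> real) \<Rightarrow> real
     \<Rightarrow> real \<times> real \<Rightarrow> real \<times> real" where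
  "perturbed_field m1 m2 \<alpha>1 \<alpha>2 n a b \<epsilon> = (\<lambda>(x, y).
     (y + \<epsilon> / den m1 m2 \<alpha>1 \<alpha>2 x * (\<Sum>(i, j)\<in>index_set n. a i j * x ^ i * y ^ j),
      - x + \<epsilon> / den m1 m2 \<alpha>1 \<alpha>2 x * (\<Sum>(i, j)\<in>index_set n. b i j * x ^ i * y ^ j)))"

definition H0 :: "real \<Rightarrow> real \<Rightarrow> real" where
  "H0 \<alpha>1 \<alpha>2 = min (1 / \<alpha>1\<^sup>2) (1 / \<alpha>2\<^sup>2)"

definition melnikov ::
  "nat \<Rightarrow> nat \<Rightarrow> real \<Rightarrow> real \<Rightarrow> nat \<Rightarrow> (nat \<Rightarrow> nat \<Rightarrow> real) \<Rightarrow> (nat \<Rightarrow> nat \<Rightarrow> real) \<Rightarrow> real \<Rightarrow> real" where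
  "melnikov m1 m2 \<alpha>1 \<alpha>2 n a b h =
     integral {0..2 * pi} (\<lambda>t.
       let x = sqrt h * sin t; y = sqrt h * cos t in
       1 / den m1 m2 \<alpha>1 \<alpha>2 x *
         (\<Sum>(i, j)\<in>index_set n. a i j * x ^ (i + 1) * y ^ j + b i j * x ^ i * y ^ (j + 1)))"

text \<open>Coefficient families indexed by \<open>i + j \<le> n\<close> are extended by zero to all indices. On this
  subspace the product topology of the function type is the Euclidean topology of the
  finite-dimensional coefficient space, so \<open>compact\<close> has its usual meaning for subsets of it.\<close>

definition coeff_box :: "nat \<Rightarrow> real \<Rightarrow> ((nat \<Rightarrow> nat \<Rightarrow> real) \<times> (nat \<Rightarrow> nat \<Rightarrow> real)) set" where
  "coeff_box n K = {(a, b). \<forall>i j.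
     (i + j \<le> n \<longrightarrow> \<bar>a i j\<bar> \<le> K \<and> \<bar>b i j\<bar> \<le> K) \<and>
     (\<not> i + j \<le> n \<longrightarrow> a i j = 0 \<and> b i j = 0)}"

end

theory Submission
  imports Defs "HOL-Complex_Analysis.Complex_Analysis"
begin

text \<open>
  Partial fractions turn the Melnikov function into
  \<open>\<Phi> h = P\<^sub>0 h + P\<^sub>1 h / u\<^sup>a + P\<^sub>2 h / v\<^sup>b\<close> with polynomials \<open>P\<^sub>i\<close>, the square roots
  \<open>u\<close> and \<open>v\<close> of \<open>1 - \<alpha>1\<^sup>2 h\<close> and \<open>1 - \<alpha>2\<^sup>2 h\<close>, and odd \<open>a\<close>, \<open>b\<close>. Multiplying by the conjugates under the
  sign changes of \<open>u\<close> and \<open>v\<close> gives a polynomial \<open>N h\<close>, nonzero when \<open>\<Phi>\<close> is, of degree at most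
  \<open>Q = 4 ([(n+1)/2] + m1 + m2) - 6\<close>.

  In polar coordinates around the perturbed equilibrium, a periodic orbit inside \<open>V\<close> is a
  \<open>2\<pi>\<close>-periodic solution \<open>r > 0\<close> of a scalar equation whose right-hand side is holomorphic in \<open>r\<close>.
  Its displacement function \<open>d\<close> is therefore holomorphic on a complex disc of radius close to
  \<open>\<surd>H\<^sub>0\<close>, and \<open>z d z / \<epsilon>\<close> is uniformly close to \<open>\<Phi> (z\<^sup>2)\<close>. An orbit meets the axis
  on both sides of the equilibrium, so it produces one positive and one negative zero of \<open>d\<close>; together
  with \<open>z = 0\<close>, \<open>Q\<close> orbits give \<open>2 Q + 1\<close> zeros of a holomorphic function that is close to the
  polynomial \<open>N (z\<^sup>2)\<close> of degree at most \<open>2 Q\<close>. Interpolating the difference at these zeros forces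
  \<open>N\<close> to be arbitrarily small, a contradiction. Compactness of \<open>D\<close> makes the bound on \<open>\<epsilon>\<close> uniform.
\<close>

section \<open>Linear differential inequalities, holomorphic flows and interpolation\<close>

text \<open>The obstacle is uniformity. As \<epsilon> tends to 0, orbits may run into one another or
  shrink to the equilibrium, so zeros of the displacement cannot be followed one by one from simple
  zeros of the Melnikov function. Comparing a holomorphic function with a polynomial of fixed degree
  avoids this: the interpolation constant depends on two radii and the number of nodes, never on
  their positions.

  This is also why the conjugates are multiplied in. The Melnikov function is no polynomial, but a
  holomorphic multiple of it is one, and multiplying the displacement by the same holomorphic factor
  keeps its zeros.

  Centring at the perturbed equilibrium leaves the radial equation with a removable singularity at
  radius 0, so one disc serves small and large orbits alike. An orbit winds around the equilibrium
  and cannot cross a singular line; compactness of \<open>V\<close> keeps it at a fixed distance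
  from the nearer one, hence in a disc of radius strictly below the critical one, on which all
  constants are finite.\<close>

lemma linear_growth_eq_zero:
  fixes g :: "real \<Rightarrow> 'a::real_inner"
  assumes der: "\<And>t. t \<in> {a..b} \<Longrightarrow> (g has_vector_derivative g' t) (at t within {a..b})"
    and bound: "\<And>t. t \<in> {a..b} \<Longrightarrow> norm (g' t) \<le> C * norm (g t)"
    and zero: "t0 \<in> {a..b}" "g t0 = 0" and t: "t \<in> {a..b}"
  shows "g t = 0"
proof -
  \<comment> \<open>Gronwall through a weight: with weight exp (-2 C s) the squared norm cannot
    increase, with exp (2 C s) it cannot decrease. The first carries the zero at \<open>t0\<close>
    forwards, the second backwards.\<close>
  define f where "f \<sigma> s = (g s \<bullet> g s) * exp (\<sigma> * s)" for \<sigma> s :: real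
  have f_der: "(f \<sigma> has_derivative (\<lambda>h. h * ((2 * (g s \<bullet> g' s) + \<sigma> * (g s \<bullet> g s)) * exp (\<sigma> * s)))) (at s within S)"
    if "s \<in> {a..b}" "S \<subseteq> {a..b}" for \<sigma> s S
    unfolding f_def 
    using has_derivative_subset[OF der[OF that(1), unfolded has_vector_derivative_def] that(2)]
    by (auto intro!: derivative_eq_intros simp: algebra_simps inner_commute)
  have key: "\<bar>g s \<bullet> g' s\<bar> \<le> C * (g s \<bullet> g s)" if "s \<in> {a..b}" for s
  proof -
    have "\<bar>g s \<bullet> g' s\<bar> \<le> norm (g s) * norm (g' s)" by (rule Cauchy_Schwarz_ineq2)
    also have "\<dots> \<le> norm (g s) * (C * norm (g s))" by (intro mult_left_mono bound that) auto
    finally show ?thesis by (simp add: dot_square_norm power2_eq_square mult_ac)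
  qed
  have f0: "f \<sigma> t0 = 0" for \<sigma> by (simp add: f_def zero)
  have "f \<sigma> t \<le> 0" if "\<sigma> = (if t \<ge> t0 then - 2 * C else 2 * C)" for \<sigma>
  proof (cases t t0 rule: linorder_cases)
    case greater
    obtain x where x: "x \<in> {t0<..<t}" 
      "f \<sigma> t - f \<sigma> t0 = (t - t0) * ((2 * (g x \<bullet> g' x) + \<sigma> * (g x \<bullet> g x)) * exp (\<sigma> * x))"
      using mvt_simple[OF greater, of "f \<sigma>" "\<lambda>s h. h * ((2 * (g s \<bullet> g' s) + \<sigma> * (g s \<bullet> g s)) * exp (\<sigma> * s))"]
        f_der zero t by auto
    have "2 * (g x \<bullet> g' x) + \<sigma> * (g x \<bullet> g x) \<le> 0"
      using key[of x] x zero t greater that by auto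
    hence "(t - t0) * ((2 * (g x \<bullet> g' x) + \<sigma> * (g x \<bullet> g x)) * exp (\<sigma> * x)) \<le> 0"
      using greater by (simp add: mult_nonneg_nonpos mult_nonpos_nonneg)
    thus ?thesis using x f0 by auto
  next
    case less
    obtain x where x: "x \<in> {t<..<t0}" 
      "f \<sigma> t0 - f \<sigma> t = (t0 - t) * ((2 * (g x \<bullet> g' x) + \<sigma> * (g x \<bullet> g x)) * exp (\<sigma> * x))"
      using mvt_simple[OF less, of "f \<sigma>" "\<lambda>s h. h * ((2 * (g s \<bullet> g' s) + \<sigma> * (g s \<bullet> g s)) * exp (\<sigma> * s))"]
        f_der zero t by auto
    have "2 * (g x \<bullet> g' x) + \<sigma> * (g x \<bullet> g x) \<ge> 0"
      using key[of x] x zero t less that by auto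
    hence "(t0 - t) * ((2 * (g x \<bullet> g' x) + \<sigma> * (g x \<bullet> g x)) * exp (\<sigma> * x)) \<ge> 0"
      using less by simp
    thus ?thesis using x f0 by auto
  next
    case equal thus ?thesis using f0 by simp
  qed
  hence "g t \<bullet> g t \<le> 0" unfolding f_def using mult_le_0_iff by (metis exp_gt_zero not_le)
  thus ?thesis by (metis inner_ge_zero inner_eq_zero_iff order_antisym)
qed

lemma linear_growth_eq_zero_UNIV:
  fixes g :: "real \<Rightarrow> 'a::real_inner"
  assumes der: "\<And>t. (g has_vector_derivative g' t) (at t)"
    and bound: "\<And>t. norm (g' t) \<le> C * norm (g t)" and "g t0 = 0"
  shows "g t = 0"
proof (rule linear_growth_eq_zero)
  show "t0 \<in> {min t t0..max t t0}" "t \<in> {min t t0..max t t0}" by auto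
qed (use assms in \<open>auto intro: has_vector_derivative_at_within\<close>)

section \<open>Holomorphic parameter integrals and interpolation\<close>

text \<open>Morera's theorem: by Fubini the integral along a triangle passes under the integral over
  \<open>t\<close>, where Cauchy's theorem for each fixed \<open>t\<close> makes it vanish.\<close>

lemma holomorphic_on_param_integral:
  fixes f :: "real \<Rightarrow> complex \<Rightarrow> complex"
  assumes cont: "continuous_on ({a..b} \<times> ball 0 R) (\<lambda>(t, z). f t z)"
    and hol: "\<And>t. t \<in> {a..b} \<Longrightarrow> f t holomorphic_on ball 0 R"
  shows "(\<lambda>z. integral {a..b} (\<lambda>t. f t z)) holomorphic_on ball 0 R"
proof -
  let ?g = "\<lambda>z. integral {a..b} (\<lambda>t. f t z)"
  have cont': "continuous_on (ball 0 R \<times> {a..b}) (\<lambda>(z, t). f t z)"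
    using continuous_on_compose2[OF cont continuous_on_swap, of "ball 0 R \<times> {a..b}"]
    by (force simp: split_beta)
  have contg: "continuous_on (ball 0 R) ?g"
    using integral_continuous_on_param[of "ball 0 R" a b "\<lambda>z t. f t z"] cont' by simp
  have edge: "contour_integral (linepath p q) ?g = integral {a..b} (\<lambda>t. contour_integral (linepath p q) (f t))
      \<and> (\<lambda>t. contour_integral (linepath p q) (f t)) integrable_on {a..b}"
    if pq: "closed_segment p q \<subseteq> ball 0 R" for p q
  proof -
    have lp: "linepath p q x \<in> ball 0 R" if "x \<in> {0..1}" for x
      using pq that by (metis linepath_in_path subsetD)
    have c2: "continuous_on ({0..1} \<times> {a..b}) (\<lambda>(x, t). f t (linepath p q x) * (q - p))"
    proof -
      have "continuous_on ({0..1} \<times> {a..b}) (\<lambda>y. (\<lambda>(t, z). f t z) (snd y, linepath p q (fst y)))"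
        by (rule continuous_on_compose2[OF cont]) (use lp in \<open>auto intro!: continuous_intros simp: linepath_def\<close>)
      thus ?thesis by (auto simp: split_beta intro!: continuous_intros)
    qed
    have c3: "continuous_on ({a..b} \<times> {0..1}) (\<lambda>(t, x). f t (linepath p q x) * (q - p))"
      using continuous_on_compose2[OF c2 continuous_on_swap, of "{a..b} \<times> {0..1}"]
      by (force simp: split_beta)
    have "contour_integral (linepath p q) ?g = integral {0..1} (\<lambda>x. integral {a..b} (\<lambda>t. f t (linepath p q x)) * (q - p))"
      by (simp add: contour_integral_integral vector_derivative_linepath_at)
    also have "\<dots> = integral {0..1} (\<lambda>x. integral {a..b} (\<lambda>t. f t (linepath p q x) * (q - p)))"
      by simp
    also have "\<dots> = integral {a..b} (\<lambda>t. integral {0..1} (\<lambda>x. f t (linepath p q x) * (q - p)))"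
      using integral_swap_continuous[of 0 a 1 b "\<lambda>x t. f t (linepath p q x) * (q - p)"] c2
      by (simp add: cbox_Pair_eq)
    finally have 1: "contour_integral (linepath p q) ?g = integral {a..b} (\<lambda>t. contour_integral (linepath p q) (f t))"
      by (simp add: contour_integral_integral vector_derivative_linepath_at)
    have "continuous_on {a..b} (\<lambda>t. integral {0..1} (\<lambda>x. f t (linepath p q x) * (q - p)))"
      using integral_continuous_on_param[of "{a..b}" 0 "1::real" "\<lambda>t x. f t (linepath p q x) * (q - p)"] c3 by simp
    thus ?thesis using 1 integrable_continuous_real
      by (simp add: contour_integral_integral vector_derivative_linepath_at)
  qed
  have "?g analytic_on ball 0 R"
  proof (rule Morera_triangle[OF contg open_ball], intro impI)
    fix p q r assume hull: "convex hull {p, q, r} \<subseteq> ball (0::complex) R"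
    have seg: "closed_segment p q \<subseteq> ball 0 R" "closed_segment q r \<subseteq> ball 0 R" "closed_segment r p \<subseteq> ball 0 R"
      by (rule order_trans[OF _ hull], rule segments_subset_convex_hull)+
    have "contour_integral (linepath p q) (f t) + contour_integral (linepath q r) (f t) + contour_integral (linepath r p) (f t) = 0"
      if "t \<in> {a..b}" for t
      by (rule has_chain_integral_chain_integral3[OF Cauchy_theorem_triangle])
        (use hol[OF that] hull in \<open>auto intro: holomorphic_on_subset\<close>)
    hence z: "integral {a..b} (\<lambda>t. contour_integral (linepath p q) (f t) + contour_integral (linepath q r) (f t) + contour_integral (linepath r p) (f t)) = integral {a..b} (\<lambda>t. 0)"
      by (intro integral_cong) auto
    thus "contour_integral (linepath p q) ?g + contour_integral (linepath q r) ?g + contour_integral (linepath r p) ?g = 0"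
      using z edge[OF seg(1)] edge[OF seg(2)] edge[OF seg(3)]
      by (simp add: integral_add integrable_add)
  qed
  thus ?thesis by (rule analytic_imp_holomorphic)
qed



text \<open>Newton interpolation: each step divides by one node, and the maximum principle controls the
  quotient no matter how close the nodes are to each other.\<close>

lemma holomorphic_interpolation_bound:
  fixes R1 R :: real
  assumes R: "0 \<le> R1" "R1 < R"
  shows "\<exists>C\<ge>0. \<forall>(f :: complex \<Rightarrow> complex) \<eta> S. f holomorphic_on ball 0 R \<and> (\<forall>z\<in>ball 0 R. norm (f z) \<le> \<eta>) \<and> finite S \<and>
           S \<subseteq> cball 0 R1 \<and> card S = m \<longrightarrow>
         (\<exists>p :: complex poly. (p = 0 \<or> degree p < m) \<and> (\<forall>z\<in>S. poly p z = f z) \<and>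
            (\<forall>z\<in>cball 0 R1. norm (poly p z) \<le> C * \<eta>))"
    (is "\<exists>C\<ge>0. ?Q C m")
proof (induction m)
  case 0
  show ?case by (intro exI[of _ 0]) auto
next
  case (Suc m)
  then obtain C where "C \<ge> 0" and Q: "?Q C m" by (elim exE conjE)
  note C = Q[rule_format, OF conjI[OF _ conjI[OF _ conjI[OF _ conjI]]]]
  \<comment> \<open>On a circle of radius at least (R + R1)/2 every node is at distance at least (R
    - R1)/2, and the numerator of the divided difference is at most 2 \<eta>. The quotient of these
    two bounds is the loss per node.\<close>
  define K where "K = 4 / (R - R1)"
  have K: "K > 0" using R by (simp add: K_def)
  show ?case
  proof (intro exI[of _ "1 + 2 * R1 * (C * K)"] conjI allI impI)
    show "0 \<le> 1 + 2 * R1 * (C * K)" using R K \<open>C \<ge> 0\<close> by simp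
    fix f :: "complex \<Rightarrow> complex" and \<eta> and S :: "complex set"
    assume "f holomorphic_on ball 0 R \<and> (\<forall>z\<in>ball 0 R. norm (f z) \<le> \<eta>) \<and> finite S \<and>
           S \<subseteq> cball 0 R1 \<and> card S = Suc m"
    hence hol: "f holomorphic_on ball 0 R" and bd: "\<And>z. z \<in> ball 0 R \<Longrightarrow> norm (f z) \<le> \<eta>"
      and S: "finite S" "S \<subseteq> cball 0 R1" "card S = Suc m" by auto
    obtain z0 S' where S': "S = insert z0 S'" "z0 \<notin> S'" "card S' = m"
      using S(3) unfolding card_Suc_eq by auto
    have S'f: "finite S'" using S S' by simp
    have z0: "norm z0 \<le> R1" using S S' by auto
    hence z0b: "z0 \<in> ball 0 R" using R by auto
    define g where "g = (\<lambda>z. if z = z0 then deriv f z0 else (f z - f z0) / (z - z0))"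
    have holg: "g holomorphic_on ball 0 R" unfolding g_def
      by (rule pole_lemma[OF hol]) (use z0b in simp)
    have bdg: "norm (g z) \<le> K * \<eta>" if z: "z \<in> ball 0 R" for z
    proof -
      define r where "r = max (norm z) ((R + R1) / 2)"
      have r: "r < R" "norm z \<le> r" "r - R1 \<ge> (R - R1) / 2" "r > 0" using z R
        by (auto simp: r_def max_def field_simps)
      show ?thesis
      proof (rule maximum_modulus_frontier[of g "cball 0 r"])
        show "g holomorphic_on interior (cball 0 r)"
          by (rule holomorphic_on_subset[OF holg]) (use r in auto)
        show "continuous_on (closure (cball 0 r)) g"
          by (rule continuous_on_subset[OF holomorphic_on_imp_continuous_on[OF holg]]) (use r in auto)
        show "z \<in> cball 0 r" using r by auto
        fix w :: complex assume "w \<in> frontier (cball 0 r)"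
        hence w: "norm w = r" by simp
        have d: "norm (w - z0) \<ge> (R - R1) / 2" using norm_triangle_ineq2[of w z0] w z0 r by linarith
        hence ne: "w \<noteq> z0" using R by auto
        have "norm (f w - f z0) \<le> 2 * \<eta>"
          using norm_triangle_ineq4[of "f w" "f z0"] bd[of w] bd[OF z0b] w r by auto
        moreover have "0 \<le> \<eta>" using bd[OF z0b] norm_ge_zero order_trans by blast
        ultimately have "norm (f w - f z0) / norm (w - z0) \<le> 2 * \<eta> / ((R - R1) / 2)"
          using d R by (intro frac_le) auto
        thus "norm (g w) \<le> K * \<eta>" using ne by (simp add: g_def norm_divide K_def)
      qed auto
    qed
    obtain p where p: "p = 0 \<or> degree p < m" "\<forall>z\<in>S'. poly p z = g z"
        "\<forall>z\<in>cball 0 R1. norm (poly p z) \<le> C * (K * \<eta>)"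
      using C[of g "K * \<eta>" S', OF holg _ S'f _ S'(3)] bdg S' S by blast
    define q where "q = [:f z0:] + [:- z0, 1:] * p"
    have "degree q < Suc m"
    proof (cases "p = 0")
      case False
      have "degree ([:- z0, 1:] * p) \<le> 1 + degree p" 
        using degree_mult_le[of "[:- z0, 1:]" p] by simp
      hence "degree q \<le> 1 + degree p" unfolding q_def
        by (intro degree_add_le) auto
      thus ?thesis using p False by auto
    qed (simp add: q_def)
    moreover have "poly q z = f z" if "z \<in> S" for z
    proof (cases "z = z0")
      case False
      hence "poly p z = g z" using that S' p by auto
      thus ?thesis using False by (simp add: q_def g_def field_simps)
    qed (simp add: q_def)
    moreover have "norm (poly q z) \<le> (1 + 2 * R1 * (C * K)) * \<eta>" if z: "z \<in> cball 0 R1" for z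
    proof -
      have "norm (poly q z) = norm (f z0 + (z - z0) * poly p z)" by (simp add: q_def algebra_simps)
      also have "\<dots> \<le> norm (f z0) + norm (z - z0) * norm (poly p z)"
        by (metis norm_mult norm_triangle_ineq)
      also have "\<dots> \<le> \<eta> + (2 * R1) * (C * (K * \<eta>))"
        using norm_triangle_ineq4[of z z0] z z0 p(3) R
        by (intro add_mono mult_mono bd z0b) auto
      finally show ?thesis by (simp add: algebra_simps)
    qed
    ultimately show "\<exists>p :: complex poly. (p = 0 \<or> degree p < Suc m) \<and> (\<forall>z\<in>S. poly p z = f z) \<and>
            (\<forall>z\<in>cball 0 R1. norm (poly p z) \<le> (1 + 2 * R1 * (C * K)) * \<eta>)" by blast
  qed
qed

text \<open>The interpolant of \<open>poly P z - f z\<close> has degree below \<open>m\<close> and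
  agrees with \<open>P\<close> at the \<open>m\<close> zeros of \<open>f\<close>, so it is
  \<open>P\<close> itself. A bound on the difference thereby becomes a bound on \<open>P\<close>,
  however close together the zeros are.\<close>

lemma poly_small_if_many_approx_zeros:
  fixes R1 R :: real
  assumes R: "0 \<le> R1" "R1 < R"
  obtains C where "C \<ge> 0" and "\<And>(f :: complex \<Rightarrow> complex) P \<eta> S z. \<lbrakk>f holomorphic_on ball 0 R; degree P < m; finite S; S \<subseteq> cball 0 R1; card S = m;
      \<And>z. z \<in> S \<Longrightarrow> f z = 0; \<And>z. z \<in> ball 0 R \<Longrightarrow> norm (f z - poly P z) \<le> \<eta>; z \<in> cball 0 R1\<rbrakk>
      \<Longrightarrow> norm (poly P z) \<le> C * \<eta>"
proof -
  from holomorphic_interpolation_bound[OF R, of m] obtain C where "C \<ge> 0" and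
    Q: "\<forall>(f :: complex \<Rightarrow> complex) \<eta> S. f holomorphic_on ball 0 R \<and> (\<forall>z\<in>ball 0 R. norm (f z) \<le> \<eta>) \<and> finite S \<and>
           S \<subseteq> cball 0 R1 \<and> card S = m \<longrightarrow>
         (\<exists>p :: complex poly. (p = 0 \<or> degree p < m) \<and> (\<forall>z\<in>S. poly p z = f z) \<and>
            (\<forall>z\<in>cball 0 R1. norm (poly p z) \<le> C * \<eta>))" by (elim exE conjE)
  note C = Q[rule_format, OF conjI[OF _ conjI[OF _ conjI[OF _ conjI]]]]
  show ?thesis
  proof (rule that[OF \<open>C \<ge> 0\<close>])
    fix f :: "complex \<Rightarrow> complex" and P \<eta> S and z :: complex
    assume *: "f holomorphic_on ball 0 R" "degree P < m" "finite S" "S \<subseteq> cball 0 R1" "card S = m"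
      "\<And>z. z \<in> S \<Longrightarrow> f z = 0" "\<And>z. z \<in> ball 0 R \<Longrightarrow> norm (f z - poly P z) \<le> \<eta>" "z \<in> cball 0 R1"
    have holP: "(\<lambda>z. poly P z) holomorphic_on ball 0 R" by (intro holomorphic_intros)
    obtain p where p: "p = 0 \<or> degree p < m" "\<forall>z\<in>S. poly p z = poly P z - f z"
        "\<forall>z\<in>cball 0 R1. norm (poly p z) \<le> C * \<eta>"
      using C[of "\<lambda>z. poly P z - f z" \<eta> S, OF holomorphic_on_diff[OF holP *(1)] _ *(3,4,5)] *(7)
      by (auto simp: norm_minus_commute)
    have "p = P"
      by (rule poly_eqI_degree[of S]) (use * p in auto)
    thus "norm (poly P z) \<le> C * \<eta>" using p * by auto
  qed
qed


section \<open>Picard iteration with holomorphic dependence on the initial value\<close>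

text \<open>Meant for Picard iterates: they are holomorphic, hence continuous, in the initial value,
  and Lipschitz in time because the vector field is bounded.\<close>

lemma continuous_on_Times_Lipschitz:
  fixes f :: "'a::metric_space \<Rightarrow> 'b::metric_space \<Rightarrow> 'c::metric_space"
  assumes cont: "\<And>x. x \<in> X \<Longrightarrow> continuous_on Y (f x)"
    and lip: "\<And>x x' y. x \<in> X \<Longrightarrow> x' \<in> X \<Longrightarrow> y \<in> Y \<Longrightarrow> dist (f x y) (f x' y) \<le> B * dist x x'"
  shows "continuous_on (X \<times> Y) (\<lambda>(x, y). f x y)"
  unfolding continuous_on_def
proof (clarify)
  fix x0 y0 assume xy: "x0 \<in> X" "y0 \<in> Y"
  let ?F = "at (x0, y0) within X \<times> Y"
  have "((\<lambda>p. f x0 (snd p)) \<longlongrightarrow> f x0 y0) ?F"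
  proof -
    have "continuous_on (X \<times> Y) (\<lambda>p. f x0 (snd p))"
      by (rule continuous_on_compose2[OF cont[OF xy(1)] continuous_on_snd[OF continuous_on_id]]) auto
    thus ?thesis using xy by (auto simp: continuous_on_def)
  qed
  hence 1: "((\<lambda>p. dist (f x0 (snd p)) (f x0 y0)) \<longlongrightarrow> 0) ?F" by (rule tendsto_dist_iff[THEN iffD1])
  have 2: "((\<lambda>p. B * dist (fst p) x0) \<longlongrightarrow> 0) ?F"
  proof -
    have "((\<lambda>p. B * dist (fst p) x0) \<longlongrightarrow> B * dist (fst (x0, y0)) x0) ?F" by (intro tendsto_intros)
    thus ?thesis by simp
  qed
  have "((\<lambda>p. dist (f (fst p) (snd p)) (f x0 y0)) \<longlongrightarrow> 0) ?F"
  proof (rule tendsto_sandwich[of "\<lambda>_. 0"])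
    show "((\<lambda>p. B * dist (fst p) x0 + dist (f x0 (snd p)) (f x0 y0)) \<longlongrightarrow> 0) ?F"
      using tendsto_add[OF 2 1] by simp
    show "\<forall>\<^sub>F p in ?F. dist (f (fst p) (snd p)) (f x0 y0) \<le> B * dist (fst p) x0 + dist (f x0 (snd p)) (f x0 y0)"
      unfolding eventually_at_filter
    proof (intro always_eventually allI impI)
      fix p assume "p \<in> X \<times> Y"
      thus "dist (f (fst p) (snd p)) (f x0 y0) \<le> B * dist (fst p) x0 + dist (f x0 (snd p)) (f x0 y0)"
        using lip[of "fst p" x0 "snd p"] xy dist_triangle[of "f (fst p) (snd p)" "f x0 y0" "f x0 (snd p)"]
        by auto
    qed
  qed auto
  thus "((\<lambda>(x, y). f x y) \<longlongrightarrow> f x0 y0) ?F"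
    unfolding split_beta by (rule tendsto_dist_iff[THEN iffD2])
qed


text \<open>The properties assumed of \<open>f\<close> are reproduced by one Picard iteration. The
  gap in \<open>R1 + \<tau> * B < R\<close> keeps all iterates in the disc where \<open>F\<close> is
  defined, so the domain does not shrink from one iterate to the next.\<close>

lemma picard_step:
  fixes F :: "real \<Rightarrow> complex \<Rightarrow> complex"
  assumes cont: "continuous_on ({0..\<tau>} \<times> ball 0 R) (\<lambda>(t, z). F t z)"
    and hol: "\<And>t. t \<in> {0..\<tau>} \<Longrightarrow> F t holomorphic_on ball 0 R"
    and bd: "\<And>t z. t \<in> {0..\<tau>} \<Longrightarrow> z \<in> ball 0 R \<Longrightarrow> norm (F t z) \<le> B"
    and R: "R1 + \<tau> * B < R" "\<tau> \<ge> 0"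
    and f_cont: "continuous_on ({0..\<tau>} \<times> ball 0 R1) (\<lambda>(t, z). f t z)"
    and f_hol: "\<And>t. t \<in> {0..\<tau>} \<Longrightarrow> f t holomorphic_on ball 0 R1"
    and f_bd: "\<And>t z. t \<in> {0..\<tau>} \<Longrightarrow> z \<in> ball 0 R1 \<Longrightarrow> norm (f t z - z) \<le> \<tau> * B"
  defines "g \<equiv> \<lambda>t z. z + integral {0..t} (\<lambda>s. F s (f s z))"
  shows "continuous_on ({0..\<tau>} \<times> ball 0 R1) (\<lambda>(t, z). g t z)"
    and "\<And>t. t \<in> {0..\<tau>} \<Longrightarrow> g t holomorphic_on ball 0 R1"
    and "\<And>t z. t \<in> {0..\<tau>} \<Longrightarrow> z \<in> ball 0 R1 \<Longrightarrow> norm (g t z - z) \<le> \<tau> * B"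
    and "\<And>z. z \<in> ball 0 R1 \<Longrightarrow> continuous_on {0..\<tau>} (\<lambda>s. F s (f s z))"
    and "\<And>t z. t \<in> {0..\<tau>} \<Longrightarrow> z \<in> ball 0 R1 \<Longrightarrow> f t z \<in> ball 0 R"
proof -
  show f_in: "f t z \<in> ball 0 R" if "t \<in> {0..\<tau>}" "z \<in> ball 0 R1" for t z
    using f_bd[OF that] that R norm_triangle_ineq[of "f t z - z" z] by auto
  have c: "continuous_on ({0..\<tau>} \<times> ball 0 R1) (\<lambda>p. (\<lambda>(t, z). F t z) (fst p, (\<lambda>(t, z). f t z) p))"
    by (rule continuous_on_compose2[OF cont])
      (use f_in in \<open>auto intro!: continuous_on_Pair continuous_on_fst[OF continuous_on_id] f_cont simp del: mem_ball\<close>)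
  hence c': "continuous_on ({0..\<tau>} \<times> ball 0 R1) (\<lambda>(t, z). F t (f t z))" by (simp add: split_beta)
  show c1: "continuous_on {0..\<tau>} (\<lambda>s. F s (f s z))" if "z \<in> ball 0 R1" for z
  proof -
    have "continuous_on {0..\<tau>} (\<lambda>s. (s, z))" by (intro continuous_intros)
    from continuous_on_compose2[OF c' this] that show ?thesis by (simp add: image_subset_iff)
  qed
  have nB: "norm (F s (f s z)) \<le> B" if "s \<in> {0..\<tau>}" "z \<in> ball 0 R1" for s z
    using bd f_in that by blast
  show holg: "g t holomorphic_on ball 0 R1" if t: "t \<in> {0..\<tau>}" for t
  proof -
    have "(\<lambda>z. integral {0..t} (\<lambda>s. F s (f s z))) holomorphic_on ball 0 R1"
    proof (rule holomorphic_on_param_integral)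
      show "continuous_on ({0..t} \<times> ball 0 R1) (\<lambda>(s, z). F s (f s z))"
        by (rule continuous_on_subset[OF c']) (use t in auto)
      fix s assume s: "s \<in> {0..t}"
      have "(F s \<circ> f s) holomorphic_on ball 0 R1"
        by (rule holomorphic_on_compose_gen[OF f_hol hol]) (use s t f_in in auto)
      thus "(\<lambda>z. F s (f s z)) holomorphic_on ball 0 R1" by (simp add: o_def)
    qed
    thus ?thesis unfolding g_def by (intro holomorphic_intros)
  qed
  have lip: "norm (g t z - g t' z) \<le> B * (t - t')" if "t \<in> {0..\<tau>}" "t' \<in> {0..\<tau>}" "t' \<le> t" "z \<in> ball 0 R1" for t t' z
  proof -
    have "integral {0..t'} (\<lambda>s. F s (f s z)) + integral {t'..t} (\<lambda>s. F s (f s z)) = integral {0..t} (\<lambda>s. F s (f s z))"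
      by (rule Henstock_Kurzweil_Integration.integral_combine)
        (use that in \<open>auto intro!: integrable_continuous_real continuous_on_subset[OF c1[OF that(4)]]\<close>)
    hence "g t z - g t' z = integral {t'..t} (\<lambda>s. F s (f s z))" by (simp add: g_def algebra_simps)
    also have "norm \<dots> \<le> B * (t - t')"
      by (rule integral_bound) (use that nB in \<open>auto intro!: continuous_on_subset[OF c1[OF that(4)]]\<close>)
    finally show ?thesis .
  qed
  show "norm (g t z - z) \<le> \<tau> * B" if "t \<in> {0..\<tau>}" "z \<in> ball 0 R1" for t z
  proof -
    have "0 \<le> B" using nB[OF that] norm_ge_zero order_trans by blast
    hence "B * t \<le> \<tau> * B" using that by (simp add: mult.commute mult_left_mono)
    moreover have "norm (g t z - g 0 z) \<le> B * (t - 0)" using lip[of t 0 z] that by auto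
    ultimately show ?thesis by (simp add: g_def)
  qed
  show "continuous_on ({0..\<tau>} \<times> ball 0 R1) (\<lambda>(t, z). g t z)"
  proof (rule continuous_on_Times_Lipschitz)
    show "continuous_on (ball 0 R1) (g t)" if "t \<in> {0..\<tau>}" for t
      using holg[OF that] by (rule holomorphic_on_imp_continuous_on)
    fix t t' z assume tz: "t \<in> {0..\<tau>}" "t' \<in> {0..\<tau>}" "z \<in> ball (0::complex) R1"
    show "dist (g t z) (g t' z) \<le> B * dist t t'"
    proof (cases "t' \<le> t")
      case True thus ?thesis using lip[of t t' z] tz by (simp add: dist_norm)
    next
      case False thus ?thesis using lip[of t' t z] tz by (simp add: dist_norm norm_minus_commute)
    qed
  qed
qed

text \<open>The Picard map halves distances because \<tau> * L \<le> 1/2, on the whole time interval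
  at once; this is affordable since the field it is meant for is of order \<epsilon>. Uniform limits
  of holomorphic iterates are holomorphic. The integral equation is kept beside the differential
  one: the former compares the flow with the Melnikov integral, the latter serves
  uniqueness.\<close>

lemma picard_holomorphic:
  fixes F :: "real \<Rightarrow> complex \<Rightarrow> complex"
  assumes cont: "continuous_on ({0..\<tau>} \<times> ball 0 R) (\<lambda>(t, z). F t z)"
    and hol: "\<And>t. t \<in> {0..\<tau>} \<Longrightarrow> F t holomorphic_on ball 0 R"
    and bd: "\<And>t z. t \<in> {0..\<tau>} \<Longrightarrow> z \<in> ball 0 R \<Longrightarrow> norm (F t z) \<le> B"
    and lip: "\<And>t z z'. t \<in> {0..\<tau>} \<Longrightarrow> z \<in> ball 0 R \<Longrightarrow> z' \<in> ball 0 R \<Longrightarrow> norm (F t z - F t z') \<le> L * norm (z - z')"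
    and R: "R1 + \<tau> * B < R" and \<tau>: "\<tau> \<ge> 0" and L: "0 \<le> L" "\<tau> * L \<le> 1/2" and B: "0 \<le> B"
  obtains \<phi> where "\<And>t. t \<in> {0..\<tau>} \<Longrightarrow> \<phi> t holomorphic_on ball 0 R1"
    and "\<And>t z. t \<in> {0..\<tau>} \<Longrightarrow> z \<in> ball 0 R1 \<Longrightarrow> norm (\<phi> t z - z) \<le> \<tau> * B"
    and "\<And>t z. t \<in> {0..\<tau>} \<Longrightarrow> z \<in> ball 0 R1 \<Longrightarrow>
           ((\<lambda>s. \<phi> s z) has_vector_derivative F t (\<phi> t z)) (at t within {0..\<tau>})"
    and "\<And>z. z \<in> ball 0 R1 \<Longrightarrow> continuous_on {0..\<tau>} (\<lambda>s. F s (\<phi> s z))"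
    and "\<And>t z. t \<in> {0..\<tau>} \<Longrightarrow> z \<in> ball 0 R1 \<Longrightarrow> \<phi> t z = z + integral {0..t} (\<lambda>s. F s (\<phi> s z))"
proof -
  let ?A = "{0..\<tau>} \<times> ball (0::complex) R1"
  define ph where "ph = rec_nat (\<lambda>(t::real) z. z) (\<lambda>_ f t z. z + integral {0..t} (\<lambda>s. F s (f s z)))"
  have ph_0: "ph 0 = (\<lambda>t z. z)" and ph_Suc: "ph (Suc n) = (\<lambda>t z. z + integral {0..t} (\<lambda>s. F s (ph n s z)))" for n
    by (simp_all add: ph_def)
  define good where "good f \<longleftrightarrow> continuous_on ?A (\<lambda>(t, z). f t z) \<and> (\<forall>t\<in>{0..\<tau>}. f t holomorphic_on ball 0 R1) \<and>
      (\<forall>t\<in>{0..\<tau>}. \<forall>z\<in>ball 0 R1. norm (f t z - z) \<le> \<tau> * B)" for f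
  have step: "good (\<lambda>t z. z + integral {0..t} (\<lambda>s. F s (f s z)))"
      "\<And>z. z \<in> ball 0 R1 \<Longrightarrow> continuous_on {0..\<tau>} (\<lambda>s. F s (f s z))"
      "\<And>t z. t \<in> {0..\<tau>} \<Longrightarrow> z \<in> ball 0 R1 \<Longrightarrow> f t z \<in> ball 0 R" if "good f" for f
  proof -
    have f: "continuous_on ?A (\<lambda>(t, z). f t z)" "\<And>t. t \<in> {0..\<tau>} \<Longrightarrow> f t holomorphic_on ball 0 R1"
      "\<And>t z. t \<in> {0..\<tau>} \<Longrightarrow> z \<in> ball 0 R1 \<Longrightarrow> norm (f t z - z) \<le> \<tau> * B"
      using that by (auto simp: good_def)
    note st = picard_step[OF cont hol bd R \<tau> f]
    show "good (\<lambda>t z. z + integral {0..t} (\<lambda>s. F s (f s z)))"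
      unfolding good_def using st(1-3) by blast
    show "continuous_on {0..\<tau>} (\<lambda>s. F s (f s z))" if "z \<in> ball 0 R1" for z
      using st(4) that by blast
    show "f t z \<in> ball 0 R" if "t \<in> {0..\<tau>}" "z \<in> ball 0 R1" for t z
      using st(5) that by blast
  qed
  have good_ph: "good (ph n)" for n
  proof (induction n)
    case 0
    show ?case using \<tau> B unfolding ph_0 good_def split_beta
      by (auto intro!: continuous_intros holomorphic_intros)
  next
    case (Suc n) thus ?case unfolding ph_Suc by (rule step)
  qed
  have diff: "norm (ph (Suc n) t z - ph n t z) \<le> \<tau> * B * (1/2) ^ n" if "t \<in> {0..\<tau>}" "z \<in> ball 0 R1" for n t z
    using that
  proof (induction n arbitrary: t)
    case 0
    thus ?case using good_ph[of "Suc 0"] by (auto simp: good_def ph_0)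
  next
    case (Suc n)
    have c: "continuous_on {0..t} (\<lambda>s. F s (ph k s z))" for k
      by (rule continuous_on_subset[OF step(2)[OF good_ph Suc.prems(2)]]) (use Suc.prems in auto)
    have "ph (Suc (Suc n)) t z - ph (Suc n) t z = integral {0..t} (\<lambda>s. F s (ph (Suc n) s z) - F s (ph n s z))"
      unfolding ph_Suc[of "Suc n"] ph_Suc[of n]
      by (subst integral_diff) (use c[of n] c[of "Suc n"] in \<open>auto intro!: integrable_continuous_real simp: ph_Suc\<close>)
    also have "norm \<dots> \<le> (L * (\<tau> * B * (1/2) ^ n)) * (t - 0)"
    proof (rule integral_bound)
      show "continuous_on {0..t} (\<lambda>s. F s (ph (Suc n) s z) - F s (ph n s z))"
        by (intro continuous_on_diff c)
      fix s assume "s \<in> {0..t}"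
      hence s: "s \<in> {0..\<tau>}" using Suc.prems by auto
      have "norm (F s (ph (Suc n) s z) - F s (ph n s z)) \<le> L * norm (ph (Suc n) s z - ph n s z)"
        using step(3)[OF good_ph s Suc.prems(2)] lip[OF s] by blast
      also have "\<dots> \<le> L * (\<tau> * B * (1/2) ^ n)"
        by (intro mult_left_mono Suc.IH s Suc.prems L)
      finally show "norm (F s (ph (Suc n) s z) - F s (ph n s z)) \<le> L * (\<tau> * B * (1/2) ^ n)" .
    qed (use Suc.prems in auto)
    also have "\<dots> = (t * L) * (\<tau> * B * (1/2) ^ n)" by simp
    also have "\<dots> \<le> (1/2) * (\<tau> * B * (1/2) ^ n)"
    proof (rule mult_right_mono)
      have "t * L \<le> \<tau> * L" using Suc.prems L by (intro mult_right_mono) auto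
      thus "t * L \<le> 1/2" using L by linarith
    qed (use \<tau> B in auto)
    finally show ?case by simp
  qed
  \<comment> \<open>Written as a telescoping series, so that the geometric bound \<open>diff\<close>
    and the M-test give convergence that is uniform in time and initial value together.\<close>
  define \<phi> where "\<phi> t z = z + (\<Sum>n. ph (Suc n) t z - ph n t z)" for t z
  have "uniform_limit ?A (\<lambda>n p. \<Sum>i<n. ph (Suc i) (fst p) (snd p) - ph i (fst p) (snd p))
      (\<lambda>p. \<Sum>i. ph (Suc i) (fst p) (snd p) - ph i (fst p) (snd p)) sequentially"
    by (rule Weierstrass_m_test[where M = "\<lambda>n. \<tau> * B * (1/2) ^ n"])
      (use diff in \<open>auto intro!: summable_mult summable_geometric\<close>)
  hence "uniform_limit ?A (\<lambda>n p. snd p + (\<Sum>i<n. ph (Suc i) (fst p) (snd p) - ph i (fst p) (snd p)))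
      (\<lambda>p. snd p + (\<Sum>i. ph (Suc i) (fst p) (snd p) - ph i (fst p) (snd p))) sequentially"
    by (intro uniform_limit_intros)
  hence UL: "uniform_limit ?A (\<lambda>n p. ph n (fst p) (snd p)) (\<lambda>p. \<phi> (fst p) (snd p)) sequentially"
    using sum_lessThan_telescope[of "\<lambda>i. ph i (fst p) (snd p)" for p]
    by (simp add: \<phi>_def ph_0)
  have UL1: "uniform_limit {0..\<tau>} (\<lambda>n t. ph n t z) (\<lambda>t. \<phi> t z) sequentially" if "z \<in> ball 0 R1" for z
    using uniform_limit_compose'[OF UL, of "\<lambda>t. (t, z)" "{0..\<tau>}"] that by auto
  have UL2: "uniform_limit (ball 0 R1) (\<lambda>n z. ph n t z) (\<lambda>z. \<phi> t z) sequentially" if "t \<in> {0..\<tau>}" for t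
    using uniform_limit_compose'[OF UL, of "\<lambda>z. (t, z)" "ball 0 R1"] that by auto
  have lim: "(\<lambda>n. ph n t z) \<longlonglongrightarrow> \<phi> t z" if "t \<in> {0..\<tau>}" "z \<in> ball 0 R1" for t z
    using tendsto_uniform_limitI[OF UL, of "(t, z)"] that by auto
  have "good \<phi>"
    unfolding good_def
  proof (intro conjI ballI)
    show "continuous_on ?A (\<lambda>(t, z). \<phi> t z)"
      using uniform_limit_theorem[OF _ UL] good_ph by (auto simp: good_def split_beta)
    show "\<phi> t holomorphic_on ball 0 R1" if t: "t \<in> {0..\<tau>}" for t
    proof (rule holomorphic_uniform_sequence)
      show "ph n t holomorphic_on ball 0 R1" for n using good_ph t by (auto simp: good_def)
      fix z :: complex assume "z \<in> ball 0 R1"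
      then obtain d where "d > 0" "cball z d \<subseteq> ball 0 R1" using open_contains_cball open_ball by blast
      thus "\<exists>d>0. cball z d \<subseteq> ball 0 R1 \<and> uniform_limit (cball z d) (\<lambda>n. ph n t) (\<phi> t) sequentially"
        using uniform_limit_on_subset[OF UL2[OF t]] by blast
    qed simp
    show "norm (\<phi> t z - z) \<le> \<tau> * B" if "t \<in> {0..\<tau>}" "z \<in> ball 0 R1" for t z
    proof (rule LIMSEQ_le_const2)
      show "(\<lambda>n. norm (ph n t z - z)) \<longlonglongrightarrow> norm (\<phi> t z - z)" by (intro tendsto_intros lim that)
      show "\<exists>N. \<forall>n\<ge>N. norm (ph n t z - z) \<le> \<tau> * B" using good_ph that by (auto simp: good_def)
    qed
  qed
  note st = step[OF this]
  have eq: "\<phi> t z = z + integral {0..t} (\<lambda>s. F s (\<phi> s z))" if t: "t \<in> {0..\<tau>}" and z: "z \<in> ball 0 R1" for t z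
  proof -
    have "uniform_limit {0..t} (\<lambda>n s. F s (ph n s z)) (\<lambda>s. F s (\<phi> s z)) sequentially"
      unfolding uniform_limit_iff
    proof (intro allI impI)
      fix e :: real assume "e > 0"
      have "\<forall>\<^sub>F n in sequentially. \<forall>s\<in>{0..\<tau>}. dist (ph n s z) (\<phi> s z) < e / (L + 1)"
        using UL1[OF z] \<open>e > 0\<close> L unfolding uniform_limit_iff by (auto elim!: allE[of _ "e / (L + 1)"])
      thus "\<forall>\<^sub>F n in sequentially. \<forall>s\<in>{0..t}. dist (F s (ph n s z)) (F s (\<phi> s z)) < e"
      proof (eventually_elim, intro ballI)
        fix n s assume h: "\<forall>s\<in>{0..\<tau>}. dist (ph n s z) (\<phi> s z) < e / (L + 1)" and "s \<in> {0..t}"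
        hence s: "s \<in> {0..\<tau>}" using t by auto
        have "dist (F s (ph n s z)) (F s (\<phi> s z)) \<le> L * dist (ph n s z) (\<phi> s z)"
          unfolding dist_norm using lip[OF s step(3)[OF good_ph s z] st(3)[OF s z]] .
        also have "\<dots> \<le> L * (e / (L + 1))" using h s L by (intro mult_left_mono) (auto simp: less_imp_le)
        also have "\<dots> < e" using L \<open>e > 0\<close> by (simp add: field_simps)
        finally show "dist (F s (ph n s z)) (F s (\<phi> s z)) < e" .
      qed
    qed
    then obtain I J where IJ: "\<And>n. ((\<lambda>s. F s (ph n s z)) has_integral I n) {0..t}"
        "((\<lambda>s. F s (\<phi> s z)) has_integral J) {0..t}" "I \<longlonglongrightarrow> J"
      by (rule uniform_limit_integral)
        (use t in \<open>auto intro!: continuous_on_subset[OF step(2)[OF good_ph z]]\<close>)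
    have "(\<lambda>n. z + I n) \<longlonglongrightarrow> z + J" by (intro tendsto_intros IJ)
    moreover have "(\<lambda>n. z + I n) = (\<lambda>n. ph (Suc n) t z)"
      using integral_unique[OF IJ(1)] by (simp add: ph_Suc)
    moreover have "(\<lambda>n. ph (Suc n) t z) \<longlonglongrightarrow> \<phi> t z" using lim[OF t z] by (rule LIMSEQ_Suc)
    ultimately show ?thesis using LIMSEQ_unique IJ(2) by (metis integral_unique)
  qed
  show ?thesis
  proof (rule that)
    show "\<phi> t holomorphic_on ball 0 R1" if "t \<in> {0..\<tau>}" for t
      using \<open>good \<phi>\<close> that by (auto simp: good_def)
    show "norm (\<phi> t z - z) \<le> \<tau> * B" if "t \<in> {0..\<tau>}" "z \<in> ball 0 R1" for t z
      using \<open>good \<phi>\<close> that by (auto simp: good_def)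
    show "continuous_on {0..\<tau>} (\<lambda>s. F s (\<phi> s z))" if "z \<in> ball 0 R1" for z using st(2)[OF that] .
    show "\<phi> t z = z + integral {0..t} (\<lambda>s. F s (\<phi> s z))" if "t \<in> {0..\<tau>}" "z \<in> ball 0 R1" for t z
      using eq that .
    show "((\<lambda>s. \<phi> s z) has_vector_derivative F t (\<phi> t z)) (at t within {0..\<tau>})"
      if "t \<in> {0..\<tau>}" "z \<in> ball 0 R1" for t z
    proof -
      have "((\<lambda>s. z + integral {0..s} (\<lambda>s. F s (\<phi> s z))) has_vector_derivative F t (\<phi> t z)) (at t within {0..\<tau>})"
        using integral_has_vector_derivative[OF st(2)[OF that(2)] that(1)]
        by (auto intro!: derivative_eq_intros)
      thus ?thesis
        by (rule has_vector_derivative_transform[OF that(1), rotated]) (use eq that in auto)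
    qed
  qed
qed

section \<open>The Melnikov function\<close>

lemma integral_2pi_antiderivative:
  fixes f F :: "real \<Rightarrow> real"
  assumes "\<And>t. (F has_real_derivative f t) (at t)" "F (2 * pi) = F 0"
  shows "integral {0..2 * pi} f = 0"
proof -
  have "(f has_integral (F (2 * pi) - F 0)) {0..2 * pi}"
    by (rule fundamental_theorem_of_calculus)
      (auto intro: has_field_derivative_at_within assms simp: has_real_derivative_iff_has_vector_derivative[symmetric])
  thus ?thesis using assms(2) by (simp add: integral_unique)
qed

lemma antiderivative_on_unit_interval:
  fixes g :: "real \<Rightarrow> real"
  assumes "continuous_on {-1..1} g"
  obtains G where "\<And>x. x \<in> {-1..1} \<Longrightarrow> (G has_real_derivative g x) (at x within {-1..1})"
  using antiderivative_continuous[OF assms] by (auto simp: has_real_derivative_iff_has_vector_derivative)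

text \<open>Up to sign the integrands are derivatives of G (sin t) and G (cos t) for a primitive G
  of \<open>g\<close>, and these are periodic. This disposes of odd powers of y in the Melnikov
  integrand and of the odd moments of the sine.\<close>

lemma integral_sin_cos_odd:
  fixes g :: "real \<Rightarrow> real"
  assumes "continuous_on {-1..1} g"
  shows "integral {0..2 * pi} (\<lambda>t. g (sin t) * cos t) = 0"
    and "integral {0..2 * pi} (\<lambda>t. g (cos t) * sin t) = 0"
proof -
  obtain G where G: "\<And>x. x \<in> {-1..1} \<Longrightarrow> (G has_real_derivative g x) (at x within {-1..1})"
    using antiderivative_on_unit_interval[OF assms] by blast
  have chain: "((\<lambda>t. G (p t)) has_real_derivative g (p t) * p') (at t)"
    if "(p has_real_derivative p') (at t)" "\<And>t. p t \<in> {-1..1}" for p p' t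
    using DERIV_image_chain[of G _ p t UNIV] that DERIV_subset[OF G] by (auto simp: o_def image_subset_iff)
  show "integral {0..2 * pi} (\<lambda>t. g (sin t) * cos t) = 0"
    by (rule integral_2pi_antiderivative[of "\<lambda>t. G (sin t)"]) (rule chain, auto)
  have "integral {0..2 * pi} (\<lambda>t. g (cos t) * (- sin t)) = 0"
    by (rule integral_2pi_antiderivative[of "\<lambda>t. G (cos t)"]) (rule chain, auto)
  thus "integral {0..2 * pi} (\<lambda>t. g (cos t) * sin t) = 0" by simp
qed

definition sin_integral :: "real \<Rightarrow> nat \<Rightarrow> real" where
  "sin_integral c j = integral {0..2 * pi} (\<lambda>t. 1 / (1 - c * sin t) ^ j)"

lemma one_minus_mult_sin_pos:
  fixes c :: real assumes "\<bar>c\<bar> < 1" shows "1 - c * sin t > 0"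
proof -
  have "\<bar>c * sin t\<bar> \<le> \<bar>c\<bar>" by (simp add: abs_mult mult_left_le)
  thus ?thesis using assms by linarith
qed

text \<open>With s = sqrt (1 - c^2) and a = c / (1 + s), the function s / (1 - c sin t) is the
  Poisson kernel (1 - a^2) / (1 + a^2 - 2 a sin t). Minus its mean 1 it has the primitive - 2 arctan
  (a cos t / (1 - a sin t)), twice the argument of 1 - i a exp (- i t). This primitive is smooth and
  periodic, whereas the half-angle substitution would jump at odd multiples of pi.\<close>

lemma sin_integral_1:
  assumes c: "\<bar>c\<bar> < 1"
  shows "sin_integral c 1 = 2 * pi / sqrt (1 - c\<^sup>2)"
proof -
  define s where "s = sqrt (1 - c\<^sup>2)"
  have "c\<^sup>2 < 1" using c by (simp add: abs_square_less_1)
  hence s: "s > 0" "s\<^sup>2 = 1 - c\<^sup>2" by (auto simp: s_def)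
  define a where "a = c / (1 + s)"
  have "\<bar>a\<bar> < 1" using s c by (simp add: a_def field_simps)
  have w: "1 - a * sin t > 0" for t by (rule one_minus_mult_sin_pos) fact
  have c1: "c * (1 + a\<^sup>2) = 2 * a" 
  proof -
    have "c * ((1 + s)\<^sup>2 + c\<^sup>2) = 2 * c * (1 + s)" 
      using s(2) by algebra
    moreover have "c = a * (1 + s)" using s(1) by (simp add: a_def)
    ultimately have "(1 + s)\<^sup>2 * (c * (1 + a\<^sup>2)) = (1 + s)\<^sup>2 * (2 * a)" by algebra
    thus ?thesis using s(1) by simp
  qed
  have c2: "(1 - a\<^sup>2) = s * (1 + a\<^sup>2)"
  proof -
    have "(1 + s)\<^sup>2 - c\<^sup>2 = s * ((1 + s)\<^sup>2 + c\<^sup>2)" using s(2) by algebra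
    moreover have "c = a * (1 + s)" using s(1) by (simp add: a_def)
    ultimately have "(1 + s)\<^sup>2 * (1 - a\<^sup>2) = (1 + s)\<^sup>2 * (s * (1 + a\<^sup>2))" by algebra
    thus ?thesis using s(1) by simp
  qed
  have pos: "1 + a\<^sup>2 - 2 * a * sin t > 0" for t
  proof -
    have "0 < (1 - a * sin t)\<^sup>2 + (a * cos t)\<^sup>2" using w[of t] by (intro add_pos_nonneg) auto
    also have "\<dots> = 1 + a\<^sup>2 - 2 * a * sin t"
      using sin_cos_squared_add[of t] by algebra
    finally show ?thesis .
  qed
  have "integral {0..2 * pi} (\<lambda>t. (1 - a\<^sup>2) / (1 + a\<^sup>2 - 2 * a * sin t) - 1) = 0"
  proof (rule integral_2pi_antiderivative)
    fix t
    have wn: "1 - a * sin t \<noteq> 0" using w[of t] by simp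
    have q: "((\<lambda>t. a * cos t / (1 - a * sin t)) has_real_derivative
        (- a * sin t * (1 - a * sin t) - a * cos t * (- a * cos t)) / (1 - a * sin t)\<^sup>2) (at t)"
      unfolding power2_eq_square by (rule derivative_eq_intros refl wn | simp)+
    have "((\<lambda>t. - 2 * arctan (a * cos t / (1 - a * sin t))) has_real_derivative
       - 2 * ((- a * sin t * (1 - a * sin t) - a * cos t * (- a * cos t)) / (1 - a * sin t)\<^sup>2 / 
         (1 + (a * cos t / (1 - a * sin t))\<^sup>2))) (at t)"
      using DERIV_cmult[OF DERIV_chain2[OF DERIV_arctan q], of "- 2"] by (simp add: field_class.field_divide_inverse mult_ac)
    moreover have "- 2 * ((- a * sin t * (1 - a * sin t) - a * cos t * (- a * cos t)) / (1 - a * sin t)\<^sup>2 / 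
         (1 + (a * cos t / (1 - a * sin t))\<^sup>2)) = (1 - a\<^sup>2) / (1 + a\<^sup>2 - 2 * a * sin t) - 1"
    proof -
      have "(1 - a * sin t)\<^sup>2 * (1 + (a * cos t / (1 - a * sin t))\<^sup>2) = 1 + a\<^sup>2 - 2 * a * sin t"
      proof -
        have "v\<^sup>2 * (1 + (x / v)\<^sup>2) = v\<^sup>2 + x\<^sup>2" if "v \<noteq> 0" for v x :: real
          using that by (simp add: field_simps)
        from this[OF wn] have "(1 - a * sin t)\<^sup>2 * (1 + (a * cos t / (1 - a * sin t))\<^sup>2) = (1 - a * sin t)\<^sup>2 + (a * cos t)\<^sup>2" .
        thus ?thesis using sin_cos_squared_add[of t] by algebra
      qed
      moreover have "- a * sin t * (1 - a * sin t) - a * cos t * (- a * cos t) = a\<^sup>2 - a * sin t"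
        using sin_cos_squared_add[of t] by algebra
      ultimately show ?thesis using pos[of t] by (simp add: divide_divide_eq_left field_simps)
    qed
    ultimately show "((\<lambda>t. - 2 * arctan (a * cos t / (1 - a * sin t))) has_real_derivative
       (1 - a\<^sup>2) / (1 + a\<^sup>2 - 2 * a * sin t) - 1) (at t)" by simp
  qed simp
  moreover have "(1 - a\<^sup>2) / (1 + a\<^sup>2 - 2 * a * sin t) = s * (1 / (1 - c * sin t) ^ 1)" for t
  proof -
    have "1 + a\<^sup>2 - 2 * a * sin t = (1 + a\<^sup>2) * (1 - c * sin t)"
      using c1 by algebra
    moreover have "1 + a\<^sup>2 \<noteq> 0" using zero_le_power2[of a] by linarith
    ultimately show ?thesis using c2 by simp
  qed
  moreover have "(\<lambda>t. s * (1 / (1 - c * sin t) ^ 1)) integrable_on {0..2 * pi}"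
    using one_minus_mult_sin_pos[OF c]
    by (intro integrable_continuous_real continuous_intros) (auto simp: order_less_imp_not_eq2)
  ultimately have "s * sin_integral c 1 - 2 * pi = 0"
    unfolding sin_integral_def by (simp only: Henstock_Kurzweil_Integration.integral_diff integrable_const_ivl
        Henstock_Kurzweil_Integration.integral_mult_right) simp
  thus ?thesis using s(1) unfolding s_def[symmetric] by (simp add: field_simps)
qed

text \<open>The derivative of \<open>c * cos t / (1 - c * sin t) ^ Suc m\<close> integrates to zero
  over a period. With w = 1 - c sin t, the relation (c cos t)^2 = c^2 - (1 - w)^2 turns this
  derivative into powers of 1/w alone.\<close>

lemma sin_integral_rec:
  assumes c: "\<bar>c\<bar> < 1"
  shows "(real m + 1) * (1 - c\<^sup>2) * sin_integral c (Suc (Suc m)) = (2 * real m + 1) * sin_integral c (Suc m) - real m * sin_integral c m"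
proof -
  let ?w = "\<lambda>t. 1 - c * sin t"
  have w: "?w t > 0" for t by (rule one_minus_mult_sin_pos) fact
  have int: "(\<lambda>t. 1 / ?w t ^ j) integrable_on {0..2 * pi}" for j
    using w by (intro integrable_continuous_real continuous_intros) (auto simp: order_less_imp_not_eq2)
  let ?G = "\<lambda>t. (real m + 1) * (c\<^sup>2 - 1) * (1 / ?w t ^ Suc (Suc m)) + (2 * real m + 1) * (1 / ?w t ^ Suc m) - real m * (1 / ?w t ^ m)"
  have "integral {0..2 * pi} ?G = 0"
  proof (rule integral_2pi_antiderivative)
    fix t
    have "((\<lambda>t. c * cos t / ?w t ^ Suc m) has_real_derivative
      (- c * sin t * ?w t ^ Suc m - c * cos t * (real (Suc m) * (- c * cos t) * ?w t ^ m)) / (?w t ^ Suc m * ?w t ^ Suc m)) (at t)"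
      by (rule derivative_eq_intros refl | (use w[of t] in simp))+
    moreover have "(- c * sin t * ?w t ^ Suc m - c * cos t * (real (Suc m) * (- c * cos t) * ?w t ^ m)) / (?w t ^ Suc m * ?w t ^ Suc m) = ?G t"
    proof -
      define v where "v = ?w t"
      have v: "v > 0" using w by (simp add: v_def)
      have cs: "c * sin t = 1 - v" by (simp add: v_def)
      have cc: "(c * cos t)\<^sup>2 = c\<^sup>2 - (1 - v)\<^sup>2"
        unfolding cs[symmetric] using sin_cos_squared_add[of t] by algebra
      have "(- c * sin t * v ^ Suc m - c * cos t * (real (Suc m) * (- c * cos t) * v ^ m)) / (v ^ Suc m * v ^ Suc m)
         = (- (c * sin t) * v + (real m + 1) * (c * cos t)\<^sup>2) / (v * v * v ^ m)"
        using v by (simp add: field_simps power2_eq_square)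
      also have "\<dots> = (- (1 - v) * v + (real m + 1) * (c\<^sup>2 - (1 - v)\<^sup>2)) / (v * v * v ^ m)"
        by (simp only: cs cc)
      also have "\<dots> = (real m + 1) * (c\<^sup>2 - 1) * (1 / v ^ Suc (Suc m)) + (2 * real m + 1) * (1 / v ^ Suc m) - real m * (1 / v ^ m)"
        using v by (simp add: field_simps power2_eq_square)
      finally show ?thesis by (simp add: v_def)
    qed
    ultimately show "((\<lambda>t. c * cos t / ?w t ^ Suc m) has_real_derivative ?G t) (at t)" by simp
  qed simp
  moreover have "integral {0..2 * pi} ?G = (real m + 1) * (c\<^sup>2 - 1) * sin_integral c (Suc (Suc m)) + (2 * real m + 1) * sin_integral c (Suc m) - real m * sin_integral c m"
    unfolding sin_integral_def using int
    by (simp only: Henstock_Kurzweil_Integration.integral_diff Henstock_Kurzweil_Integration.integral_add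
         integrable_on_mult_right integrable_add Henstock_Kurzweil_Integration.integral_mult_right)
  ultimately show ?thesis by (simp add: algebra_simps)
qed

text \<open>The recursion divides by 1 - c^2, so each step adds two to the exponent of the square
  root in the denominator, while the numerator stays within degree \<open>j\<close>.\<close>

lemma sin_integral_closed_form:
  "\<exists>p. degree p \<le> j \<and> (\<forall>c. \<bar>c\<bar> < 1 \<longrightarrow> sin_integral c (Suc j) = poly p (c\<^sup>2) / sqrt (1 - c\<^sup>2) ^ (2 * j + 1))"
proof (induction j rule: less_induct)
  case (less j)
  have pos: "1 - c\<^sup>2 > 0" if "\<bar>c\<bar> < 1" for c :: real using that by (simp add: abs_square_less_1)
  consider "j = 0" | "j = 1" | k where "j = Suc (Suc k)" 
    by (metis One_nat_def not0_implies_Suc)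
  thus ?case
  proof cases
    case 1 thus ?thesis using sin_integral_1 by (intro exI[of _ "[:2 * pi:]"]) auto
  next
    case 2 
    have "sin_integral c 2 = 2 * pi / sqrt (1 - c\<^sup>2) ^ 3" if "\<bar>c\<bar> < 1" for c
    proof -
      have "(1 - c\<^sup>2) * sin_integral c 2 = sin_integral c 1" using sin_integral_rec[OF that, of 0] by (simp add: numeral_2_eq_2)
      hence "(sqrt (1 - c\<^sup>2))\<^sup>2 * sin_integral c 2 = 2 * pi / sqrt (1 - c\<^sup>2)" using sin_integral_1[OF that] pos[OF that] by simp
      thus ?thesis using pos[OF that] by (simp add: field_simps power2_eq_square power3_eq_cube)
    qed
    thus ?thesis using 2 by (intro exI[of _ "[:2 * pi:]"]) (auto simp: numeral_2_eq_2 numeral_3_eq_3)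
  next
    case 3
    obtain p where p: "degree p \<le> k" "\<And>c. \<bar>c\<bar> < 1 \<Longrightarrow> sin_integral c (Suc k) = poly p (c\<^sup>2) / sqrt (1 - c\<^sup>2) ^ (2 * k + 1)"
      using less[of k] 3 by auto
    obtain p' where p': "degree p' \<le> Suc k" "\<And>c. \<bar>c\<bar> < 1 \<Longrightarrow> sin_integral c (Suc (Suc k)) = poly p' (c\<^sup>2) / sqrt (1 - c\<^sup>2) ^ (2 * Suc k + 1)"
      using less[of "Suc k"] 3 by auto
    \<comment> \<open>The factor \<open>[:1, -1:]\<close> is 1 - c^2 as a polynomial in c^2; it
      brings the older integral to the denominator of the newer one.\<close>
    define r where "r = smult (1 / (real k + 2)) (smult (2 * real k + 3) p' - smult (real k + 1) ([:1, -1:] * p))"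
    have "degree ([:1, -1:] * p) \<le> Suc k" using degree_mult_le[of "[:1, -1:]" p] p(1) by simp
    hence "degree r \<le> Suc k" unfolding r_def
      by (intro order_trans[OF degree_smult_le] degree_diff_le) (use p' in \<open>auto intro: order_trans[OF degree_smult_le]\<close>)
    moreover have "sin_integral c (Suc (Suc (Suc k))) = poly r (c\<^sup>2) / sqrt (1 - c\<^sup>2) ^ (2 * Suc (Suc k) + 1)" if c: "\<bar>c\<bar> < 1" for c
    proof -
      define u where "u = sqrt (1 - c\<^sup>2)"
      have u: "u > 0" "1 - c\<^sup>2 = u\<^sup>2" using pos[OF c] by (auto simp: u_def)
      define q where "q = u ^ (2 * k + 1)"
      have q: "q > 0" using u by (simp add: q_def)
      have e: "u ^ (2 * Suc k + 1) = q * u\<^sup>2" "u ^ (2 * Suc (Suc k) + 1) = q * u\<^sup>2 * u\<^sup>2"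
        by (simp_all add: q_def power2_eq_square)
      have "(real k + 2) * u\<^sup>2 * sin_integral c (Suc (Suc (Suc k))) = (2 * real k + 3) * sin_integral c (Suc (Suc k)) - (real k + 1) * sin_integral c (Suc k)"
        using sin_integral_rec[OF c, of "Suc k"] u(2) by (simp add: algebra_simps)
      also have "\<dots> = (2 * real k + 3) * (poly p' (c\<^sup>2) / (q * u\<^sup>2)) - (real k + 1) * (poly p (c\<^sup>2) / q)"
        using p(2)[OF c] p'(2)[OF c] unfolding u_def[symmetric] q_def[symmetric] e by simp
      also have "\<dots> = ((2 * real k + 3) * poly p' (c\<^sup>2) - (real k + 1) * (u\<^sup>2 * poly p (c\<^sup>2))) / (q * u\<^sup>2)"
        using u q by (simp add: field_simps)
      also have "\<dots> = (real k + 2) * poly r (c\<^sup>2) / (q * u\<^sup>2)"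
      proof -
        have "poly r (c\<^sup>2) = 1 / (real k + 2) * ((2 * real k + 3) * poly p' (c\<^sup>2) - (real k + 1) * ((1 - c\<^sup>2) * poly p (c\<^sup>2)))"
          by (simp add: r_def left_diff_distrib)
        thus ?thesis unfolding u(2) by simp
      qed
      finally have "(real k + 2) * u\<^sup>2 * sin_integral c (Suc (Suc (Suc k))) = (real k + 2) * poly r (c\<^sup>2) / (q * u\<^sup>2)" .
      hence "(real k + 2) * (u\<^sup>2 * sin_integral c (Suc (Suc (Suc k)))) = (real k + 2) * (poly r (c\<^sup>2) / (q * u\<^sup>2))"
        by (simp only: mult.assoc times_divide_eq_right)
      hence "u\<^sup>2 * sin_integral c (Suc (Suc (Suc k))) = poly r (c\<^sup>2) / (q * u\<^sup>2)"
        by (subst (asm) mult_left_cancel) auto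
      thus ?thesis using u q unfolding u_def[symmetric] e by (simp add: field_simps)
    qed
    ultimately show ?thesis using 3 by (intro exI[of _ r]) auto
  qed
qed

section \<open>Reduction of the Melnikov integrals to a normal form\<close>

locale melnikov_params =
  fixes m1 m2 n :: nat and \<alpha>1 \<alpha>2 :: real
  assumes m: "m1 \<ge> 1" "m2 \<ge> 1" and \<alpha>_nz: "\<alpha>1 \<noteq> 0" "\<alpha>2 \<noteq> 0" and \<alpha>_ne: "\<alpha>1 \<noteq> \<alpha>2"
begin

definition "q = (n + 1) div 2"

definition "H = H0 \<alpha>1 \<alpha>2"

definition pole_integral :: "nat \<Rightarrow> nat \<Rightarrow> nat \<Rightarrow> real \<Rightarrow> real" where
  "pole_integral l i j h = integral {0..2 * pi} (\<lambda>t. (sqrt h * sin t) ^ l / ((1 - \<alpha>1 * (sqrt h * sin t)) ^ i * (1 - \<alpha>2 * (sqrt h * sin t)) ^ j))"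

abbreviation melnikov_value :: "real poly \<Rightarrow> real poly \<Rightarrow> real poly \<Rightarrow> real \<Rightarrow> real" where
  "melnikov_value P0 P1 P2 h \<equiv> poly P0 h + poly P1 h / sqrt (1 - \<alpha>1\<^sup>2 * h) ^ (2 * m1 - 1) + poly P2 h / sqrt (1 - \<alpha>2\<^sup>2 * h) ^ (2 * m2 - 1)"

text \<open>The degrees count factors. Even powers of y bring in at most the power \<open>q\<close>
  of h, and a pole of order at most m adds m - 1 over the common denominator. A polynomial part
  arises only when the total degree n + 1 reaches m1 + m2, and two degrees in (x, y) make one in h.
  The condition on \<open>P0\<close> is additive so that truncated subtraction cannot weaken
  it.\<close>

definition melnikov_form :: "(real \<Rightarrow> real) \<Rightarrow> bool" where
  "melnikov_form f \<longleftrightarrow> (\<exists>P0 P1 P2 :: real poly. (P0 = 0 \<or> 2 * degree P0 + m1 + m2 \<le> n + 1) \<and>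
     degree P1 \<le> q + m1 - 1 \<and> degree P2 \<le> q + m2 - 1 \<and>
     (\<forall>h. 0 \<le> h \<and> h < H \<longrightarrow> f h = melnikov_value P0 P1 P2 h))"

lemma alpha_h: assumes "0 \<le> h" "h < H" shows "\<bar>\<alpha>1 * sqrt h\<bar> < 1" "\<bar>\<alpha>2 * sqrt h\<bar> < 1"
proof -
  have *: "\<bar>a * sqrt h\<bar> < 1" if "a \<noteq> 0" "h < 1 / a\<^sup>2" for a
  proof -
    have "(a * sqrt h)\<^sup>2 < 1" using that assms by (simp add: power_mult_distrib field_simps)
    thus ?thesis by (simp add: abs_square_less_1)
  qed
  show "\<bar>\<alpha>1 * sqrt h\<bar> < 1" "\<bar>\<alpha>2 * sqrt h\<bar> < 1"
    by (rule *; use \<alpha>_nz assms in \<open>simp add: H_def H0_def\<close>)+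
qed

lemma melnikov_form_0: "melnikov_form (\<lambda>h. 0)"
  unfolding melnikov_form_def by (intro exI[of _ 0]) auto

lemma melnikov_form_cong: "melnikov_form f \<Longrightarrow> (\<And>h. 0 \<le> h \<Longrightarrow> h < H \<Longrightarrow> f h = g h) \<Longrightarrow> melnikov_form g"
  unfolding melnikov_form_def by (elim ex_forward conj_forward) auto

lemma melnikov_form_add:
  assumes "melnikov_form f" "melnikov_form g" shows "melnikov_form (\<lambda>h. f h + g h)"
proof -
  from assms(1)[unfolded melnikov_form_def] obtain P0 P1 P2 where f: "P0 = 0 \<or> 2 * degree P0 + m1 + m2 \<le> n + 1"
     "degree P1 \<le> q + m1 - 1" "degree P2 \<le> q + m2 - 1"
     "\<forall>h. 0 \<le> h \<and> h < H \<longrightarrow> f h = melnikov_value P0 P1 P2 h"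
    by (elim exE conjE)
  from assms(2)[unfolded melnikov_form_def] obtain R0 R1 R2 where g: "R0 = 0 \<or> 2 * degree R0 + m1 + m2 \<le> n + 1"
     "degree R1 \<le> q + m1 - 1" "degree R2 \<le> q + m2 - 1"
     "\<forall>h. 0 \<le> h \<and> h < H \<longrightarrow> g h = melnikov_value R0 R1 R2 h"
    by (elim exE conjE)
  show ?thesis unfolding melnikov_form_def
  proof (intro exI conjI)
    show "P0 + R0 = 0 \<or> 2 * degree (P0 + R0) + m1 + m2 \<le> n + 1"
      using f(1) g(1) degree_add_le_max[of P0 R0] by (cases "P0 = 0"; cases "R0 = 0") (auto simp: max_def split: if_splits)
    show "degree (P1 + R1) \<le> q + m1 - 1" "degree (P2 + R2) \<le> q + m2 - 1"
      by (intro degree_add_le f g)+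
    show "\<forall>h. 0 \<le> h \<and> h < H \<longrightarrow> f h + g h = melnikov_value (P0 + R0) (P1 + R1) (P2 + R2) h"
      using f(4) g(4) by (simp add: add_divide_distrib)
  qed
qed

lemma melnikov_form_cmult:
  assumes "melnikov_form f" shows "melnikov_form (\<lambda>h. c * f h)"
proof -
  from assms[unfolded melnikov_form_def] obtain P0 P1 P2 where f: "P0 = 0 \<or> 2 * degree P0 + m1 + m2 \<le> n + 1"
     "degree P1 \<le> q + m1 - 1" "degree P2 \<le> q + m2 - 1"
     "\<forall>h. 0 \<le> h \<and> h < H \<longrightarrow> f h = melnikov_value P0 P1 P2 h"
    by (elim exE conjE)
  show ?thesis unfolding melnikov_form_def
  proof (intro exI conjI)
    show "smult c P0 = 0 \<or> 2 * degree (smult c P0) + m1 + m2 \<le> n + 1"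
      using f(1) by auto
    show "degree (smult c P1) \<le> q + m1 - 1" "degree (smult c P2) \<le> q + m2 - 1"
      using f by auto
    show "\<forall>h. 0 \<le> h \<and> h < H \<longrightarrow> c * f h = melnikov_value (smult c P0) (smult c P1) (smult c P2) h"
      using f(4) by (simp add: distrib_left)
  qed
qed

lemma melnikov_form_sum:
  assumes "finite A" "\<And>x. x \<in> A \<Longrightarrow> melnikov_form (f x)" shows "melnikov_form (\<lambda>h. \<Sum>x\<in>A. f x h)"
  using assms by (induction rule: finite_induct) (auto intro: melnikov_form_0 melnikov_form_add)

lemma pole_integral_cont:
  assumes "0 \<le> h" "h < H"
  shows "continuous_on {0..2 * pi} (\<lambda>t. (sqrt h * sin t) ^ l / ((1 - \<alpha>1 * (sqrt h * sin t)) ^ i * (1 - \<alpha>2 * (sqrt h * sin t)) ^ j))"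
proof -
  have "1 - \<alpha>1 * (sqrt h * sin t) \<noteq> 0" "1 - \<alpha>2 * (sqrt h * sin t) \<noteq> 0" for t
    using one_minus_mult_sin_pos[OF alpha_h(1)[OF assms], of t] one_minus_mult_sin_pos[OF alpha_h(2)[OF assms], of t]
    by (simp_all add: mult.assoc)
  thus ?thesis by (intro continuous_intros) auto
qed

lemma closed_form_degree:
  assumes "degree p \<le> i" "s \<le> q" "Suc i \<le> m"
  shows "degree (monom 1 s * pcompose p [:0, a:] * [:1, b::real:] ^ (m - Suc i)) \<le> q + m - 1"
proof -
  have "degree (pcompose p [:0, a:]) \<le> i"
    using degree_pcompose_le[of p "[:0, a:]"] assms(1) by (cases "a = 0") auto
  moreover have "degree ([:1, b:] ^ (m - Suc i)) \<le> m - Suc i"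
    using degree_power_le[of "[:1, b:]" "m - Suc i"] by (auto split: if_splits intro: order_trans)
  moreover have "degree (monom (1::real) s) \<le> s" by (rule degree_monom_le)
  ultimately have "degree (monom 1 s * pcompose p [:0, a:] * [:1, b:] ^ (m - Suc i)) \<le> s + i + (m - Suc i)"
    by (meson add_mono degree_mult_le order_trans)
  thus ?thesis using assms by auto
qed

text \<open>Poles of lower order are padded with powers of 1 - a^2 h, so that all orders up to
  \<open>m\<close> share one denominator.\<close>

lemma closed_form_eq:
  assumes ah: "\<bar>a * sqrt h\<bar> < 1" and h: "0 \<le> h" and i: "Suc i \<le> m"
    and p: "\<And>c. \<bar>c\<bar> < 1 \<Longrightarrow> sin_integral c (Suc i) = poly p (c\<^sup>2) / sqrt (1 - c\<^sup>2) ^ (2 * i + 1)"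
  shows "h ^ s * sin_integral (a * sqrt h) (Suc i) =
    poly (monom 1 s * pcompose p [:0, a\<^sup>2:] * [:1, - a\<^sup>2:] ^ (m - Suc i)) h / sqrt (1 - a\<^sup>2 * h) ^ (2 * m - 1)"
proof -
  have sq: "(a * sqrt h)\<^sup>2 = a\<^sup>2 * h" using h by (simp add: power_mult_distrib)
  define u where "u = sqrt (1 - a\<^sup>2 * h)"
  have "a\<^sup>2 * h < 1" using ah unfolding sq[symmetric] by (simp add: abs_square_less_1)
  hence u: "u > 0" "u\<^sup>2 = 1 - a\<^sup>2 * h" by (auto simp: u_def)
  have e: "2 * m - 1 = (2 * i + 1) + 2 * (m - Suc i)" using i by simp
  have "sin_integral (a * sqrt h) (Suc i) = poly p (a\<^sup>2 * h) / u ^ (2 * i + 1)" using p[OF ah] by (simp add: sq u_def)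
  also have "\<dots> = poly p (a\<^sup>2 * h) * (u\<^sup>2) ^ (m - Suc i) / u ^ (2 * m - 1)"
    unfolding e power_add power_mult using u(1) by simp
  finally show ?thesis unfolding u(2) u_def[symmetric]
    by (simp add: poly_monom poly_pcompose mult_ac)
qed

lemma pole_integral_i_0: "pole_integral 0 i 0 h = sin_integral (\<alpha>1 * sqrt h) i" and pole_integral_0_j: "pole_integral 0 0 i h = sin_integral (\<alpha>2 * sqrt h) i"
  by (simp_all add: pole_integral_def sin_integral_def mult.assoc)

lemma rep_I_pole1:
  assumes "1 \<le> i" "i \<le> m1" "s \<le> q" shows "melnikov_form (\<lambda>h. h ^ s * pole_integral 0 i 0 h)"
proof -
  obtain i' where i: "i = Suc i'" using assms by (cases i) auto
  obtain p where p: "degree p \<le> i'" "\<forall>c. \<bar>c\<bar> < 1 \<longrightarrow> sin_integral c (Suc i') = poly p (c\<^sup>2) / sqrt (1 - c\<^sup>2) ^ (2 * i' + 1)"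
    using sin_integral_closed_form[of i'] by blast
  show ?thesis unfolding melnikov_form_def
    by (rule exI[of _ 0], rule exI[of _ "monom 1 s * pcompose p [:0, \<alpha>1\<^sup>2:] * [:1, - \<alpha>1\<^sup>2:] ^ (m1 - Suc i')"], rule exI[of _ 0])
      (use closed_form_degree[OF p(1) assms(3)] closed_form_eq[OF alpha_h(1), where p = p] p assms in \<open>auto simp: i pole_integral_i_0\<close>)
qed

lemma rep_I_pole2:
  assumes "1 \<le> i" "i \<le> m2" "s \<le> q" shows "melnikov_form (\<lambda>h. h ^ s * pole_integral 0 0 i h)"
proof -
  obtain i' where i: "i = Suc i'" using assms by (cases i) auto
  obtain p where p: "degree p \<le> i'" "\<forall>c. \<bar>c\<bar> < 1 \<longrightarrow> sin_integral c (Suc i') = poly p (c\<^sup>2) / sqrt (1 - c\<^sup>2) ^ (2 * i' + 1)"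
    using sin_integral_closed_form[of i'] by blast
  show ?thesis unfolding melnikov_form_def
    by (rule exI[of _ 0], rule exI[of _ 0], rule exI[of _ "monom 1 s * pcompose p [:0, \<alpha>2\<^sup>2:] * [:1, - \<alpha>2\<^sup>2:] ^ (m2 - Suc i')"])
      (use closed_form_degree[OF p(1) assms(3)] closed_form_eq[OF alpha_h(2), where p = p] p assms in \<open>auto simp: i pole_integral_0_j\<close>)
qed

text \<open>For A = 1 - \<alpha>1 x and B = 1 - \<alpha>2 x, the first identity is \<alpha>2 A -
  \<alpha>1 B = \<alpha>2 - \<alpha>1 and separates the two poles. The others are x = (1 - A) /
  \<alpha>1 and x = (1 - B) / \<alpha>2; they lower the power of x without creating new
  poles.\<close>

lemma pole_integral_partial_fraction:
  assumes h: "0 \<le> h" "h < H"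
  shows "pole_integral 0 (Suc i) (Suc j) h = \<alpha>2 / (\<alpha>2 - \<alpha>1) * pole_integral 0 i (Suc j) h + - \<alpha>1 / (\<alpha>2 - \<alpha>1) * pole_integral 0 (Suc i) j h"
    and "pole_integral (Suc l) (Suc i) j h = 1 / \<alpha>1 * pole_integral l (Suc i) j h + - 1 / \<alpha>1 * pole_integral l i j h"
    and "pole_integral (Suc l) i (Suc j) h = 1 / \<alpha>2 * pole_integral l i (Suc j) h + - 1 / \<alpha>2 * pole_integral l i j h"
proof -
  let ?x = "\<lambda>t. sqrt h * sin t"
  have nz: "1 - \<alpha>1 * ?x t > 0" "1 - \<alpha>2 * ?x t > 0" for t
    using one_minus_mult_sin_pos[OF alpha_h(1)[OF h], of t] one_minus_mult_sin_pos[OF alpha_h(2)[OF h], of t]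
    by (simp_all add: mult.assoc)
  note int = integrable_continuous_real[OF pole_integral_cont[OF h]]
  have lin: "pole_integral l i j h = c1 * pole_integral l1 i1 j1 h + c2 * pole_integral l2 i2 j2 h"
    if "\<And>x. 1 - \<alpha>1 * x > 0 \<Longrightarrow> 1 - \<alpha>2 * x > 0 \<Longrightarrow> 
          x ^ l / ((1 - \<alpha>1 * x) ^ i * (1 - \<alpha>2 * x) ^ j) =
          c1 * (x ^ l1 / ((1 - \<alpha>1 * x) ^ i1 * (1 - \<alpha>2 * x) ^ j1)) +
          c2 * (x ^ l2 / ((1 - \<alpha>1 * x) ^ i2 * (1 - \<alpha>2 * x) ^ j2))" for l i j c1 c2 l1 i1 j1 l2 i2 j2
  proof -
    have "pole_integral l i j h = integral {0..2 * pi} (\<lambda>t. c1 * (?x t ^ l1 / ((1 - \<alpha>1 * ?x t) ^ i1 * (1 - \<alpha>2 * ?x t) ^ j1)) +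
          c2 * (?x t ^ l2 / ((1 - \<alpha>1 * ?x t) ^ i2 * (1 - \<alpha>2 * ?x t) ^ j2)))"
      unfolding pole_integral_def by (intro integral_cong that nz)
    also have "\<dots> = c1 * pole_integral l1 i1 j1 h + c2 * pole_integral l2 i2 j2 h"
      unfolding pole_integral_def Henstock_Kurzweil_Integration.integral_add[OF integrable_on_mult_right[OF int] integrable_on_mult_right[OF int]]
        Henstock_Kurzweil_Integration.integral_mult_right ..
    finally show ?thesis .
  qed
  show "pole_integral 0 (Suc i) (Suc j) h = \<alpha>2 / (\<alpha>2 - \<alpha>1) * pole_integral 0 i (Suc j) h + - \<alpha>1 / (\<alpha>2 - \<alpha>1) * pole_integral 0 (Suc i) j h"
  proof (rule lin)
    fix x assume x: "1 - \<alpha>1 * x > 0" "1 - \<alpha>2 * x > 0"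
    define A B where "A = 1 - \<alpha>1 * x" and "B = 1 - \<alpha>2 * x"
    have AB: "A > 0" "B > 0" using x by (auto simp: A_def B_def)
    have "\<alpha>2 / (\<alpha>2 - \<alpha>1) * (x ^ 0 / (A ^ i * B ^ Suc j)) + - \<alpha>1 / (\<alpha>2 - \<alpha>1) * (x ^ 0 / (A ^ Suc i * B ^ j))
       = (\<alpha>2 * A - \<alpha>1 * B) / (\<alpha>2 - \<alpha>1) / (A ^ Suc i * B ^ Suc j)"
      using AB \<alpha>_ne by (simp add: divide_simps)
    also have "(\<alpha>2 * A - \<alpha>1 * B) / (\<alpha>2 - \<alpha>1) = 1" using \<alpha>_ne by (simp add: A_def B_def algebra_simps)
    finally show "x ^ 0 / ((1 - \<alpha>1 * x) ^ Suc i * (1 - \<alpha>2 * x) ^ Suc j) =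
       \<alpha>2 / (\<alpha>2 - \<alpha>1) * (x ^ 0 / ((1 - \<alpha>1 * x) ^ i * (1 - \<alpha>2 * x) ^ Suc j)) +
       - \<alpha>1 / (\<alpha>2 - \<alpha>1) * (x ^ 0 / ((1 - \<alpha>1 * x) ^ Suc i * (1 - \<alpha>2 * x) ^ j))"
      by (simp add: A_def B_def)
  qed
  show "pole_integral (Suc l) (Suc i) j h = 1 / \<alpha>1 * pole_integral l (Suc i) j h + - 1 / \<alpha>1 * pole_integral l i j h"
  proof (rule lin)
    fix x assume x: "1 - \<alpha>1 * x > 0" "1 - \<alpha>2 * x > 0"
    define A B X where "A = 1 - \<alpha>1 * x" and "B = (1 - \<alpha>2 * x) ^ j" and "X = x ^ l"
    have AB: "A > 0" "B > 0" "x = (1 - A) / \<alpha>1" using x \<alpha>_nz by (auto simp: A_def B_def)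
    have "x * X / (A ^ Suc i * B) = 1 / \<alpha>1 * (X / (A ^ Suc i * B)) + - 1 / \<alpha>1 * (X / (A ^ i * B))"
      unfolding AB(3) using AB(1,2) \<alpha>_nz by (simp add: divide_simps) (simp add: algebra_simps)
    thus "x ^ Suc l / ((1 - \<alpha>1 * x) ^ Suc i * (1 - \<alpha>2 * x) ^ j) =
       1 / \<alpha>1 * (x ^ l / ((1 - \<alpha>1 * x) ^ Suc i * (1 - \<alpha>2 * x) ^ j)) +
       - 1 / \<alpha>1 * (x ^ l / ((1 - \<alpha>1 * x) ^ i * (1 - \<alpha>2 * x) ^ j))"
      by (simp only: A_def B_def X_def power_Suc)
  qed
  show "pole_integral (Suc l) i (Suc j) h = 1 / \<alpha>2 * pole_integral l i (Suc j) h + - 1 / \<alpha>2 * pole_integral l i j h"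
  proof (rule lin)
    fix x assume x: "1 - \<alpha>1 * x > 0" "1 - \<alpha>2 * x > 0"
    define A B X where "A = 1 - \<alpha>2 * x" and "B = (1 - \<alpha>1 * x) ^ i" and "X = x ^ l"
    have AB: "A > 0" "B > 0" "x = (1 - A) / \<alpha>2" using x \<alpha>_nz by (auto simp: A_def B_def)
    have "x * X / (B * A ^ Suc j) = 1 / \<alpha>2 * (X / (B * A ^ Suc j)) + - 1 / \<alpha>2 * (X / (B * A ^ j))"
      unfolding AB(3) using AB(1,2) \<alpha>_nz by (simp add: divide_simps) (simp add: algebra_simps)
    thus "x ^ Suc l / ((1 - \<alpha>1 * x) ^ i * (1 - \<alpha>2 * x) ^ Suc j) =
       1 / \<alpha>2 * (x ^ l / ((1 - \<alpha>1 * x) ^ i * (1 - \<alpha>2 * x) ^ Suc j)) +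
       - 1 / \<alpha>2 * (x ^ l / ((1 - \<alpha>1 * x) ^ i * (1 - \<alpha>2 * x) ^ j))"
      by (simp only: A_def B_def X_def power_Suc)
  qed
qed

lemma melnikov_form_lin2:
  assumes "melnikov_form (\<lambda>h. h ^ s * f h)" "melnikov_form (\<lambda>h. h ^ s * g h)"
    and "\<And>h. 0 \<le> h \<Longrightarrow> h < H \<Longrightarrow> k h = c * f h + d * g h"
  shows "melnikov_form (\<lambda>h. h ^ s * k h)"
  using melnikov_form_add[OF melnikov_form_cmult[OF assms(1), of c] melnikov_form_cmult[OF assms(2), of d]]
  by (rule melnikov_form_cong) (simp add: assms(3) algebra_simps)

text \<open>Separation of the poles stops at a single pole, whose closed form is known. The case i =
  j = 0 is kept apart because it belongs to the polynomial part, which obeys its own degree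
  condition.\<close>

lemma rep_I_0:
  assumes "i \<le> m1" "j \<le> m2" "i + j > 0" "s \<le> q" shows "melnikov_form (\<lambda>h. h ^ s * pole_integral 0 i j h)"
  using assms
proof (induction "i + j" arbitrary: i j rule: less_induct)
  case less
  consider "j = 0" | "i = 0" | i' j' where "i = Suc i'" "j = Suc j'" by (metis not0_implies_Suc)
  thus ?case
  proof cases
    case 1 thus ?thesis using less.prems rep_I_pole1[of i s] by auto
  next
    case 2 thus ?thesis using less.prems rep_I_pole2[of j s] by auto
  next
    case 3
    have r: "melnikov_form (\<lambda>h. h ^ s * pole_integral 0 i' j h)" "melnikov_form (\<lambda>h. h ^ s * pole_integral 0 i j' h)"
      using 3 less.prems by (auto intro!: less.hyps)
    show ?thesis unfolding 3
      by (rule melnikov_form_lin2[OF r(1)[unfolded 3] r(2)[unfolded 3] pole_integral_partial_fraction(1)])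
  qed
qed

lemma melnikov_form_moment:
  assumes "l + 2 * s + m1 + m2 \<le> n + 1"
  shows "melnikov_form (\<lambda>h. h ^ s * pole_integral l 0 0 h)"
proof (cases "even l")
  case True
  then obtain k where l: "l = 2 * k" by (elim evenE)
  define c where "c = integral {0..2 * pi} (\<lambda>t. sin t ^ l)"
  have "pole_integral l 0 0 h = c * h ^ k" if "0 \<le> h" for h
    using that by (simp add: pole_integral_def power_mult_distrib c_def l power_mult)
  thus ?thesis unfolding melnikov_form_def using assms degree_monom_le[of c "s + k"]
    by (intro exI[of _ "monom c (s + k)"] exI[of _ 0]) (auto simp: poly_monom power_add l)
next
  case False
  then obtain k where l: "l = Suc (2 * k)" by (elim oddE) auto
  have "integral {0..2 * pi} (\<lambda>t. sin t ^ l) = integral {0..2 * pi} (\<lambda>t. (1 - cos t ^ 2) ^ k * sin t)"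
    by (intro integral_cong) (simp add: l sin_squared_eq[symmetric] flip: power_mult)
  also have "\<dots> = 0" by (rule integral_sin_cos_odd(2)[of "\<lambda>x. (1 - x ^ 2) ^ k"]) (intro continuous_intros)
  finally have "pole_integral l 0 0 h = 0" for h by (simp add: pole_integral_def power_mult_distrib)
  thus ?thesis using melnikov_form_0 by simp
qed

text \<open>The first hypothesis is an invariant of the reduction: each step lowers \<open>l\<close>
  by one and lowers at most one of \<open>i\<close> and \<open>j\<close>, by one. Once both poles
  are gone it is exactly the degree condition of \<open>melnikov_form_moment\<close>; for i = m1 and
  j = m2 it says l + 2 s \<le> n + 1.\<close>

lemma rep_I:
  assumes "l + 2 * s + m1 + m2 \<le> n + 1 + i + j" "i \<le> m1" "j \<le> m2" "s \<le> q"
  shows "melnikov_form (\<lambda>h. h ^ s * pole_integral l i j h)"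
  using assms
proof (induction l arbitrary: i j)
  case 0
  thus ?case using rep_I_0[of i j s] melnikov_form_moment[of 0 s] by (cases "i + j = 0") auto
next
  case (Suc l)
  show ?case
  proof (cases i)
    case (Suc i')
    have r: "melnikov_form (\<lambda>h. h ^ s * pole_integral l i j h)" "melnikov_form (\<lambda>h. h ^ s * pole_integral l i' j h)"
      using Suc Suc.prems by (auto intro!: Suc.IH)
    show ?thesis unfolding Suc
      by (rule melnikov_form_lin2[OF r(1)[unfolded Suc] r(2) pole_integral_partial_fraction(2)])
  next
    case 0
    show ?thesis
    proof (cases j)
      case (Suc j')
      have r: "melnikov_form (\<lambda>h. h ^ s * pole_integral l i j h)" "melnikov_form (\<lambda>h. h ^ s * pole_integral l i j' h)"
        using Suc Suc.prems by (auto intro!: Suc.IH)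
      show ?thesis unfolding Suc
        by (rule melnikov_form_lin2[OF r(1)[unfolded Suc] r(2) pole_integral_partial_fraction(3)])
    next
      case 0
      thus ?thesis using \<open>i = 0\<close> Suc.prems melnikov_form_moment[of "Suc l" s] by auto
    qed
  qed
qed

end

context melnikov_params begin

definition monomial_integral :: "nat \<Rightarrow> nat \<Rightarrow> real \<Rightarrow> real" where
  "monomial_integral l k h = integral {0..2 * pi} (\<lambda>t. (sqrt h * sin t) ^ l * (sqrt h * cos t) ^ k / den m1 m2 \<alpha>1 \<alpha>2 (sqrt h * sin t))"

lemma den_pos:
  assumes "0 \<le> h" "h < H" shows "den m1 m2 \<alpha>1 \<alpha>2 (sqrt h * sin t) > 0"
  using one_minus_mult_sin_pos[OF alpha_h(1)[OF assms], of t] one_minus_mult_sin_pos[OF alpha_h(2)[OF assms], of t]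
  by (simp add: den_def mult.assoc)

lemma monomial_integral_cont:
  assumes "0 \<le> h" "h < H"
  shows "continuous_on S (\<lambda>t. (sqrt h * sin t) ^ l * (sqrt h * cos t) ^ k / den m1 m2 \<alpha>1 \<alpha>2 (sqrt h * sin t))"
proof -
  have "den m1 m2 \<alpha>1 \<alpha>2 (sqrt h * sin t) \<noteq> 0" for t using den_pos[OF assms, of t] by simp
  thus ?thesis unfolding den_def by (intro continuous_intros) auto
qed

text \<open>An even power of y is a polynomial in h and x by y^2 = h - x^2. An odd power leaves a
  single cosine beside a function of the sine, and the integral vanishes.\<close>

lemma rep_E:
  assumes "l + k \<le> n + 1" shows "melnikov_form (monomial_integral l k)"
proof (cases "even k")
  case True
  then obtain p where k: "k = 2 * p" by (elim evenE)
  have "melnikov_form (\<lambda>h. \<Sum>s\<le>p. (real (p choose s) * (-1) ^ (p - s)) * (h ^ s * pole_integral (l + 2 * (p - s)) m1 m2 h))"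
    by (intro melnikov_form_sum melnikov_form_cmult rep_I) (use assms in \<open>auto simp: k q_def\<close>)
  thus ?thesis
  proof (rule melnikov_form_cong)
    fix h assume h: "0 \<le> h" "h < H"
    let ?x = "\<lambda>t. sqrt h * sin t" and ?y = "\<lambda>t. sqrt h * cos t"
    let ?D = "\<lambda>t. (1 - \<alpha>1 * ?x t) ^ m1 * (1 - \<alpha>2 * ?x t) ^ m2"
    have y2: "?y t ^ 2 = h + - ((?x t)\<^sup>2)" for t
      using h by (simp add: power_mult_distrib cos_squared_eq right_diff_distrib)
    have "?x t ^ l * ?y t ^ k / den m1 m2 \<alpha>1 \<alpha>2 (?x t) = 
      (\<Sum>s\<le>p. (real (p choose s) * (-1) ^ (p - s)) * h ^ s * (?x t ^ (l + 2 * (p - s)) / ?D t))" for t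
    proof -
      have "?y t ^ k = (\<Sum>s\<le>p. real (p choose s) * h ^ s * (- ((?x t)\<^sup>2)) ^ (p - s))"
        unfolding k power_mult y2 binomial_ring ..
      also have "\<dots> = (\<Sum>s\<le>p. real (p choose s) * (-1) ^ (p - s) * h ^ s * ?x t ^ (2 * (p - s)))"
        by (intro sum.cong refl) (subst power_minus, simp add: power_mult)
      finally show ?thesis
        by (simp add: den_def sum_distrib_left sum_divide_distrib power_add mult_ac)
    qed
    hence "monomial_integral l k h = integral {0..2 * pi} (\<lambda>t. \<Sum>s\<le>p. (real (p choose s) * (-1) ^ (p - s)) * h ^ s * (?x t ^ (l + 2 * (p - s)) / ?D t))"
      by (simp add: monomial_integral_def)
    also have "\<dots> = (\<Sum>s\<le>p. integral {0..2 * pi} (\<lambda>t. (real (p choose s) * (-1) ^ (p - s)) * h ^ s * (?x t ^ (l + 2 * (p - s)) / ?D t)))"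
      by (intro integral_sum integrable_on_mult_right integrable_continuous_real pole_integral_cont h finite_atMost)
    also have "\<dots> = (\<Sum>s\<le>p. (real (p choose s) * (-1) ^ (p - s)) * (h ^ s * pole_integral (l + 2 * (p - s)) m1 m2 h))"
      unfolding Henstock_Kurzweil_Integration.integral_mult_right pole_integral_def by (simp add: mult.assoc)
    finally show "(\<Sum>s\<le>p. (real (p choose s) * (-1) ^ (p - s)) * (h ^ s * pole_integral (l + 2 * (p - s)) m1 m2 h)) = monomial_integral l k h" ..
  qed
next
  case False
  then obtain p where k: "k = Suc (2 * p)" by (elim oddE) auto
  have "monomial_integral l k h = 0" if h: "0 \<le> h" "h < H" for h
  proof -
    let ?g = "\<lambda>s. (sqrt h * s) ^ l * (sqrt h * (h * (1 - s\<^sup>2)) ^ p) / den m1 m2 \<alpha>1 \<alpha>2 (sqrt h * s)"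
    have "sqrt h ^ 2 = h" using h by simp
    hence "(sqrt h * cos t) ^ k = sqrt h * (h * (1 - (sin t)\<^sup>2)) ^ p * cos t" for t
      by (simp add: k power_mult power_mult_distrib cos_squared_eq)
    hence "monomial_integral l k h = integral {0..2 * pi} (\<lambda>t. ?g (sin t) * cos t)"
      by (simp add: monomial_integral_def mult_ac)
    also have "\<dots> = 0"
    proof (rule integral_sin_cos_odd(1))
      \<comment> \<open>Positivity of the denominator is available at sines only; every s in [-1, 1]
        is the sine of \<open>arcsin s\<close>.\<close>
      have "den m1 m2 \<alpha>1 \<alpha>2 (sqrt h * s) \<noteq> 0" if "s \<in> {-1..1}" for s
        using den_pos[OF h, of "arcsin s"] that by simp
      thus "continuous_on {- 1..1} ?g" unfolding den_def by (intro continuous_intros) auto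
    qed
    finally show ?thesis .
  qed
  note zero = this
  show ?thesis by (rule melnikov_form_cong[OF melnikov_form_0]) (simp add: zero)
qed

lemma melnikov_form_melnikov: "melnikov_form (melnikov m1 m2 \<alpha>1 \<alpha>2 n a b)"
proof -
  have "melnikov_form (\<lambda>h. \<Sum>p\<in>index_set n. a (fst p) (snd p) * monomial_integral (fst p + 1) (snd p) h + b (fst p) (snd p) * monomial_integral (fst p) (snd p + 1) h)"
    by (intro melnikov_form_sum melnikov_form_add melnikov_form_cmult rep_E finite_index_set) (auto simp: index_set_def)
  thus ?thesis
  proof (rule melnikov_form_cong)
    fix h assume h: "0 \<le> h" "h < H"
    let ?x = "\<lambda>t. sqrt h * sin t" and ?y = "\<lambda>t. sqrt h * cos t"
    let ?e = "\<lambda>l k t. ?x t ^ l * ?y t ^ k / den m1 m2 \<alpha>1 \<alpha>2 (?x t)"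
    have int: "?e l k integrable_on {0..2 * pi}" for l k
      by (intro integrable_continuous_real monomial_integral_cont h)
    have "melnikov m1 m2 \<alpha>1 \<alpha>2 n a b h = integral {0..2 * pi} (\<lambda>t. \<Sum>p\<in>index_set n.
       a (fst p) (snd p) * ?e (fst p + 1) (snd p) t + b (fst p) (snd p) * ?e (fst p) (snd p + 1) t)"
      unfolding melnikov_def Let_def
      by (intro integral_cong) (simp add: sum_distrib_left sum_divide_distrib split_beta add_divide_distrib mult_ac)
    also have "\<dots> = (\<Sum>p\<in>index_set n. integral {0..2 * pi} (\<lambda>t.
       a (fst p) (snd p) * ?e (fst p + 1) (snd p) t + b (fst p) (snd p) * ?e (fst p) (snd p + 1) t))"
      by (intro integral_sum integrable_add integrable_on_mult_right int finite_index_set)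
    also have "\<dots> = (\<Sum>p\<in>index_set n. a (fst p) (snd p) * monomial_integral (fst p + 1) (snd p) h + b (fst p) (snd p) * monomial_integral (fst p) (snd p + 1) h)"
      unfolding monomial_integral_def Henstock_Kurzweil_Integration.integral_add[OF integrable_on_mult_right[OF int] integrable_on_mult_right[OF int]]
        Henstock_Kurzweil_Integration.integral_mult_right ..
    finally show "(\<Sum>p\<in>index_set n. a (fst p) (snd p) * monomial_integral (fst p + 1) (snd p) h + b (fst p) (snd p) * monomial_integral (fst p) (snd p + 1) h)
      = melnikov m1 m2 \<alpha>1 \<alpha>2 n a b h" ..
  qed
qed

end

section \<open>Elimination of the square roots\<close>

lemma poly_map_poly_of_real:
  "poly (map_poly of_real p) (of_real x) = (of_real (poly p x) :: 'a :: {comm_ring_1, real_algebra_1})"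
  by (induction p) (auto simp: map_poly_pCons)

lemma order_power:
  fixes p :: "'a::idom poly"
  assumes "p \<noteq> 0" shows "order a (p ^ k) = k * order a p"
  by (induction k) (use assms in \<open>auto simp: order_mult order_root\<close>)

text \<open>Parity of the order at 1/\<gamma>: it is even for the squares, and the linear factor
  adds the odd number \<open>k\<close> while \<open>C\<close> adds nothing.\<close>

lemma odd_power_linear_not_square:
  fixes A B C :: "real poly"
  assumes eq: "B\<^sup>2 = A\<^sup>2 * [:1, - \<gamma>:] ^ k * C" and \<gamma>: "\<gamma> \<noteq> 0" and k: "odd k" and C: "poly C (1 / \<gamma>) \<noteq> 0"
  shows "A = 0"
proof (rule ccontr)
  assume A: "A \<noteq> 0"
  have C0: "C \<noteq> 0" using C by auto
  have B: "B \<noteq> 0" using eq A C0 by auto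
  have "order (1 / \<gamma>) [:1, - \<gamma>:] = 1"
  proof -
    have "[:1, - \<gamma>:] = smult (- \<gamma>) [:- (1 / \<gamma>), 1:]" using \<gamma> by simp
    moreover have "- \<gamma> \<noteq> 0" using \<gamma> by simp
    ultimately have "order (1 / \<gamma>) [:1, - \<gamma>:] = order (1 / \<gamma>) [:- (1 / \<gamma>), 1:]"
      by (metis order_smult)
    thus ?thesis using order_power_n_n[of "1 / \<gamma>" 1] by simp
  qed
  moreover have "order (1 / \<gamma>) C = 0" using C by (simp add: order_root C0)
  ultimately have "order (1 / \<gamma>) (A\<^sup>2 * [:1, - \<gamma>:] ^ k * C) = 2 * order (1 / \<gamma>) A + k"
    using A C0 by (simp add: order_mult power2_eq_square order_power)
  moreover have "order (1 / \<gamma>) (B\<^sup>2) = 2 * order (1 / \<gamma>) B"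
    using B by (simp add: power2_eq_square order_mult)
  ultimately show False using eq k by (metis dvd_triv_left even_add)
qed


context melnikov_params begin

text \<open>The distance from the origin to the nearer of the lines x = 1/\<alpha>1 and x =
  1/\<alpha>2. With h = z^2, it is the radius of the complex disc to which the Melnikov function
  extends holomorphically.\<close>

definition "\<sigma> = sqrt H"

lemma sigma_pos: "\<sigma> > 0"
  using \<alpha>_nz by (simp add: \<sigma>_def H_def H0_def)

lemma alpha_sigma: assumes "r < \<sigma>" "0 \<le> r" shows "\<bar>\<alpha>1\<bar> * r < 1" "\<bar>\<alpha>2\<bar> * r < 1"
proof -
  have "r\<^sup>2 < H" using assms by (metis \<sigma>_def real_less_rsqrt real_sqrt_less_iff real_sqrt_unique)
  with alpha_h[of "r\<^sup>2"] assms show "\<bar>\<alpha>1\<bar> * r < 1" "\<bar>\<alpha>2\<bar> * r < 1" by (simp_all add: abs_mult)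
qed

text \<open>On the disc a^2 z^2 has modulus below 1, so the radicand has positive real part and the
  principal root stays away from its cut.\<close>

lemma csqrt_factor:
  assumes a: "\<And>r. 0 \<le> r \<Longrightarrow> r < \<sigma> \<Longrightarrow> \<bar>a\<bar> * r < 1"
  shows "(\<lambda>z. csqrt (1 - of_real (a\<^sup>2) * z\<^sup>2)) holomorphic_on ball 0 \<sigma>"
    and "\<And>r. 0 \<le> r \<Longrightarrow> r < \<sigma> \<Longrightarrow> csqrt (1 - of_real (a\<^sup>2) * (of_real r)\<^sup>2) = of_real (sqrt (1 - a\<^sup>2 * r\<^sup>2))"
proof -
  have lt: "a\<^sup>2 * r\<^sup>2 < 1" if "0 \<le> r" "r < \<sigma>" for r
  proof -
    have "(\<bar>a\<bar> * r)\<^sup>2 < 1" using a[OF that] that by (simp add: power_less_one_iff abs_square_less_1)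
    thus ?thesis by (simp add: power_mult_distrib)
  qed
  have "1 - of_real (a\<^sup>2) * z\<^sup>2 \<notin> \<real>\<^sub>\<le>\<^sub>0" if "z \<in> ball 0 \<sigma>" for z :: complex
  proof -
    have "Re (of_real (a\<^sup>2) * z\<^sup>2) \<le> norm (of_real (a\<^sup>2) * z\<^sup>2)" by (rule complex_Re_le_cmod)
    also have "\<dots> = a\<^sup>2 * (norm z)\<^sup>2" by (simp add: norm_mult norm_power)
    also have "\<dots> < 1" using lt[of "norm z"] that by simp
    finally have "Re (1 - of_real (a\<^sup>2) * z\<^sup>2) > 0" by simp
    thus ?thesis by (auto simp: complex_nonpos_Reals_iff)
  qed
  thus "(\<lambda>z. csqrt (1 - of_real (a\<^sup>2) * z\<^sup>2)) holomorphic_on ball 0 \<sigma>"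
    by (intro holomorphic_intros) auto
  fix r assume r: "0 \<le> r" "r < \<sigma>"
  have "1 - of_real (a\<^sup>2) * (of_real r)\<^sup>2 = (of_real (1 - a\<^sup>2 * r\<^sup>2) :: complex)" by simp
  moreover have "1 - a\<^sup>2 * r\<^sup>2 \<ge> 0" using lt[OF r] by simp
  ultimately show "csqrt (1 - of_real (a\<^sup>2) * (of_real r)\<^sup>2) = of_real (sqrt (1 - a\<^sup>2 * r\<^sup>2))"
    using csqrt_of_real by metis
qed


text \<open>The polynomial is the product of \<open>P\<^sub>0 u\<^sup>a v\<^sup>b \<plusminus> P\<^sub>1 v\<^sup>b \<plusminus> P\<^sub>2 u\<^sup>a\<close> over all four signs. Its discriminant-like shape
  \<open>(X - Y - Z)\<^sup>2 - 4 Y Z\<close> shows that it vanishes only for \<open>P\<^sub>0 = P\<^sub>1 = P\<^sub>2 = 0\<close>: the order of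
  \<open>Y Z\<close> at the root of \<open>1 - \<alpha>1\<^sup>2 h\<close> is odd. If \<open>\<alpha>1 = - \<alpha>2\<close>, then \<open>u = v\<close> and two conjugates suffice.\<close>

lemma norm_polynomial:
  assumes "melnikov_form f" and f: "0 \<le> h0" "h0 < H" "f h0 \<noteq> 0"
  obtains N :: "real poly" and G where "N \<noteq> 0" "degree N \<le> 4 * (q + m1 + m2) - 6"
    "G holomorphic_on ball 0 \<sigma>"
    "\<And>r. 0 \<le> r \<Longrightarrow> r < \<sigma> \<Longrightarrow> complex_of_real (poly N (r\<^sup>2)) = of_real (f (r\<^sup>2)) * G (of_real r)"
proof -
  from assms(1)[unfolded melnikov_form_def] obtain P0 P1 P2 where P: "P0 = 0 \<or> 2 * degree P0 + m1 + m2 \<le> n + 1"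
     "degree P1 \<le> q + m1 - 1" "degree P2 \<le> q + m2 - 1"
     "\<forall>h. 0 \<le> h \<and> h < H \<longrightarrow> f h = melnikov_value P0 P1 P2 h"
    by (elim exE conjE)
  define U W where "U = [:1, - \<alpha>1\<^sup>2:]" and "W = [:1, - \<alpha>2\<^sup>2:]"
  have degU: "degree (U ^ k) \<le> k" and degW: "degree (W ^ k) \<le> k" for k
    using degree_power_le[of U k] degree_power_le[of W k] by (auto simp: U_def W_def split: if_splits intro: order_trans)
  have n_q: "n \<le> 2 * q" by (simp add: q_def)
  define u v where "u r = sqrt (1 - \<alpha>1\<^sup>2 * r\<^sup>2)" and "v r = sqrt (1 - \<alpha>2\<^sup>2 * r\<^sup>2)" for r :: real
  define cu cv where "cu z = csqrt (1 - of_real (\<alpha>1\<^sup>2) * z\<^sup>2)" and "cv z = csqrt (1 - of_real (\<alpha>2\<^sup>2) * z\<^sup>2)" for z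
  have hol: "cu holomorphic_on ball 0 \<sigma>" "cv holomorphic_on ball 0 \<sigma>"
    using csqrt_factor(1) alpha_sigma by (auto simp: cu_def[abs_def] cv_def[abs_def])
  have cu_r: "cu (of_real r) = of_real (u r)" and cv_r: "cv (of_real r) = of_real (v r)" if "0 \<le> r" "r < \<sigma>" for r
    using csqrt_factor(2) alpha_sigma that by (auto simp: cu_def cv_def u_def v_def)
  have uv: "u r > 0" "v r > 0" "(u r)\<^sup>2 = poly U (r\<^sup>2)" "(v r)\<^sup>2 = poly W (r\<^sup>2)" if "0 \<le> r" "r < \<sigma>" for r
  proof -
    have "\<bar>\<bar>\<alpha>1\<bar> * r\<bar> < 1" "\<bar>\<bar>\<alpha>2\<bar> * r\<bar> < 1" using alpha_sigma that by (auto simp: abs_mult)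
    hence "\<alpha>1\<^sup>2 * r\<^sup>2 < 1" "\<alpha>2\<^sup>2 * r\<^sup>2 < 1"
      unfolding abs_square_less_1[symmetric] by (simp_all add: power_mult_distrib)
    thus "u r > 0" "v r > 0" "(u r)\<^sup>2 = poly U (r\<^sup>2)" "(v r)\<^sup>2 = poly W (r\<^sup>2)"
      by (auto simp: u_def v_def U_def W_def mult.commute)
  qed
  have H: "r\<^sup>2 < H" if "0 \<le> r" "r < \<sigma>" for r
    using that by (metis \<sigma>_def real_less_rsqrt real_sqrt_less_iff real_sqrt_unique)
  have f_r: "f (r\<^sup>2) = poly P0 (r\<^sup>2) + poly P1 (r\<^sup>2) / u r ^ (2 * m1 - 1) + poly P2 (r\<^sup>2) / v r ^ (2 * m2 - 1)"
    if "0 \<le> r" "r < \<sigma>" for r using P(4) H[OF that] by (simp add: u_def v_def)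
  have polyhol: "(\<lambda>z. poly (map_poly of_real p) (z\<^sup>2) :: complex) holomorphic_on S" for p :: "real poly" and S
    by (intro holomorphic_intros)
  have polyr: "poly (map_poly complex_of_real p) ((of_real r)\<^sup>2) = of_real (poly p (r\<^sup>2))" for p r
    unfolding of_real_power[symmetric] by (rule poly_map_poly_of_real)
  show ?thesis
  proof (cases "\<alpha>1\<^sup>2 = \<alpha>2\<^sup>2")
    case False
    define a b where "a = 2 * m1 - 1" and "b = 2 * m2 - 1"
    have ab: "odd a" "odd b" using m by (auto simp: a_def b_def)
    define X Y Z where "X = P0\<^sup>2 * U ^ a * W ^ b" and "Y = P1\<^sup>2 * W ^ b" and "Z = P2\<^sup>2 * U ^ a"
    define N where "N = (X - Y - Z)\<^sup>2 - 4 * Y * Z"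
    \<comment> \<open>Half of the target degree. The tight terms are \<open>Y\<close> and
      \<open>Z\<close>: 2 (q + m1 - 1) + (2 m2 - 1) = 2 (q + m1 + m2) - 3, and symmetrically. For
      \<open>X\<close> the degree condition on \<open>P0\<close> leaves room because m1 + m2 is at
      least 2.\<close>
    define D where "D = 2 * (q + m1 + m2) - 3"
    have dX: "degree X \<le> D"
    proof (cases "P0 = 0")
      case False
      have "degree X \<le> degree (P0\<^sup>2) + degree (U ^ a) + degree (W ^ b)"
        unfolding X_def by (meson add_mono degree_mult_le order_refl order_trans)
      also have "\<dots> \<le> 2 * degree P0 + a + b"
        using degree_power_le[of P0 2] degU[of a] degW[of b] by simp
      also have "\<dots> \<le> D" using P(1) False n_q m by (auto simp: a_def b_def D_def)
      finally show ?thesis .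
    qed (simp add: X_def)
    have dY: "degree Y \<le> D"
    proof -
      have "degree Y \<le> degree (P1\<^sup>2) + degree (W ^ b)" unfolding Y_def by (rule degree_mult_le)
      also have "\<dots> \<le> 2 * (q + m1 - 1) + b"
        using degree_power_le[of P1 2] P(2) degW[of b] by simp
      also have "\<dots> \<le> D" using m by (auto simp: b_def D_def)
      finally show ?thesis .
    qed
    have dZ: "degree Z \<le> D"
    proof -
      have "degree Z \<le> degree (P2\<^sup>2) + degree (U ^ a)" unfolding Z_def by (rule degree_mult_le)
      also have "\<dots> \<le> 2 * (q + m2 - 1) + a"
        using degree_power_le[of P2 2] P(3) degU[of a] by simp
      also have "\<dots> \<le> D" using m by (auto simp: a_def D_def)
      finally show ?thesis .
    qed
    have "degree (X - Y - Z) \<le> D" by (intro degree_diff_le dX dY dZ)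
    hence 1: "degree ((X - Y - Z)\<^sup>2) \<le> 2 * D"
      using degree_power_le[of "X - Y - Z" 2] by simp
    have "degree (4 * Y * Z) \<le> degree (4 * Y) + degree Z" by (rule degree_mult_le)
    moreover have "degree (4 * Y) \<le> degree (4 :: real poly) + degree Y" by (rule degree_mult_le)
    ultimately have 2: "degree (4 * Y * Z) \<le> 2 * D" using dY dZ by simp
    have degN: "degree N \<le> 2 * D" unfolding N_def by (rule degree_diff_le[OF 1 2])
    have N0: "N \<noteq> 0"
    proof
      assume "N = 0"
      \<comment> \<open>A square equals a square times \<open>U ^ a * W ^ b\<close>. At the root of
        \<open>U\<close> the factor \<open>W\<close> does not vanish, since the squares of \<alpha>1
        and \<alpha>2 differ, and the odd exponent \<open>a\<close> forces
        \<open>P1 * P2 = 0\<close>. The same parity argument, for whichever of \<open>P1\<close> and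
        \<open>P2\<close> may remain, then removes \<open>P0\<close> and that one too.\<close>
      hence sq: "(X - Y - Z)\<^sup>2 = (2 * P1 * P2)\<^sup>2 * U ^ a * W ^ b"
        by (simp add: N_def Y_def Z_def power_mult_distrib mult_ac)
      have pW: "poly W (1 / \<alpha>1\<^sup>2) \<noteq> 0" using False \<alpha>_nz by (simp add: W_def field_simps)
      have "2 * P1 * P2 = 0"
        by (rule odd_power_linear_not_square[OF sq[unfolded U_def]]) (use \<alpha>_nz ab pW in auto)
      hence P12: "P1 = 0 \<or> P2 = 0" by auto
      hence X: "X = Y + Z" using sq by (auto simp: Y_def Z_def)
      have "P0 = 0 \<and> P1 = 0 \<and> P2 = 0"
      proof (cases "P2 = 0")
        case True
        have "W ^ b \<noteq> 0" by (auto simp: W_def)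
        hence "P1\<^sup>2 = P0\<^sup>2 * U ^ a * 1" using X True by (auto simp: X_def Y_def Z_def)
        hence "P0 = 0" unfolding U_def by (rule odd_power_linear_not_square) (use \<alpha>_nz ab in auto)
        thus ?thesis using \<open>P1\<^sup>2 = P0\<^sup>2 * U ^ a * 1\<close> True by auto
      next
        case False
        hence "P1 = 0" using P12 by auto
        have "U ^ a \<noteq> 0" by (auto simp: U_def)
        hence "P2\<^sup>2 = P0\<^sup>2 * W ^ b * 1" using X \<open>P1 = 0\<close> by (auto simp: X_def Y_def Z_def)
        hence "P0 = 0" unfolding W_def by (rule odd_power_linear_not_square) (use \<alpha>_nz ab in auto)
        thus ?thesis using \<open>P2\<^sup>2 = P0\<^sup>2 * W ^ b * 1\<close> \<open>P1 = 0\<close> by auto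
      qed
      thus False using P(4) f by auto
    qed
    define A B C where "A z = poly (map_poly of_real P0) (z\<^sup>2) * cu z ^ a * cv z ^ b"
      and "B z = poly (map_poly of_real P1) (z\<^sup>2) * cv z ^ b"
      and "C z = poly (map_poly of_real P2) (z\<^sup>2) * cu z ^ a" for z
    have "A holomorphic_on ball 0 \<sigma>" "B holomorphic_on ball 0 \<sigma>" "C holomorphic_on ball 0 \<sigma>"
      unfolding A_def[abs_def] B_def[abs_def] C_def[abs_def] by (intro holomorphic_on_mult holomorphic_on_power polyhol hol)+
    note ABC = this
    show ?thesis
    proof (rule that[OF N0])
      show "degree N \<le> 4 * (q + m1 + m2) - 6" using degN by (simp add: D_def)
      \<comment> \<open>The cofactor consists of the three other conjugates and of the product that
        clears the denominators of \<open>f\<close>.\<close>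
      show "(\<lambda>z. cu z ^ a * cv z ^ b * ((A z - B z - C z) * (A z - B z + C z) * (A z + B z - C z))) holomorphic_on ball 0 \<sigma>"
        by (intro holomorphic_intros hol ABC)
      fix r assume r: "0 \<le> r" "r < \<sigma>"
      define A' B' C' where "A' = poly P0 (r\<^sup>2) * u r ^ a * v r ^ b" and "B' = poly P1 (r\<^sup>2) * v r ^ b" and "C' = poly P2 (r\<^sup>2) * u r ^ a"
      have abc: "A (of_real r) = of_real A'" "B (of_real r) = of_real B'" "C (of_real r) = of_real C'"
        by (simp_all add: A_def B_def C_def A'_def B'_def C'_def polyr cu_r[OF r] cv_r[OF r])
      have p: "(u r ^ a)\<^sup>2 = poly (U ^ a) (r\<^sup>2)" "(v r ^ b)\<^sup>2 = poly (W ^ b) (r\<^sup>2)"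
        unfolding poly_power uv(3,4)[OF r, symmetric] by (simp_all add: power_mult[symmetric] mult.commute)
      have XYZ: "poly X (r\<^sup>2) = A'\<^sup>2" "poly Y (r\<^sup>2) = B'\<^sup>2" "poly Z (r\<^sup>2) = C'\<^sup>2"
        unfolding X_def Y_def Z_def A'_def B'_def C'_def poly_mult power_mult_distrib p by (simp_all only: poly_power)
      have fr: "f (r\<^sup>2) * (u r ^ a * v r ^ b) = A' + B' + C'"
      proof -
        have "(x + y / U + z / V) * (U * V) = x * U * V + y * V + z * U" if "U > 0" "V > 0" for x y z U V :: real
          using that by (simp add: field_simps)
        thus ?thesis using uv(1,2)[OF r] unfolding f_r[OF r] A'_def B'_def C'_def a_def b_def by simp
      qed
      have "poly N (r\<^sup>2) = (A'\<^sup>2 - B'\<^sup>2 - C'\<^sup>2)\<^sup>2 - 4 * B'\<^sup>2 * C'\<^sup>2"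
        by (simp add: N_def XYZ)
      also have "\<dots> = (A' + B' + C') * ((A' - B' - C') * (A' - B' + C') * (A' + B' - C'))"
        by (simp add: power2_eq_square algebra_simps)
      also have "\<dots> = f (r\<^sup>2) * (u r ^ a * v r ^ b * ((A' - B' - C') * (A' - B' + C') * (A' + B' - C')))"
        unfolding fr[symmetric] by (simp only: mult.assoc)
      finally have "poly N (r\<^sup>2) = f (r\<^sup>2) * (u r ^ a * v r ^ b * ((A' - B' - C') * (A' - B' + C') * (A' + B' - C')))" .
      thus "complex_of_real (poly N (r\<^sup>2)) = of_real (f (r\<^sup>2)) * (cu (of_real r) ^ a * cv (of_real r) ^ b *
          ((A (of_real r) - B (of_real r) - C (of_real r)) * (A (of_real r) - B (of_real r) + C (of_real r)) * (A (of_real r) + B (of_real r) - C (of_real r))))"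
        by (simp only: abc cu_r[OF r] cv_r[OF r] of_real_mult of_real_diff of_real_add of_real_power)
    qed
  next
    case True
    define M where "M = max m1 m2"
    define c where "c = 2 * M - 1"
    have M: "M \<ge> 1" "m1 \<le> M" "m2 \<le> M" "M \<le> m1 + m2 - 1" using m by (auto simp: M_def)
    have c: "odd c" using M by (auto simp: c_def)
    \<comment> \<open>Here the two square roots coincide, so \<open>P1\<close> and \<open>P2\<close>
      merge into one numerator over the larger of the two denominators.\<close>
    define S where "S = P1 * U ^ (M - m1) + P2 * U ^ (M - m2)"
    define N where "N = P0\<^sup>2 * U ^ c - S\<^sup>2"
    have "degree S \<le> q + M - 1"
      unfolding S_def using P(2,3) degU[of "M - m1"] degU[of "M - m2"] M m
      by (intro degree_add_le order_trans[OF degree_mult_le]) auto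
    hence "degree (S\<^sup>2) \<le> 2 * (q + M - 1)"
      using degree_power_le[of S 2] by simp
    hence dS: "degree (S\<^sup>2) \<le> 4 * (q + m1 + m2) - 6" using M m by simp
    have dP: "degree (P0\<^sup>2 * U ^ c) \<le> 4 * (q + m1 + m2) - 6"
    proof (cases "P0 = 0")
      case False
      have "degree (P0\<^sup>2 * U ^ c) \<le> degree (P0\<^sup>2) + degree (U ^ c)" by (rule degree_mult_le)
      also have "\<dots> \<le> 2 * degree P0 + c" using degree_power_le[of P0 2] degU[of c] by simp
      also have "\<dots> \<le> 4 * (q + m1 + m2) - 6" using P(1) False n_q M m by (auto simp: c_def)
      finally show ?thesis .
    qed simp
    have eqS: "f (r\<^sup>2) = poly P0 (r\<^sup>2) + poly S (r\<^sup>2) / u r ^ c" if r: "0 \<le> r" "r < \<sigma>" for r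
    proof -
      have v: "v r = u r" using True by (simp add: u_def v_def)
      have *: "x / u r ^ (2 * k - 1) = x * poly (U ^ (M - k)) (r\<^sup>2) / u r ^ c" if "1 \<le> k" "k \<le> M" for x k
      proof -
        have "poly (U ^ (M - k)) (r\<^sup>2) = u r ^ (2 * (M - k))" by (simp add: uv(3)[OF r, symmetric] power_mult)
        moreover have "c = (2 * k - 1) + 2 * (M - k)" using that by (simp add: c_def)
        ultimately show ?thesis using uv[OF r] by (simp add: power_add)
      qed
      show ?thesis using *[of m1] *[of m2] M m f_r[OF r]
        by (simp add: S_def v add_divide_distrib)
    qed
    have N0: "N \<noteq> 0"
    proof
      assume "N = 0"
      hence sq: "S\<^sup>2 = P0\<^sup>2 * U ^ c * 1" by (simp add: N_def)
      have "P0 = 0" using sq[unfolded U_def] by (rule odd_power_linear_not_square) (use \<alpha>_nz c in auto)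
      hence "S = 0" using sq by simp
      moreover have "sqrt h0 < \<sigma>" "0 \<le> sqrt h0" "(sqrt h0)\<^sup>2 = h0" using f by (auto simp: \<sigma>_def)
      ultimately show False using eqS[of "sqrt h0"] f \<open>P0 = 0\<close> by simp
    qed
    show ?thesis
    proof (rule that[OF N0])
      show "degree N \<le> 4 * (q + m1 + m2) - 6" unfolding N_def by (rule degree_diff_le[OF dP dS])
      show "(\<lambda>z. cu z ^ c * (poly (map_poly of_real P0) (z\<^sup>2) * cu z ^ c - poly (map_poly of_real S) (z\<^sup>2))) holomorphic_on ball 0 \<sigma>"
        by (intro holomorphic_on_mult holomorphic_on_diff holomorphic_on_power polyhol hol)
      fix r assume r: "0 \<le> r" "r < \<sigma>"
      have p: "poly (U ^ c) (r\<^sup>2) = (u r ^ c)\<^sup>2"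
        unfolding poly_power uv(3)[OF r, symmetric] by (simp add: power_mult[symmetric] mult.commute)
      have fr: "f (r\<^sup>2) * u r ^ c = poly P0 (r\<^sup>2) * u r ^ c + poly S (r\<^sup>2)"
        using uv(1)[OF r] by (simp add: eqS[OF r] field_simps)
      have "poly N (r\<^sup>2) = (poly P0 (r\<^sup>2))\<^sup>2 * (u r ^ c)\<^sup>2 - (poly S (r\<^sup>2))\<^sup>2"
        unfolding N_def poly_diff poly_mult p by (simp only: poly_power)
      also have "\<dots> = (poly P0 (r\<^sup>2) * u r ^ c + poly S (r\<^sup>2)) * (poly P0 (r\<^sup>2) * u r ^ c - poly S (r\<^sup>2))"
        by (simp add: power2_eq_square algebra_simps)
      also have "\<dots> = f (r\<^sup>2) * (u r ^ c * (poly P0 (r\<^sup>2) * u r ^ c - poly S (r\<^sup>2)))"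
        unfolding fr[symmetric] by (simp only: mult.assoc)
      finally have "poly N (r\<^sup>2) = f (r\<^sup>2) * (u r ^ c * (poly P0 (r\<^sup>2) * u r ^ c - poly S (r\<^sup>2)))" .
      thus "complex_of_real (poly N (r\<^sup>2)) = of_real (f (r\<^sup>2)) * (cu (of_real r) ^ c *
          (poly (map_poly of_real P0) ((of_real r)\<^sup>2) * cu (of_real r) ^ c - poly (map_poly of_real S) ((of_real r)\<^sup>2)))"
        by (simp only: cu_r[OF r] polyr of_real_mult of_real_diff of_real_power)
    qed
  qed
qed

end

section \<open>Complexification of the perturbed field\<close>

text \<open>The Lipschitz estimate of a product needs the sup bounds of both factors. One constant
  for both properties makes the class closed under products, with constant 2 B C.\<close>

definition bounded_Lipschitz :: "(complex \<times> complex) set \<Rightarrow> real \<Rightarrow> (complex \<times> complex \<Rightarrow> complex) \<Rightarrow> bool" where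
  "bounded_Lipschitz S B f \<longleftrightarrow> (\<forall>p\<in>S. norm (f p) \<le> B) \<and>
     (\<forall>p\<in>S. \<forall>p'\<in>S. norm (f p - f p') \<le> B * (norm (fst p - fst p') + norm (snd p - snd p')))"

lemma bounded_Lipschitz_mult:
  assumes f: "bounded_Lipschitz S B f" and g: "bounded_Lipschitz S C g" and BC: "B \<ge> 0" "C \<ge> 0"
  shows "bounded_Lipschitz S (2 * B * C) (\<lambda>p. f p * g p)"
  unfolding bounded_Lipschitz_def
proof (intro conjI ballI)
  fix p assume p: "p \<in> S"
  have "norm (f p * g p) \<le> B * C"
    unfolding norm_mult using f g p BC by (intro mult_mono) (auto simp: bounded_Lipschitz_def)
  also have "B * C \<le> 2 * B * C" using BC by simp
  finally show "norm (f p * g p) \<le> 2 * B * C" .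
  fix p' assume p': "p' \<in> S"
  let ?d = "norm (fst p - fst p') + norm (snd p - snd p')"
  have "f p * g p - f p' * g p' = f p * (g p - g p') + (f p - f p') * g p'" by (simp add: algebra_simps)
  also have "norm \<dots> \<le> norm (f p) * norm (g p - g p') + norm (f p - f p') * norm (g p')"
    by (metis norm_mult norm_triangle_ineq)
  also have "\<dots> \<le> B * (C * ?d) + (B * ?d) * C"
    using f g p p' BC by (intro add_mono mult_mono) (auto simp: bounded_Lipschitz_def)
  finally show "norm (f p * g p - f p' * g p') \<le> 2 * B * C * ?d" by (simp add: algebra_simps)
qed

lemma bounded_Lipschitz_const: "bounded_Lipschitz S (norm c) (\<lambda>_. c)"
  by (simp add: bounded_Lipschitz_def)

lemma ex_bounded_Lipschitz_power:
  assumes f: "bounded_Lipschitz S B f" and B: "B \<ge> 0"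
  shows "\<exists>C\<ge>0. bounded_Lipschitz S C (\<lambda>p. f p ^ k)"
proof (induction k)
  case 0 show ?case using bounded_Lipschitz_const[of S 1] by (intro exI[of _ 1]) auto
next
  case (Suc k)
  then obtain C where "C \<ge> 0" "bounded_Lipschitz S C (\<lambda>p. f p ^ k)" by blast
  thus ?case using bounded_Lipschitz_mult[OF f _ B, of C "\<lambda>p. f p ^ k"] B
    by (intro exI[of _ "2 * B * C"]) auto
qed

context melnikov_params begin

definition cden :: "complex \<Rightarrow> complex" where
  "cden x = (1 - of_real \<alpha>1 * x) ^ m1 * (1 - of_real \<alpha>2 * x) ^ m2"

definition cquot :: "(nat \<Rightarrow> nat \<Rightarrow> real) \<Rightarrow> complex \<Rightarrow> complex \<Rightarrow> complex" where
  "cquot c x y = (\<Sum>(i, j)\<in>index_set n. of_real (c i j) * x ^ i * y ^ j) / cden x"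

definition rquot :: "(nat \<Rightarrow> nat \<Rightarrow> real) \<Rightarrow> real \<Rightarrow> real \<Rightarrow> real" where
  "rquot c x y = (\<Sum>(i, j)\<in>index_set n. c i j * x ^ i * y ^ j) / den m1 m2 \<alpha>1 \<alpha>2 x"

lemma cquot_of_real: "cquot c (of_real x) (of_real y) = of_real (rquot c x y)"
  by (simp add: cquot_def rquot_def cden_def den_def split_beta)

text \<open>It has to contain both the complex discs and the real points of \<open>V\<close>, which
  may lie beyond a singular line. In general it is not convex, so Lipschitz bounds on it are derived
  algebraically and not from derivatives.\<close>

definition pole_free_box :: "real \<Rightarrow> real \<Rightarrow> (complex \<times> complex) set" where
  "pole_free_box \<delta> R = {(x, y). \<delta> \<le> norm (1 - of_real \<alpha>1 * x) \<and> \<delta> \<le> norm (1 - of_real \<alpha>2 * x) \<and> norm x \<le> R \<and> norm y \<le> R}"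

lemma bounded_Lipschitz_inverse:
  fixes a :: real
  assumes \<delta>: "\<delta> > 0" and S: "\<And>p. p \<in> S \<Longrightarrow> \<delta> \<le> norm (1 - of_real a * fst p)"
  shows "bounded_Lipschitz S (1 / \<delta> + \<bar>a\<bar> / \<delta>\<^sup>2) (\<lambda>p. inverse (1 - of_real a * fst p))"
  unfolding bounded_Lipschitz_def
proof (intro conjI ballI)
  fix p assume p: "p \<in> S"
  have "norm (inverse (1 - of_real a * fst p)) \<le> 1 / \<delta>"
    using le_imp_inverse_le[OF S[OF p] \<delta>] by (simp only: norm_inverse) (simp add: inverse_eq_divide)
  thus "norm (inverse (1 - of_real a * fst p)) \<le> 1 / \<delta> + \<bar>a\<bar> / \<delta>\<^sup>2"
    using \<delta> by (meson abs_ge_zero add_increasing2 divide_nonneg_pos zero_less_power)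
  fix p' assume p': "p' \<in> S"
  let ?d = "norm (fst p - fst p') + norm (snd p - snd p')"
  let ?v = "1 - of_real a * fst p" and ?w = "1 - of_real a * fst p'"
  have nz: "?v \<noteq> 0" "?w \<noteq> 0" using S[OF p] S[OF p'] \<delta> by auto
  have "inverse ?v - inverse ?w = (?w - ?v) / (?v * ?w)" using nz by (simp add: field_simps)
  also have "?w - ?v = of_real a * (fst p - fst p')" by (simp add: algebra_simps)
  finally have "norm (inverse ?v - inverse ?w) = \<bar>a\<bar> * norm (fst p - fst p') / (norm ?v * norm ?w)"
    by (simp add: norm_mult norm_divide)
  also have "\<dots> \<le> \<bar>a\<bar> * ?d / (\<delta> * \<delta>)"
    using S[OF p] S[OF p'] \<delta> by (intro frac_le mult_mono mult_left_mono) auto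
  also have "\<dots> = \<bar>a\<bar> / \<delta>\<^sup>2 * ?d" by (simp add: power2_eq_square)
  also have "\<dots> \<le> (1 / \<delta> + \<bar>a\<bar> / \<delta>\<^sup>2) * ?d"
    using \<delta> by (intro mult_right_mono) auto
  finally show "norm (inverse ?v - inverse ?w) \<le> (1 / \<delta> + \<bar>a\<bar> / \<delta>\<^sup>2) * ?d" .
qed

lemma monomial_bounded_Lipschitz:
  assumes "\<delta> > 0"
  shows "\<exists>B\<ge>0. bounded_Lipschitz (pole_free_box \<delta> R) B (\<lambda>p. fst p ^ i * snd p ^ j / cden (fst p))"
proof -
  have R: "bounded_Lipschitz (pole_free_box \<delta> R) (1 + \<bar>R\<bar>) fst" "bounded_Lipschitz (pole_free_box \<delta> R) (1 + \<bar>R\<bar>) snd"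
  proof -
    have 1: "x \<le> (1 + \<bar>R\<bar>) * (x + y)" "y \<le> (1 + \<bar>R\<bar>) * (x + y)" if "0 \<le> x" "0 \<le> y" for x y
      using mult_right_mono[of 1 "1 + \<bar>R\<bar>" "x + y"] that by auto
    have 2: "x \<le> 1 + \<bar>R\<bar>" if "x \<le> R" for x using that by linarith
    show "bounded_Lipschitz (pole_free_box \<delta> R) (1 + \<bar>R\<bar>) fst" "bounded_Lipschitz (pole_free_box \<delta> R) (1 + \<bar>R\<bar>) snd"
      unfolding bounded_Lipschitz_def using 1 2 by (auto simp: pole_free_box_def)
  qed
  have R0: "0 \<le> 1 + \<bar>R\<bar>" by simp
  obtain B1 where B1: "B1 \<ge> 0" "bounded_Lipschitz (pole_free_box \<delta> R) B1 (\<lambda>p. fst p ^ i)"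
    using ex_bounded_Lipschitz_power[OF R(1) R0] by blast
  obtain B2 where B2: "B2 \<ge> 0" "bounded_Lipschitz (pole_free_box \<delta> R) B2 (\<lambda>p. snd p ^ j)"
    using ex_bounded_Lipschitz_power[OF R(2) R0] by blast
  have I: "\<exists>B\<ge>0. bounded_Lipschitz (pole_free_box \<delta> R) B (\<lambda>p. inverse (1 - of_real a * fst p) ^ k)" if "a = \<alpha>1 \<or> a = \<alpha>2" for a k
    by (rule ex_bounded_Lipschitz_power[OF bounded_Lipschitz_inverse[OF assms]])
      (use that assms in \<open>auto simp: pole_free_box_def\<close>)
  obtain B3 where B3: "B3 \<ge> 0" "bounded_Lipschitz (pole_free_box \<delta> R) B3 (\<lambda>p. inverse (1 - of_real \<alpha>1 * fst p) ^ m1)"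
    using I[of \<alpha>1 m1] by blast
  obtain B4 where B4: "B4 \<ge> 0" "bounded_Lipschitz (pole_free_box \<delta> R) B4 (\<lambda>p. inverse (1 - of_real \<alpha>2 * fst p) ^ m2)"
    using I[of \<alpha>2 m2] by blast
  have "bounded_Lipschitz (pole_free_box \<delta> R) (2 * (2 * B1 * B2) * (2 * B3 * B4)) (\<lambda>p. (fst p ^ i * snd p ^ j) * (inverse (1 - of_real \<alpha>1 * fst p) ^ m1 * inverse (1 - of_real \<alpha>2 * fst p) ^ m2))"
    using B1 B2 B3 B4 by (intro bounded_Lipschitz_mult) auto
  moreover have "(fst p ^ i * snd p ^ j) * (inverse (1 - of_real \<alpha>1 * fst p) ^ m1 * inverse (1 - of_real \<alpha>2 * fst p) ^ m2)
     = fst p ^ i * snd p ^ j / cden (fst p)" for p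
    by (simp add: cden_def divide_inverse power_inverse)
  ultimately show ?thesis using B1 B2 B3 B4 by (intro exI[of _ "2 * (2 * B1 * B2) * (2 * B3 * B4)"]) auto
qed

text \<open>The quotient is linear in its coefficients, so \<open>L\<close> can be chosen before
  them and only their size \<kappa> enters. This is used with \<kappa> = K for constants that are
  uniform over the box, and with small \<kappa> for the difference of two coefficient
  families.\<close>

lemma cquot_bounds:
  assumes "\<delta> > 0"
  obtains L where "L > 0"
    and "\<And>c \<kappa> x y. (\<And>i j. i + j \<le> n \<Longrightarrow> \<bar>c i j\<bar> \<le> \<kappa>) \<Longrightarrow> (x, y) \<in> pole_free_box \<delta> R \<Longrightarrow> norm (cquot c x y) \<le> \<kappa> * L"
    and "\<And>c \<kappa> x y x' y'. (\<And>i j. i + j \<le> n \<Longrightarrow> \<bar>c i j\<bar> \<le> \<kappa>) \<Longrightarrow> (x, y) \<in> pole_free_box \<delta> R \<Longrightarrow> (x', y') \<in> pole_free_box \<delta> R \<Longrightarrow>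
        norm (cquot c x y - cquot c x' y') \<le> \<kappa> * L * (norm (x - x') + norm (y - y'))"
proof -
  let ?e = "\<lambda>i j p. fst p ^ i * snd p ^ j / cden (fst p)"
  have "\<forall>i j. \<exists>B\<ge>0. bounded_Lipschitz (pole_free_box \<delta> R) B (?e i j)"
    using monomial_bounded_Lipschitz[OF assms] by blast
  then obtain B where B: "\<And>i j. B i j \<ge> 0" "\<And>i j. bounded_Lipschitz (pole_free_box \<delta> R) (B i j) (?e i j)" by metis
  define L where "L = 1 + (\<Sum>q\<in>index_set n. B (fst q) (snd q))"
  have L: "L > 0" unfolding L_def using B(1) by (intro add_pos_nonneg sum_nonneg) auto
  have cquot_eq: "cquot c x y = (\<Sum>q\<in>index_set n. of_real (c (fst q) (snd q)) * ?e (fst q) (snd q) (x, y))" for c x y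
    by (simp add: cquot_def split_beta sum_divide_distrib mult.assoc)
  have est: "norm (\<Sum>q\<in>index_set n. of_real (c (fst q) (snd q)) * g (fst q) (snd q)) \<le> \<kappa> * L * d"
    if c: "\<And>i j. i + j \<le> n \<Longrightarrow> \<bar>c i j\<bar> \<le> \<kappa>" and g: "\<And>i j. norm (g i j :: complex) \<le> B i j * d" and d: "d \<ge> 0"
    for c \<kappa> g d
  proof -
    have \<kappa>: "\<kappa> \<ge> 0" using c[of 0 0] by auto
    have "norm (\<Sum>q\<in>index_set n. of_real (c (fst q) (snd q)) * g (fst q) (snd q)) \<le> (\<Sum>q\<in>index_set n. \<kappa> * (B (fst q) (snd q) * d))"
    proof (rule sum_norm_le)
      fix q assume "q \<in> index_set n"
      hence "\<bar>c (fst q) (snd q)\<bar> \<le> \<kappa>" using c by (auto simp: index_set_def)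
      thus "norm (of_real (c (fst q) (snd q)) * g (fst q) (snd q)) \<le> \<kappa> * (B (fst q) (snd q) * d)"
        unfolding norm_mult norm_of_real by (intro mult_mono g) (use \<kappa> in auto)
    qed
    also have "\<dots> = \<kappa> * d * (\<Sum>q\<in>index_set n. B (fst q) (snd q))"
      by (simp add: sum_distrib_left mult_ac)
    also have "\<dots> \<le> \<kappa> * d * L" unfolding L_def using \<kappa> d by (intro mult_left_mono) auto
    finally show ?thesis by (simp add: mult_ac)
  qed
  show ?thesis
  proof (rule that[OF L])
    fix c :: "nat \<Rightarrow> nat \<Rightarrow> real" and \<kappa> and x y :: complex
    assume c: "\<And>i j. i + j \<le> n \<Longrightarrow> \<bar>c i j\<bar> \<le> \<kappa>" and xy: "(x, y) \<in> pole_free_box \<delta> R"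
    show "norm (cquot c x y) \<le> \<kappa> * L"
    proof -
      have "norm (?e i j (x, y)) \<le> B i j * 1" for i j
        using B(2)[of i j] xy unfolding bounded_Lipschitz_def by fastforce
      note g1 = this
      have "norm (\<Sum>q\<in>index_set n. of_real (c (fst q) (snd q)) * ?e (fst q) (snd q) (x, y)) \<le> \<kappa> * L * 1"
        by (rule est[where c = c and \<kappa> = \<kappa> and g = "\<lambda>i j. ?e i j (x, y)" and d = 1], erule c, rule g1, simp)
      thus ?thesis unfolding cquot_eq by (simp only: mult_1_right)
    qed
    fix x' y' :: complex assume xy': "(x', y') \<in> pole_free_box \<delta> R"
    have "cquot c x y - cquot c x' y' = (\<Sum>q\<in>index_set n. of_real (c (fst q) (snd q)) * (?e (fst q) (snd q) (x, y) - ?e (fst q) (snd q) (x', y')))"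
      unfolding cquot_eq by (simp add: sum_subtractf right_diff_distrib)
    also have "norm \<dots> \<le> \<kappa> * L * (norm (x - x') + norm (y - y'))"
    proof (rule est[where c = c and \<kappa> = \<kappa> and g = "\<lambda>i j. ?e i j (x, y) - ?e i j (x', y')"])
      show "i + j \<le> n \<Longrightarrow> \<bar>c i j\<bar> \<le> \<kappa>" for i j by (rule c)
      fix i j show "norm (?e i j (x, y) - ?e i j (x', y')) \<le> B i j * (norm (x - x') + norm (y - y'))"
        using B(2)[of i j] xy xy' unfolding bounded_Lipschitz_def by fastforce
    qed auto
    finally show "norm (cquot c x y - cquot c x' y') \<le> \<kappa> * L * (norm (x - x') + norm (y - y'))" .
  qed
qed

lemma cquot_diff: "cquot (\<lambda>i j. c i j - c' i j) x y = cquot c x y - cquot c' x y"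
  by (simp add: cquot_def split_beta sum_subtractf left_diff_distrib diff_divide_distrib)

lemma disc_alpha: 
  fixes z :: complex
  assumes "norm z < \<sigma>" shows "norm (of_real \<alpha>1 * z) < 1" "norm (of_real \<alpha>2 * z) < 1"
  using alpha_sigma[of "norm z"] assms by (auto simp: norm_mult)

lemma cden_nz:
  assumes "norm z < \<sigma>" shows "cden z \<noteq> 0"
  using disc_alpha[OF assms] by (auto simp: cden_def)

lemma norm_mult_sin_cos_le: "norm (z * complex_of_real (sin t)) \<le> norm z" "norm (z * complex_of_real (cos t)) \<le> norm z"
  by (simp_all add: norm_mult mult_left_le)

lemma cquot_polar_holomorphic:
  assumes "norm x0 + R \<le> \<sigma>"
  shows "(\<lambda>r. cquot c (x0 + r * of_real (sin t)) (y0 + r * of_real (cos t))) holomorphic_on ball 0 R"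
proof -
  have "cden (x0 + r * of_real (sin t)) \<noteq> 0" if "r \<in> ball 0 R" for r
    using norm_triangle_ineq[of x0 "r * of_real (sin t)"] norm_mult_sin_cos_le(1)[of r t] that assms
    by (intro cden_nz) auto
  thus ?thesis unfolding cquot_def split_beta cden_def by (intro holomorphic_intros) auto
qed

lemma cquot_polar_continuous:
  assumes "norm x0 + R \<le> \<sigma>"
  shows "continuous_on (S \<times> ball 0 R) (\<lambda>p. cquot c (x0 + snd p * of_real (sin (fst p))) (y0 + snd p * of_real (cos (fst p))))"
proof -
  have "cden (x0 + r * of_real (sin t)) \<noteq> 0" if "r \<in> ball 0 R" for r t
    using norm_triangle_ineq[of x0 "r * of_real (sin t)"] norm_mult_sin_cos_le(1)[of r t] that assms
    by (intro cden_nz) auto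
  thus ?thesis unfolding cquot_def split_beta cden_def by (intro continuous_intros) (auto simp: cden_def)
qed

section \<open>The complex Melnikov function\<close>

text \<open>For z = r > 0 this is the Melnikov function at r^2 divided by r: the factor r common to
  x and y in its integrand is dropped, as the first-order change of the radius requires.\<close>

definition cmelnikov :: "(nat \<Rightarrow> nat \<Rightarrow> real) \<Rightarrow> (nat \<Rightarrow> nat \<Rightarrow> real) \<Rightarrow> complex \<Rightarrow> complex" where
  "cmelnikov a b z = integral {0..2 * pi} (\<lambda>t. of_real (sin t) * cquot a (z * of_real (sin t)) (z * of_real (cos t)) +
                                       of_real (cos t) * cquot b (z * of_real (sin t)) (z * of_real (cos t)))"

lemma cmelnikov_integrand_continuous:
  "continuous_on ({0..2 * pi} \<times> ball 0 \<sigma>) (\<lambda>(t, z). of_real (sin t) * cquot a (z * of_real (sin t)) (z * of_real (cos t)) +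
                                       of_real (cos t) * cquot b (z * of_real (sin t)) (z * of_real (cos t)))"
  unfolding split_beta
  by (intro continuous_intros cquot_polar_continuous[of 0 \<sigma> _ _ 0, simplified])

lemma cmelnikov_holomorphic: "cmelnikov a b holomorphic_on ball 0 \<sigma>"
  unfolding cmelnikov_def[abs_def]
proof (rule holomorphic_on_param_integral[OF cmelnikov_integrand_continuous])
  fix t show "(\<lambda>z. of_real (sin t) * cquot a (z * of_real (sin t)) (z * of_real (cos t)) +
             of_real (cos t) * cquot b (z * of_real (sin t)) (z * of_real (cos t))) holomorphic_on ball 0 \<sigma>"
    by (intro holomorphic_intros cquot_polar_holomorphic[of 0 \<sigma> _ _ 0, simplified])
qed

lemma cmelnikov_of_real:
  assumes r: "0 \<le> r" "r < \<sigma>"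
  shows "of_real r * cmelnikov a b (of_real r) = of_real (melnikov m1 m2 \<alpha>1 \<alpha>2 n a b (r\<^sup>2))"
proof -
  have H: "r\<^sup>2 < H" using r by (metis \<sigma>_def real_less_rsqrt real_sqrt_less_iff real_sqrt_unique)
  let ?g = "\<lambda>t. (r * sin t) * rquot a (r * sin t) (r * cos t) + (r * cos t) * rquot b (r * sin t) (r * cos t)"
  have mel: "melnikov m1 m2 \<alpha>1 \<alpha>2 n a b (r\<^sup>2) = integral {0..2 * pi} ?g"
    unfolding melnikov_def using r
    by (intro integral_cong) (simp add: Let_def rquot_def split_beta sum.distrib sum_distrib_left distrib_left sum_divide_distrib mult_ac)
  have "den m1 m2 \<alpha>1 \<alpha>2 (r * sin t) \<noteq> 0" for t
    using den_pos[of "r\<^sup>2" t] H r by simp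
  hence "continuous_on {0..2 * pi} ?g"
    unfolding rquot_def split_beta den_def by (intro continuous_intros) auto
  hence "(?g has_integral integral {0..2 * pi} ?g) {0..2 * pi}"
    using integrable_continuous_real integrable_integral by blast
  hence "((\<lambda>t. of_real (?g t)) has_integral complex_of_real (integral {0..2 * pi} ?g)) {0..2 * pi}"
    by (rule has_integral_of_real)
  hence "complex_of_real (integral {0..2 * pi} ?g) = integral {0..2 * pi} (\<lambda>t. of_real (?g t))"
    by (rule integral_unique[symmetric])
  also have "\<dots> = integral {0..2 * pi} (\<lambda>t. of_real r * (of_real (sin t) * cquot a (of_real r * of_real (sin t)) (of_real r * of_real (cos t)) +
                                       of_real (cos t) * cquot b (of_real r * of_real (sin t)) (of_real r * of_real (cos t))))"
    by (intro integral_cong) (simp flip: of_real_mult add: cquot_of_real, simp add: algebra_simps)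
  finally show ?thesis by (simp add: cmelnikov_def mel)
qed

text \<open>The real identity holds for 0 \<le> r < \<sigma>, a set with limit point 0, and analytic
  continuation spreads it over the disc. Substituting z^2 for h doubles the degree.\<close>

lemma norm_polynomial_complex:
  assumes "0 \<le> h0" "h0 < H" "melnikov m1 m2 \<alpha>1 \<alpha>2 n a b h0 \<noteq> 0"
  obtains P :: "complex poly" and G where "P \<noteq> 0" "degree P \<le> 2 * (4 * (q + m1 + m2) - 6)"
    "G holomorphic_on ball 0 \<sigma>" "\<And>z. z \<in> ball 0 \<sigma> \<Longrightarrow> poly P z = z * cmelnikov a b z * G z"
proof -
  obtain N :: "real poly" and G where N: "N \<noteq> 0" "degree N \<le> 4 * (q + m1 + m2) - 6"
    "G holomorphic_on ball 0 \<sigma>"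
    "\<And>r. 0 \<le> r \<Longrightarrow> r < \<sigma> \<Longrightarrow> complex_of_real (poly N (r\<^sup>2)) = of_real (melnikov m1 m2 \<alpha>1 \<alpha>2 n a b (r\<^sup>2)) * G (of_real r)"
    using norm_polynomial[OF melnikov_form_melnikov assms] by blast
  define P where "P = pcompose (map_poly complex_of_real N) [:0, 0, 1:]"
  have polyP: "poly P z = poly (map_poly of_real N) (z\<^sup>2)" for z
    by (simp add: P_def poly_pcompose power2_eq_square)
  have "P \<noteq> 0"
  proof
    assume "P = 0"
    hence "poly N (r\<^sup>2) = 0" for r
      using polyP[of "of_real r"] poly_map_poly_of_real[of N "r\<^sup>2", where 'a = complex] by simp
    hence "poly N x = 0" if "x \<ge> 0" for x using that by (metis real_sqrt_pow2)
    hence "{0..} \<subseteq> {x. poly N x = 0}" by auto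
    moreover have "infinite {0::real..}" by (rule infinite_Ici)
    ultimately show False using poly_roots_finite[OF N(1)] finite_subset by blast
  qed
  moreover have "degree P \<le> 2 * (4 * (q + m1 + m2) - 6)"
  proof -
    have "degree P \<le> degree (map_poly complex_of_real N) * 2"
      unfolding P_def using degree_pcompose_le[of "map_poly complex_of_real N" "[:0, 0, 1:]"] by simp
    also have "degree (map_poly complex_of_real N) \<le> degree N" by (simp add: degree_map_poly)
    finally show ?thesis using N(2) by simp
  qed
  moreover have "poly P z = z * cmelnikov a b z * G z" if z: "z \<in> ball 0 \<sigma>" for z
  proof -
    have "poly P z - z * cmelnikov a b z * G z = 0"
    proof (rule analytic_continuation[of "\<lambda>z. poly P z - z * cmelnikov a b z * G z" "ball 0 \<sigma>" "of_real ` {0<..<\<sigma>}" 0])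
      show "(\<lambda>z. poly P z - z * cmelnikov a b z * G z) holomorphic_on ball 0 \<sigma>"
        by (intro holomorphic_intros cmelnikov_holomorphic N(3))
      show "(0::complex) islimpt complex_of_real ` {0<..<\<sigma>}"
        unfolding islimpt_approachable
      proof (intro allI impI)
        fix e :: real assume "e > 0"
        define x where "x = min (e / 2) (\<sigma> / 2)"
        have "x \<in> {0<..<\<sigma>}" "x < e" using \<open>e > 0\<close> sigma_pos by (auto simp: x_def min_def)
        thus "\<exists>x'\<in>complex_of_real ` {0<..<\<sigma>}. x' \<noteq> 0 \<and> dist x' 0 < e"
          by (intro bexI[of _ "of_real x"]) auto
      qed
      fix w assume "w \<in> complex_of_real ` {0<..<\<sigma>}"
      then obtain r where r: "w = of_real r" "0 \<le> r" "r < \<sigma>" by auto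
      have "poly P w = of_real (poly N (r\<^sup>2))"
        unfolding polyP r(1) using poly_map_poly_of_real[of N "r\<^sup>2", where 'a = complex] by simp
      thus "poly P w - w * cmelnikov a b w * G w = 0"
        using N(4)[OF r(2,3)] cmelnikov_of_real[OF r(2,3), of a b] by (simp add: r(1))
    qed (use z sigma_pos in auto)
    thus ?thesis by simp
  qed
  ultimately show ?thesis using that N(3) by blast
qed

end

section \<open>The displacement function\<close>

text \<open>Cauchy's estimate on circles of radius (R - R')/2. It turns a bound of order \<epsilon>
  for the radial field into a Lipschitz constant of order \<epsilon> without differentiating a
  quotient.\<close>

lemma holomorphic_bounded_Lipschitz:
  assumes hol: "f holomorphic_on ball 0 R" and bd: "\<And>z. z \<in> ball 0 R \<Longrightarrow> norm (f z) \<le> B"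
    and R: "R' < R" and zw: "z \<in> ball 0 R'" "w \<in> ball 0 R'"
  shows "norm (f z - f w) \<le> 2 * B / (R - R') * norm (z - w)"
proof (rule field_differentiable_bound[of "ball 0 R'" f "deriv f"])
  fix u :: complex assume u: "u \<in> ball 0 R'"
  show "(f has_field_derivative deriv f u) (at u within ball 0 R')"
    by (rule has_field_derivative_at_within, rule holomorphic_derivI[OF hol open_ball]) (use u R in auto)
  define r where "r = (R - R') / 2"
  have r: "r > 0" "cball u r \<subseteq> ball 0 R"
  proof -
    show "r > 0" using R by (simp add: r_def)
    show "cball u r \<subseteq> ball 0 R"
    proof
      fix v assume "v \<in> cball u r"
      hence "norm (v - u) \<le> r" by (simp add: dist_norm norm_minus_commute)
      thus "v \<in> ball 0 R" using norm_triangle_ineq[of u "v - u"] u R by (simp add: r_def field_simps)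
    qed
  qed
  have "norm ((deriv ^^ 1) f u) \<le> fact 1 * B / r ^ 1"
  proof (rule Cauchy_inequality)
    show "f holomorphic_on ball u r" using holomorphic_on_subset[OF hol] r by force
    show "continuous_on (cball u r) f" using continuous_on_subset[OF holomorphic_on_imp_continuous_on[OF hol]] r by blast
    show "norm (f v) \<le> B" if "norm (u - v) = r" for v
      using bd[of v] r that by (auto simp: subset_iff dist_norm)
  qed (use r in auto)
  thus "norm (deriv f u) \<le> 2 * B / (R - R')" by (simp add: r_def mult.commute)
qed (use zw in auto)

section \<open>The radial equation around the perturbed equilibrium\<close>

text \<open>The field \<open>F\<close> is bounded for |r| < \<rho>3 and Lipschitz for |r| < \<rho>2,
  and \<rho>1 bounds the initial radii of the flow. The three conditions in \<open>small\<close>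
  respectively keep the denominator of \<open>F\<close> at least |r|/2 in modulus, keep the flow
  from leaving radius \<rho>2 within one turn, and make the Picard map a contraction on that turn.
  The second part of \<open>disc\<close> concerns circles around the origin, where the Melnikov
  integrand lives.\<close>

locale perturbation = melnikov_params +
  fixes a b :: "nat \<Rightarrow> nat \<Rightarrow> real" and \<epsilon> x0 y0 L \<delta> R \<rho>1 \<rho>2 \<rho>3 :: real
  assumes L: "L > 0"
    and cquot_lip: "\<And>x y x' y'. (x, y) \<in> pole_free_box \<delta> R \<Longrightarrow> (x', y') \<in> pole_free_box \<delta> R \<Longrightarrow>
        norm (cquot a x y - cquot a x' y') \<le> L * (norm (x - x') + norm (y - y')) \<and>
        norm (cquot b x y - cquot b x' y') \<le> L * (norm (x - x') + norm (y - y'))"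
    and disc: "\<And>r t. r \<in> ball 0 \<rho>3 \<Longrightarrow> (of_real x0 + r * of_real (sin t), of_real y0 + r * of_real (cos t)) \<in> pole_free_box \<delta> R"
        "\<And>r t. r \<in> ball 0 \<rho>3 \<Longrightarrow> (r * of_real (sin t), r * of_real (cos t)) \<in> pole_free_box \<delta> R"
    and \<rho>: "0 < \<rho>1" "\<rho>1 < \<rho>2" "\<rho>2 < \<rho>3" "\<bar>x0\<bar> + \<rho>3 \<le> \<sigma>"
    and equil: "\<bar>x0\<bar> \<le> \<bar>\<epsilon>\<bar> * L" "\<bar>y0\<bar> \<le> \<bar>\<epsilon>\<bar> * L"
        "y0 + \<epsilon> * rquot a x0 y0 = 0" "- x0 + \<epsilon> * rquot b x0 y0 = 0"
    and small: "8 * L * \<bar>\<epsilon>\<bar> \<le> 1" "16 * pi * L * \<bar>\<epsilon>\<bar> * \<rho>3 < \<rho>2 - \<rho>1"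
        "2 * pi * (2 * (8 * L * \<bar>\<epsilon>\<bar> * \<rho>3) / (\<rho>3 - \<rho>2)) \<le> 1 / 2"
begin

text \<open>By \<open>equil\<close> the subtracted value cancels the constant terms produced by the
  shift of the origin. What remains is at most a multiple of |r|, which allows division by
  r.\<close>

definition Na :: "real \<Rightarrow> complex \<Rightarrow> complex" where
  "Na t r = cquot a (of_real x0 + r * of_real (sin t)) (of_real y0 + r * of_real (cos t)) - cquot a (of_real x0) (of_real y0)"
definition Nb :: "real \<Rightarrow> complex \<Rightarrow> complex" where
  "Nb t r = cquot b (of_real x0 + r * of_real (sin t)) (of_real y0 + r * of_real (cos t)) - cquot b (of_real x0) (of_real y0)"
definition S :: "real \<Rightarrow> complex \<Rightarrow> complex" where
  "S t r = of_real (sin t) * Na t r + of_real (cos t) * Nb t r"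
definition T :: "real \<Rightarrow> complex \<Rightarrow> complex" where
  "T t r = of_real (cos t) * Na t r - of_real (sin t) * Nb t r"
text \<open>With \<open>X = r sin t\<close>, \<open>Y = r cos t\<close> around \<open>(x0, y0)\<close>, the system reads \<open>r' = \<epsilon> S\<close>, \<open>t' = 1 + \<epsilon> T / r\<close>;
  \<open>F\<close> is the resulting \<open>dr/dt\<close>, written so that its value at \<open>r = 0\<close> is the correct limit \<open>0\<close>.\<close>

definition F :: "real \<Rightarrow> complex \<Rightarrow> complex" where
  "F t r = of_real \<epsilon> * (r * S t r / (r + of_real \<epsilon> * T t r))"

lemma center_Wd: "(of_real x0, of_real y0) \<in> pole_free_box \<delta> R"
  using disc(1)[of 0 0] \<rho> by simp

lemma N_le: 
  assumes r: "r \<in> ball 0 \<rho>3" shows "norm (Na t r) \<le> 2 * L * norm r" "norm (Nb t r) \<le> 2 * L * norm r"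
proof -
  have "norm (r * of_real (sin t)) + norm (r * of_real (cos t)) \<le> 2 * norm r"
    using norm_mult_sin_cos_le[of r t] by simp
  hence "L * (norm (r * of_real (sin t)) + norm (r * of_real (cos t))) \<le> 2 * L * norm r" using L by simp
  thus "norm (Na t r) \<le> 2 * L * norm r" "norm (Nb t r) \<le> 2 * L * norm r"
    using cquot_lip[OF disc(1)[OF r, of t] center_Wd] by (auto simp: Na_def Nb_def)
qed

lemma sin_cos_comb_le:
  assumes "norm (x::complex) \<le> d" "norm y \<le> d"
  shows "norm (of_real (sin t) * x + of_real (cos t) * y) \<le> 2 * d" "norm (of_real (cos t) * x - of_real (sin t) * y) \<le> 2 * d"
  using norm_triangle_ineq[of "of_real (sin t) * x" "of_real (cos t) * y"] norm_triangle_ineq4[of "of_real (cos t) * x" "of_real (sin t) * y"]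
    norm_mult_sin_cos_le[of x t] norm_mult_sin_cos_le[of y t] assms by (simp_all add: mult.commute)

lemma S_le: assumes "r \<in> ball 0 \<rho>3" shows "norm (S t r) \<le> 4 * L * norm r" "norm (T t r) \<le> 4 * L * norm r"
  using sin_cos_comb_le[OF N_le(1)[OF assms, of t] N_le(2)[OF assms, of t], of t] by (simp_all add: S_def T_def mult.assoc)

text \<open>The complex counterpart of an angular speed of at least 1/2: the denominator of
  \<open>F\<close> can vanish at r = 0 only.\<close>

lemma denom_ge: 
  assumes "r \<in> ball 0 \<rho>3" shows "norm (r + of_real \<epsilon> * T t r) \<ge> norm r / 2"
proof -
  have "norm (of_real \<epsilon> * T t r) \<le> \<bar>\<epsilon>\<bar> * (4 * L * norm r)"
    unfolding norm_mult norm_of_real by (intro mult_left_mono S_le assms) auto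
  also have "\<dots> = (8 * L * \<bar>\<epsilon>\<bar>) * (norm r / 2)" by simp
  also have "\<dots> \<le> 1 * (norm r / 2)" using small(1) by (intro mult_right_mono) auto
  finally show ?thesis using norm_triangle_ineq2[of r "- (of_real \<epsilon> * T t r)"] by simp
qed

lemma F_le:
  assumes "r \<in> ball 0 \<rho>3" shows "norm (F t r) \<le> 8 * L * \<bar>\<epsilon>\<bar> * norm r"
proof (cases "r = 0")
  case False
  have "norm (F t r) = \<bar>\<epsilon>\<bar> * (norm r * norm (S t r) / norm (r + of_real \<epsilon> * T t r))"
    by (simp add: F_def norm_mult norm_divide)
  also have "\<dots> \<le> \<bar>\<epsilon>\<bar> * (norm r * (4 * L * norm r) / (norm r / 2))"
    using False L S_le[OF assms] denom_ge[OF assms] by (intro mult_left_mono frac_le mult_nonneg_nonneg) auto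
  also have "\<dots> = 8 * L * \<bar>\<epsilon>\<bar> * norm r" using False by (simp add: field_simps)
  finally show ?thesis .
qed (simp add: F_def)

text \<open>Replacing the denominator of \<open>F\<close> by r changes it by - \<epsilon>^2 S T / (r
  + \<epsilon> T), which is of second order in \<epsilon>.\<close>

lemma F_S_le:
  assumes "r \<in> ball 0 \<rho>3" shows "norm (F t r - of_real \<epsilon> * S t r) \<le> 32 * L\<^sup>2 * \<epsilon>\<^sup>2 * norm r"
proof (cases "r = 0")
  case True thus ?thesis by (simp add: F_def S_def Na_def Nb_def)
next
  case False
  hence nz: "r + of_real \<epsilon> * T t r \<noteq> 0" using denom_ge[OF assms, of t] by auto
  have "F t r - of_real \<epsilon> * S t r = of_real \<epsilon> * S t r * (- of_real \<epsilon> * T t r) / (r + of_real \<epsilon> * T t r)"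
    using nz by (simp add: F_def divide_simps) (simp add: algebra_simps)
  also have "norm \<dots> = \<bar>\<epsilon>\<bar> * norm (S t r) * (\<bar>\<epsilon>\<bar> * norm (T t r)) / norm (r + of_real \<epsilon> * T t r)"
    by (simp add: norm_mult norm_divide)
  also have "\<dots> \<le> \<bar>\<epsilon>\<bar> * (4 * L * norm r) * (\<bar>\<epsilon>\<bar> * (4 * L * norm r)) / (norm r / 2)"
    using False L S_le[OF assms, of t] denom_ge[OF assms, of t] by (intro frac_le mult_mono mult_left_mono mult_nonneg_nonneg) auto
  also have "\<dots> = 32 * L\<^sup>2 * \<epsilon>\<^sup>2 * norm r" using False by (simp add: field_simps power2_eq_square flip: abs_mult)
  finally show ?thesis .
qed

lemma N_continuous:
  "continuous_on (A \<times> ball 0 \<rho>3) (\<lambda>p. Na (fst p) (snd p))" "continuous_on (A \<times> ball 0 \<rho>3) (\<lambda>p. Nb (fst p) (snd p))"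
  unfolding Na_def Nb_def by (intro continuous_intros cquot_polar_continuous; use \<rho> in simp)+

lemma ST_continuous:
  "continuous_on (A \<times> ball 0 \<rho>3) (\<lambda>p. S (fst p) (snd p))" "continuous_on (A \<times> ball 0 \<rho>3) (\<lambda>p. T (fst p) (snd p))"
  unfolding S_def T_def by (intro continuous_intros N_continuous)+

lemma ST_holomorphic: "S t holomorphic_on ball 0 \<rho>3" "T t holomorphic_on ball 0 \<rho>3"
  unfolding S_def[abs_def] T_def[abs_def] Na_def Nb_def
  by (intro holomorphic_intros cquot_polar_holomorphic; use \<rho> in simp)+

lemma F_continuous: "continuous_on (A \<times> ball 0 \<rho>3) (\<lambda>(t, r). F t r)"
  unfolding continuous_on_def
proof clarify
  fix t r assume tr: "t \<in> A" "r \<in> ball (0::complex) \<rho>3"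
  let ?X = "at (t, r) within A \<times> ball 0 \<rho>3"
  have lims: "((\<lambda>p. S (fst p) (snd p)) \<longlongrightarrow> S t r) ?X" "((\<lambda>p. T (fst p) (snd p)) \<longlongrightarrow> T t r) ?X"
    using ST_continuous[of A] tr by (auto simp: continuous_on_def)
  show "((\<lambda>(t, r). F t r) \<longlongrightarrow> F t r) ?X"
  proof (cases "r = 0")
    case False
    hence nz: "r + of_real \<epsilon> * T t r \<noteq> 0" using denom_ge[OF tr(2), of t] by auto
    have sr: "((\<lambda>p. snd p) \<longlongrightarrow> r) ?X" using tendsto_snd[OF tendsto_ident_at, of "(t, r)"] by simp
    show ?thesis unfolding F_def split_beta using nz by (intro tendsto_intros lims sr) auto
  next
    case True
    have "((\<lambda>p. 8 * L * \<bar>\<epsilon>\<bar> * norm (snd p)) \<longlongrightarrow> 8 * L * \<bar>\<epsilon>\<bar> * norm (snd (t, r))) ?X"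
      by (intro tendsto_intros)
    hence "((\<lambda>p. 8 * L * \<bar>\<epsilon>\<bar> * norm (snd p)) \<longlongrightarrow> 0) ?X" using True by simp
    moreover have "\<forall>\<^sub>F p in ?X. norm ((\<lambda>(t, r). F t r) p) \<le> 8 * L * \<bar>\<epsilon>\<bar> * norm (snd p)"
      unfolding eventually_at_filter by (intro always_eventually allI impI) (use F_le in auto)
    ultimately have "((\<lambda>(t, r). F t r) \<longlongrightarrow> 0) ?X" by (rule Lim_null_comparison[rotated])
    thus ?thesis using True by (simp add: F_def)
  qed
qed

text \<open>The singularity at 0 is removable, since the linear bound \<open>F_le\<close> has
  already given continuity there.\<close>

lemma F_holomorphic: "F t holomorphic_on ball 0 \<rho>3"
proof (rule no_isolated_singularity[of _ _ "{0}"])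
  have "continuous_on (ball 0 \<rho>3) (\<lambda>r. (\<lambda>(t, r). F t r) (t, r))"
    by (rule continuous_on_compose2[OF F_continuous[of "{t}"]]) (auto intro!: continuous_intros)
  thus "continuous_on (ball 0 \<rho>3) (F t)" by simp
  have nz: "r + of_real \<epsilon> * T t r \<noteq> 0" if "r \<in> ball 0 \<rho>3 - {0}" for r
    using denom_ge[of r t] that by auto
  show "F t holomorphic_on ball 0 \<rho>3 - {0}"
    unfolding F_def[abs_def]
    by (intro holomorphic_intros holomorphic_on_subset[OF ST_holomorphic(1)] holomorphic_on_subset[OF ST_holomorphic(2)] nz) auto
qed auto

definition Lip where "Lip = 2 * (8 * L * \<bar>\<epsilon>\<bar> * \<rho>3) / (\<rho>3 - \<rho>2)"

lemma F_lip:
  assumes "z \<in> ball 0 \<rho>2" "w \<in> ball 0 \<rho>2" shows "norm (F t z - F t w) \<le> Lip * norm (z - w)"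
  unfolding Lip_def
proof (rule holomorphic_bounded_Lipschitz[OF F_holomorphic])
  fix z :: complex assume z: "z \<in> ball 0 \<rho>3"
  have "8 * L * \<bar>\<epsilon>\<bar> * norm z \<le> 8 * L * \<bar>\<epsilon>\<bar> * \<rho>3" using z L by (intro mult_left_mono) auto
  thus "norm (F t z) \<le> 8 * L * \<bar>\<epsilon>\<bar> * \<rho>3" using F_le[OF z, of t] by linarith
qed (use assms \<rho> in auto)

text \<open>The pairs (t, r) and (t + pi, - r) describe the same point of the plane. Hence a radial
  solution r yields the solution - r (t + pi), the source of the negative zeros.\<close>

lemma F_antisym: "F (t + pi) (- r) = - F t r"
proof -
  have "Na (t + pi) (- r) = Na t r" "Nb (t + pi) (- r) = Nb t r" by (simp_all add: Na_def Nb_def)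
  hence "S (t + pi) (- r) = - S t r" "T (t + pi) (- r) = - T t r" by (simp_all add: S_def T_def)
  moreover have "(- r) * (- s) / (- r + e * (- u)) = - (r * s / (r + e * u))" for s e u :: complex
    by (metis minus_add_distrib minus_divide_right minus_mult_minus mult_minus_right)
  ultimately show ?thesis by (simp only: F_def mult_minus_right)
qed

lemma F_periodic: "F (t + 2 * pi) r = F t r"
  by (simp add: F_def S_def T_def Na_def Nb_def)

text \<open>The remainder constant of the first-order expansion over one turn. The first term comes
  from \<open>F_S_le\<close>; the second from displacing the arguments of the perturbation by the
  shift of the equilibrium and by the drift of the radius. Only \<open>L\<close> and \<rho>3 occur
  in it, so it is common to all coefficients of the box.\<close>

definition "Cd = 2 * pi * (32 * L\<^sup>2 * \<rho>3 + 2 * L * (2 * L + 32 * pi * L * \<rho>3))"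

text \<open>Freezing the radius at its initial value and moving the centre back to the origin each
  cost O(\<epsilon>) in an integrand that already carries a factor \<epsilon>. What remains of first
  order is the Melnikov integral.\<close>

lemma poincare_flow:
  obtains \<phi> where "\<And>t. t \<in> {0..2 * pi} \<Longrightarrow> \<phi> t holomorphic_on ball 0 \<rho>1"
    and "\<And>t z. t \<in> {0..2 * pi} \<Longrightarrow> z \<in> ball 0 \<rho>1 \<Longrightarrow> \<phi> t z \<in> ball 0 \<rho>2"
    and "\<And>t z. t \<in> {0..2 * pi} \<Longrightarrow> z \<in> ball 0 \<rho>1 \<Longrightarrow>
           ((\<lambda>s. \<phi> s z) has_vector_derivative F t (\<phi> t z)) (at t within {0..2 * pi})"
    and "\<And>z. z \<in> ball 0 \<rho>1 \<Longrightarrow> \<phi> 0 z = z"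
    and "\<And>z. z \<in> ball 0 \<rho>1 \<Longrightarrow> norm (\<phi> (2 * pi) z - z - of_real \<epsilon> * cmelnikov a b z) \<le> Cd * \<epsilon>\<^sup>2"
proof -
  define B where "B = 8 * L * \<bar>\<epsilon>\<bar> * \<rho>3"
  have B0: "0 \<le> B" using L \<rho> by (simp add: B_def)
  have B: "norm (F t z) \<le> B" if "z \<in> ball 0 \<rho>2" for t z
  proof -
    have "8 * L * \<bar>\<epsilon>\<bar> * norm z \<le> 8 * L * \<bar>\<epsilon>\<bar> * \<rho>3" using that \<rho> L by (intro mult_left_mono) auto
    thus ?thesis using F_le[of z t] that \<rho> unfolding B_def by force
  qed
  have R: "\<rho>1 + 2 * pi * B < \<rho>2" using small(2) by (simp add: B_def mult_ac)
  have Lip0: "0 \<le> Lip" "2 * pi * Lip \<le> 1 / 2"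
    using L \<rho> small(3) unfolding Lip_def by (auto intro!: divide_nonneg_pos mult_nonneg_nonneg)
  obtain \<phi> where \<phi>: "\<And>t. t \<in> {0..2 * pi} \<Longrightarrow> \<phi> t holomorphic_on ball 0 \<rho>1"
    "\<And>t z. t \<in> {0..2 * pi} \<Longrightarrow> z \<in> ball 0 \<rho>1 \<Longrightarrow> norm (\<phi> t z - z) \<le> 2 * pi * B"
    "\<And>t z. t \<in> {0..2 * pi} \<Longrightarrow> z \<in> ball 0 \<rho>1 \<Longrightarrow>
           ((\<lambda>s. \<phi> s z) has_vector_derivative F t (\<phi> t z)) (at t within {0..2 * pi})"
    "\<And>z. z \<in> ball 0 \<rho>1 \<Longrightarrow> continuous_on {0..2 * pi} (\<lambda>s. F s (\<phi> s z))"
    "\<And>t z. t \<in> {0..2 * pi} \<Longrightarrow> z \<in> ball 0 \<rho>1 \<Longrightarrow> \<phi> t z = z + integral {0..t} (\<lambda>s. F s (\<phi> s z))"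
  proof (rule picard_holomorphic[of "2 * pi" \<rho>2 F B Lip \<rho>1])
    show "continuous_on ({0..2 * pi} \<times> ball 0 \<rho>2) (\<lambda>(t, z). F t z)"
      by (rule continuous_on_subset[OF F_continuous[of "{0..2 * pi}"]]) (use \<rho> in auto)
    show "F t holomorphic_on ball 0 \<rho>2" for t
      by (rule holomorphic_on_subset[OF F_holomorphic]) (use \<rho> in auto)
  qed (use B R Lip0 B0 F_lip in auto)
  have in2: "\<phi> t z \<in> ball 0 \<rho>2" if "t \<in> {0..2 * pi}" "z \<in> ball 0 \<rho>1" for t z
    using \<phi>(2)[OF that] R that norm_triangle_ineq[of z "\<phi> t z - z"] by simp
  have est: "norm (\<phi> (2 * pi) z - z - of_real \<epsilon> * cmelnikov a b z) \<le> Cd * \<epsilon>\<^sup>2" if z: "z \<in> ball 0 \<rho>1" for z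
  proof -
    let ?g = "\<lambda>t. of_real (sin t) * cquot a (z * of_real (sin t)) (z * of_real (cos t)) +
                                       of_real (cos t) * cquot b (z * of_real (sin t)) (z * of_real (cos t))"
    let ?k = "\<lambda>t. of_real (sin t) * cquot a (of_real x0) (of_real y0) + of_real (cos t) * cquot b (of_real x0) (of_real y0)"
    have z3: "z \<in> ball 0 \<rho>3" and z\<sigma>: "z \<in> ball 0 \<sigma>" using z \<rho> by auto
    have cg: "continuous_on {0..2 * pi} ?g"
    proof -
      have "continuous_on {0..2 * pi} (\<lambda>t. (t, z))" by (intro continuous_intros)
      from continuous_on_compose2[OF cmelnikov_integrand_continuous[of a b] this] show ?thesis
        using z\<sigma> by (simp add: image_subset_iff)
    qed
    \<comment> \<open>The subtracted equilibrium values contribute multiples of sine and cosine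
      only. These have mean zero, so the Melnikov integral does not feel the subtraction in
      \<open>Na\<close> and \<open>Nb\<close>.\<close>
    have k0: "(?k has_integral 0) {0..2 * pi}"
    proof -
      have "(?k has_integral ((- of_real (cos (2 * pi)) * cquot a (of_real x0) (of_real y0) + of_real (sin (2 * pi)) * cquot b (of_real x0) (of_real y0))
          - (- of_real (cos 0) * cquot a (of_real x0) (of_real y0) + of_real (sin 0) * cquot b (of_real x0) (of_real y0)))) {0..2 * pi}"
      proof (rule fundamental_theorem_of_calculus)
        fix t
        have 1: "((\<lambda>t. - complex_of_real (cos t)) has_vector_derivative of_real (sin t)) (at t within {0..2 * pi})"
          and 2: "((\<lambda>t. complex_of_real (sin t)) has_vector_derivative of_real (cos t)) (at t within {0..2 * pi})"
          using has_vector_derivative_of_real[of "\<lambda>t. - cos t" "sin t" "at t within {0..2 * pi}"]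
            has_vector_derivative_of_real[of sin "cos t" "at t within {0..2 * pi}"]
          by (auto intro!: derivative_eq_intros)
        show "((\<lambda>t. - of_real (cos t) * cquot a (of_real x0) (of_real y0) + of_real (sin t) * cquot b (of_real x0) (of_real y0))
          has_vector_derivative ?k t) (at t within {0..2 * pi})"
          by (intro has_vector_derivative_add has_vector_derivative_mult_left 1 2)
      qed simp
      thus ?thesis by simp
    qed
    have 1: "((\<lambda>s. F s (\<phi> s z)) has_integral (\<phi> (2 * pi) z - z)) {0..2 * pi}"
      using integrable_integral[OF integrable_continuous_real[OF \<phi>(4)[OF z]]] \<phi>(5)[of "2 * pi" z] z by simp
    have "(?g has_integral cmelnikov a b z) {0..2 * pi}"
      unfolding cmelnikov_def using integrable_integral[OF integrable_continuous_real[OF cg]] .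
    hence 2: "((\<lambda>s. of_real \<epsilon> * (?g s - ?k s)) has_integral of_real \<epsilon> * (cmelnikov a b z - 0)) {0..2 * pi}"
      by (intro has_integral_mult_right has_integral_diff k0)
    have "norm (\<phi> (2 * pi) z - z - of_real \<epsilon> * (cmelnikov a b z - 0)) \<le>
       (32 * L\<^sup>2 * \<epsilon>\<^sup>2 * \<rho>3 + \<bar>\<epsilon>\<bar> * (2 * (L * (2 * (\<bar>\<epsilon>\<bar> * L) + 2 * (2 * pi * B))))) * measure lborel {0..2 * pi}"
    proof (rule has_integral_bound_real[OF _ finite.emptyI has_integral_diff[OF 1 2]])
      show "0 \<le> 32 * L\<^sup>2 * \<epsilon>\<^sup>2 * \<rho>3 + \<bar>\<epsilon>\<bar> * (2 * (L * (2 * (\<bar>\<epsilon>\<bar> * L) + 2 * (2 * pi * B))))"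
        using L \<rho> B0 by (intro add_nonneg_nonneg mult_nonneg_nonneg) auto
      fix s assume s: "s \<in> {0..2 * pi} - {}"
      let ?w = "\<phi> s z"
      have w: "?w \<in> ball 0 \<rho>3" "norm ?w \<le> \<rho>3" "norm (?w - z) \<le> 2 * pi * B" using in2[of s z] \<phi>(2)[of s z] s z \<rho> by auto
      let ?x = "of_real x0 + ?w * of_real (sin s)" and ?y = "of_real y0 + ?w * of_real (cos s)"
      let ?da = "cquot a ?x ?y - cquot a (z * of_real (sin s)) (z * of_real (cos s))"
      let ?db = "cquot b ?x ?y - cquot b (z * of_real (sin s)) (z * of_real (cos s))"
      have dx: "norm (?x - z * of_real (sin s)) \<le> \<bar>\<epsilon>\<bar> * L + 2 * pi * B"
        using norm_triangle_ineq[of "of_real x0" "(?w - z) * of_real (sin s)"] norm_mult_sin_cos_le(1)[of "?w - z" s] w(3) equil(1)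
        by (simp add: algebra_simps)
      have dy: "norm (?y - z * of_real (cos s)) \<le> \<bar>\<epsilon>\<bar> * L + 2 * pi * B"
        using norm_triangle_ineq[of "of_real y0" "(?w - z) * of_real (cos s)"] norm_mult_sin_cos_le(2)[of "?w - z" s] w(3) equil(2)
        by (simp add: algebra_simps)
      have "L * (norm (?x - z * of_real (sin s)) + norm (?y - z * of_real (cos s))) \<le> L * (2 * (\<bar>\<epsilon>\<bar> * L) + 2 * (2 * pi * B))"
        using dx dy L by (intro mult_left_mono) auto
      hence dab: "norm ?da \<le> L * (2 * (\<bar>\<epsilon>\<bar> * L) + 2 * (2 * pi * B))" "norm ?db \<le> L * (2 * (\<bar>\<epsilon>\<bar> * L) + 2 * (2 * pi * B))"
        using cquot_lip[OF disc(1)[OF w(1), of s] disc(2)[OF z3, of s]] by auto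
      define A where "A = F s ?w - of_real \<epsilon> * S s ?w"
      define C where "C = of_real (sin s) * ?da + of_real (cos s) * ?db"
      have eq: "F s ?w - of_real \<epsilon> * (?g s - ?k s) = A + of_real \<epsilon> * C"
        unfolding A_def C_def by (simp add: S_def Na_def Nb_def algebra_simps)
      have "32 * L\<^sup>2 * \<epsilon>\<^sup>2 * norm ?w \<le> 32 * L\<^sup>2 * \<epsilon>\<^sup>2 * \<rho>3" by (rule mult_left_mono[OF w(2)]) simp
      hence A: "norm A \<le> 32 * L\<^sup>2 * \<epsilon>\<^sup>2 * \<rho>3"
        unfolding A_def by (rule order_trans[OF F_S_le[OF w(1)]])
      have C: "norm C \<le> 2 * (L * (2 * (\<bar>\<epsilon>\<bar> * L) + 2 * (2 * pi * B)))"
        unfolding C_def by (rule sin_cos_comb_le(1)[OF dab])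
      have "norm (A + of_real \<epsilon> * C) \<le> norm A + \<bar>\<epsilon>\<bar> * norm C"
        using norm_triangle_ineq[of A "of_real \<epsilon> * C"] by (simp add: norm_mult)
      also have "\<dots> \<le> 32 * L\<^sup>2 * \<epsilon>\<^sup>2 * \<rho>3 + \<bar>\<epsilon>\<bar> * (2 * (L * (2 * (\<bar>\<epsilon>\<bar> * L) + 2 * (2 * pi * B))))"
        by (rule add_mono[OF A mult_left_mono[OF C]]) simp
      finally show "norm (F s ?w - of_real \<epsilon> * (?g s - ?k s)) \<le> 32 * L\<^sup>2 * \<epsilon>\<^sup>2 * \<rho>3 + \<bar>\<epsilon>\<bar> * (2 * (L * (2 * (\<bar>\<epsilon>\<bar> * L) + 2 * (2 * pi * B))))"
        unfolding eq .
    qed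
    also have "\<dots> = Cd * \<epsilon>\<^sup>2"
    proof -
      define e where "e = \<bar>\<epsilon>\<bar>"
      have "\<epsilon>\<^sup>2 = e * e" by (simp add: e_def power2_eq_square)
      thus ?thesis unfolding Cd_def B_def e_def[symmetric] by (simp add: power2_eq_square[of L] algebra_simps)
    qed
    finally show ?thesis by simp
  qed
  show ?thesis
    by (rule that[OF \<phi>(1) in2 \<phi>(3) _ est]) (use \<phi>(5)[of 0] in auto)
qed

end

section \<open>Periodic orbits in polar coordinates\<close>

lemma continuous_antiderivative_UNIV:
  fixes f :: "real \<Rightarrow> 'a::euclidean_space"
  assumes "continuous_on UNIV f"
  obtains G where "\<And>t. (G has_vector_derivative f t) (at t)" "G 0 = 0"
proof (rule that)
  fix t
  have "((\<lambda>u. LBINT y=0..u. f y) has_vector_derivative f t) (at t within {- (\<bar>t\<bar> + 1)..\<bar>t\<bar> + 1})"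
    using interval_integral_FTC2[of "- (\<bar>t\<bar> + 1)" 0 "\<bar>t\<bar> + 1" f t] continuous_on_subset[OF assms]
    by (simp add: zero_ereal_def)
  moreover have "at t within {- (\<bar>t\<bar> + 1)..\<bar>t\<bar> + 1} = at t"
    by (rule at_within_interior) (simp add: abs_if)
  ultimately have "((\<lambda>u. LBINT y=0..u. f y) has_vector_derivative f t) (at t)" by simp
  from has_vector_derivative_diff[OF this has_vector_derivative_const]
  show "((\<lambda>u. (LBINT y=0..u. f y) - (LBINT y=0..(0::real). f y)) has_vector_derivative f t) (at t)" by simp
qed simp

lemma nonvanishing_continuous_sign:
  fixes g :: "real \<Rightarrow> real"
  assumes "continuous_on UNIV g" "\<And>t. g t \<noteq> 0" "g s > 0"
  shows "g t > 0"
proof (rule ccontr)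
  assume "\<not> g t > 0"
  hence "g t < 0" using assms(2)[of t] by linarith
  moreover have "connected (range g)" by (rule connected_continuous_image[OF assms(1)]) simp
  ultimately have "0 \<in> range g"
    using connected_contains_Icc[of "range g" "g t" "g s"] assms(3) by (auto simp: subset_iff)
  thus False using assms(2) by auto
qed

text \<open>It is applied to the polar angle as a function of time, so that the angle can take over
  as the independent variable.\<close>

lemma inverse_of_expanding:
  fixes f f' :: "real \<Rightarrow> real"
  assumes der: "\<And>t. (f has_real_derivative f' t) (at t)" and ge: "\<And>t. f' t \<ge> 1 / 2"
  obtains g where "\<And>y. f (g y) = y" "\<And>t. g (f t) = t" "\<And>y. (g has_real_derivative inverse (f' (g y))) (at y)"
proof -
  have grow: "t - s \<le> 2 * f t - 2 * f s" if "s \<le> t" for s t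
  proof (cases "s = t")
    case False
    hence "s < t" using that by simp
    from MVT2[OF this, of f f'] der obtain z where "f t - f s = (t - s) * f' z" by auto
    moreover have "(t - s) * f' z \<ge> (t - s) * (1 / 2)" using ge that by (intro mult_left_mono) auto
    ultimately show ?thesis by simp
  qed simp
  have cont: "isCont f t" for t using DERIV_isCont[OF der] .
  have inj: "inj f"
  proof (rule injI)
    fix s t assume eq: "f s = f t"
    have "v \<le> u" if "u \<le> v" "f u = f v" for u v using grow[OF that(1)] that(2) by simp
    with eq show "s = t" by (metis linear order_antisym)
  qed
  have surj: "\<exists>t. f t = y" for y
  proof -
    \<comment> \<open>Over a time of 2 |y - f 0| the function changes by at least |y - f 0|, so
      these two points enclose the value y.\<close>
    define s t where "s = - 2 * \<bar>y - f 0\<bar>" and "t = 2 * \<bar>y - f 0\<bar>"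
    have "f s \<le> y" "y \<le> f t" "s \<le> t"
    proof -
      have st: "s \<le> 0" "0 \<le> t" by (simp_all add: s_def t_def)
      have "2 * \<bar>y - f 0\<bar> \<le> 2 * f 0 - 2 * f s" "2 * \<bar>y - f 0\<bar> \<le> 2 * f t - 2 * f 0"
        using grow[OF st(1)] grow[OF st(2)] by (simp_all add: s_def t_def)
      thus "f s \<le> y" "y \<le> f t" by (simp_all add: abs_if split: if_splits)
      show "s \<le> t" using st by simp
    qed
    thus ?thesis using IVT[of f s y t] cont by auto
  qed
  define g where "g y = (THE t. f t = y)" for y
  have fg: "f (g y) = y" for y
  proof -
    obtain t where t: "f t = y" using surj by blast
    show ?thesis unfolding g_def by (rule theI[of _ t]) (use t injD[OF inj] in blast)+
  qed
  have gf: "g (f t) = t" for t by (rule injD[OF inj fg])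
  have lip: "\<bar>g x - g y\<bar> \<le> 2 * \<bar>x - y\<bar>" for x y
  proof (cases "g x \<le> g y")
    case True
    thus ?thesis using grow[OF True] by (simp add: fg abs_if)
  next
    case False
    hence "g y \<le> g x" by simp
    from grow[OF this] this show ?thesis by (simp add: fg abs_if)
  qed
  have "isCont g y" for y
    unfolding isCont_def LIM_def
  proof (intro allI impI)
    fix e :: real assume "e > 0"
    show "\<exists>d>0. \<forall>x. x \<noteq> y \<and> dist x y < d \<longrightarrow> dist (g x) (g y) < e"
    proof (intro exI[of _ "e / 2"] conjI allI impI)
      fix x assume "x \<noteq> y \<and> dist x y < e / 2"
      thus "dist (g x) (g y) < e" using lip[of x y] by (simp add: dist_real_def)
    qed (use \<open>e > 0\<close> in simp)
  qed
  hence "(g has_real_derivative inverse (f' (g y))) (at y)" for y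
    using DERIV_inverse_function[of f "f' (g y)" g y "y - 1" "y + 1"] der ge[of "g y"] fg by force
  thus ?thesis using that fg gf by blast
qed

section \<open>From closed orbits to periodic solutions of the radial equation\<close>

text \<open>Here \<delta>' is the margin between \<open>V\<close> and the singular lines, and
  \<delta> the smaller margin of the complex discs. In \<open>small2\<close> the first term bounds
  the radius in the direction of the nearer line, the second is the shift of the centre, and the
  third the variation of the radius during one turn.\<close>

locale small_perturbation = perturbation +
  fixes \<rho>0 \<delta>' :: real
  assumes \<delta>: "\<delta>' > 0" "\<delta> \<le> \<delta>'" and \<rho>0: "0 < \<rho>0" "\<rho>0 < \<rho>1"
    and small2: "(1 - \<delta>') * \<sigma> + \<bar>\<epsilon>\<bar> * L + 64 * pi * L * \<bar>\<epsilon>\<bar> * R < \<rho>0"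
begin

abbreviation "field \<equiv> perturbed_field m1 m2 \<alpha>1 \<alpha>2 n a b \<epsilon>"

lemma field_eq: "field (x, y) = (y + \<epsilon> * rquot a x y, - x + \<epsilon> * rquot b x y)"
  by (simp add: perturbed_field_def rquot_def mult.commute)

lemma rquot_lip:
  assumes "(of_real x, of_real y) \<in> pole_free_box \<delta> R"
  shows "\<bar>rquot a x y - rquot a x0 y0\<bar> \<le> L * (\<bar>x - x0\<bar> + \<bar>y - y0\<bar>)" "\<bar>rquot b x y - rquot b x0 y0\<bar> \<le> L * (\<bar>x - x0\<bar> + \<bar>y - y0\<bar>)"
  using cquot_lip[OF assms center_Wd] by (simp_all add: cquot_of_real flip: of_real_diff)

lemma sigma_alpha: obtains \<alpha> where "\<alpha> = \<alpha>1 \<or> \<alpha> = \<alpha>2" "\<bar>\<alpha>\<bar> * \<sigma> = 1"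
proof -
  have *: "\<bar>y\<bar> * sqrt (min (1 / x\<^sup>2) (1 / y\<^sup>2)) = 1" if "\<bar>x\<bar> \<le> \<bar>y\<bar>" "x \<noteq> 0" for x y :: real
  proof -
    have "y \<noteq> 0" using that by auto
    have "x\<^sup>2 \<le> y\<^sup>2" using that(1) by (simp add: abs_le_square_iff)
    hence "1 / y\<^sup>2 \<le> 1 / x\<^sup>2" using that(2) \<open>y \<noteq> 0\<close> by (intro divide_left_mono) auto
    hence "min (1 / x\<^sup>2) (1 / y\<^sup>2) = 1 / y\<^sup>2" by simp
    thus ?thesis using \<open>y \<noteq> 0\<close> by (simp add: real_sqrt_divide)
  qed
  show ?thesis
  proof (cases "\<bar>\<alpha>1\<bar> \<le> \<bar>\<alpha>2\<bar>")
    case True thus ?thesis using *[of \<alpha>1 \<alpha>2] \<alpha>_nz that[of \<alpha>2] by (simp add: \<sigma>_def H_def H0_def)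
  next
    case False thus ?thesis using *[of \<alpha>2 \<alpha>1] \<alpha>_nz that[of \<alpha>1] by (simp add: \<sigma>_def H_def H0_def min.commute)
  qed
qed

lemma pole_free_box_mono: "(x, y) \<in> pole_free_box d' R \<Longrightarrow> d \<le> d' \<Longrightarrow> (x, y) \<in> pole_free_box d R"
  by (auto simp: pole_free_box_def intro: order_trans)

text \<open>The angle has speed at least 1/2 and replaces time. Two claims need a global argument:
  the radius stays below \<rho>0 because the orbit winds around on the near side of a singular line,
  and the radius repeats after a single turn although a period of the orbit might cover
  several.\<close>

lemma periodic_orbit_polar:
  assumes po: "periodic_orbit field W C" and CV: "\<And>x y. (x, y) \<in> C \<Longrightarrow> (of_real x, of_real y) \<in> pole_free_box \<delta>' R"
  obtains r where "\<And>\<theta>. r \<theta> > 0" "\<And>\<theta>. r \<theta> < \<rho>0" "\<And>\<theta>. r (\<theta> + 2 * pi) = r \<theta>"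
    "\<And>\<theta>. ((\<lambda>\<theta>. complex_of_real (r \<theta>)) has_vector_derivative F \<theta> (of_real (r \<theta>))) (at \<theta>)"
    "C = range (\<lambda>\<theta>. (x0 + r \<theta> * sin \<theta>, y0 + r \<theta> * cos \<theta>))"
proof -
  from po obtain \<gamma> P where P: "P > 0" and sol: "is_solution field W \<gamma>" and per: "\<And>t. \<gamma> (t + P) = \<gamma> t"
    and nonc: "\<exists>t. \<gamma> t \<noteq> \<gamma> 0" and C: "C = range \<gamma>"
    unfolding periodic_orbit_def by blast
  define x y where "x t = fst (\<gamma> t)" and "y t = snd (\<gamma> t)" for t
  have \<gamma>: "\<gamma> t = (x t, y t)" for t by (simp add: x_def y_def)
  have wd': "(of_real (x t), of_real (y t)) \<in> pole_free_box \<delta>' R" for t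
    by (rule CV) (simp add: C \<gamma>[symmetric])
  hence wd: "(of_real (x t), of_real (y t)) \<in> pole_free_box \<delta> R" for t
    using pole_free_box_mono[OF _ \<delta>(2)] by blast
  have der\<gamma>: "(\<gamma> has_vector_derivative field (x t, y t)) (at t)" for t
    using sol by (simp add: is_solution_def \<gamma>)
  define pa pb where "pa t = rquot a (x t) (y t) - rquot a x0 y0" and "pb t = rquot b (x t) (y t) - rquot b x0 y0" for t
  define X Y where "X t = x t - x0" and "Y t = y t - y0" for t
  have dX: "(X has_real_derivative Y t + \<epsilon> * pa t) (at t)"
    and dY: "(Y has_real_derivative - X t + \<epsilon> * pb t) (at t)" for t
  proof -
    have xy: "(\<lambda>s. fst (\<gamma> s)) = x" "(\<lambda>s. snd (\<gamma> s)) = y" by (simp_all add: x_def y_def fun_eq_iff)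
    have "(x has_real_derivative y t + \<epsilon> * rquot a (x t) (y t)) (at t)"
      using bounded_linear.has_vector_derivative[OF bounded_linear_fst der\<gamma>[of t]]
      unfolding field_eq fst_conv xy has_real_derivative_iff_has_vector_derivative .
    thus "(X has_real_derivative Y t + \<epsilon> * pa t) (at t)"
      unfolding X_def[abs_def] using equil(3)
      by (auto intro!: derivative_eq_intros simp: Y_def pa_def algebra_simps)
    have "(y has_real_derivative - x t + \<epsilon> * rquot b (x t) (y t)) (at t)"
      using bounded_linear.has_vector_derivative[OF bounded_linear_snd der\<gamma>[of t]]
      unfolding field_eq snd_conv xy has_real_derivative_iff_has_vector_derivative .
    thus "(Y has_real_derivative - X t + \<epsilon> * pb t) (at t)"
      unfolding Y_def[abs_def] using equil(4)
      by (auto intro!: derivative_eq_intros simp: X_def pb_def algebra_simps)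
  qed
  have pab: "\<bar>pa t\<bar> \<le> L * (\<bar>X t\<bar> + \<bar>Y t\<bar>)" "\<bar>pb t\<bar> \<le> L * (\<bar>X t\<bar> + \<bar>Y t\<bar>)" for t
    using rquot_lip[OF wd[of t]] by (simp_all add: pa_def pb_def X_def Y_def)
  \<comment> \<open>Along the orbit the field is bounded by a multiple of the distance to the
    equilibrium, so a solution that reaches the equilibrium stays there, against
    \<open>nonc\<close>.\<close>
  have nz: "(X t, Y t) \<noteq> (0, 0)" for t
  proof
    assume z: "(X t, Y t) = (0, 0)"
    have "(X s, Y s) = 0" for s
    proof (rule linear_growth_eq_zero_UNIV[of "\<lambda>s. (X s, Y s)" "\<lambda>s. (Y s + \<epsilon> * pa s, - X s + \<epsilon> * pb s)" "2 + 4 * \<bar>\<epsilon>\<bar> * L" t])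
      fix s
      show "((\<lambda>s. (X s, Y s)) has_vector_derivative (Y s + \<epsilon> * pa s, - X s + \<epsilon> * pb s)) (at s)"
        using dX[of s] dY[of s] by (intro has_vector_derivative_Pair) (auto simp: has_real_derivative_iff_has_vector_derivative)
      have n: "\<bar>X s\<bar> \<le> norm (X s, Y s)" "\<bar>Y s\<bar> \<le> norm (X s, Y s)"
        using norm_fst_le[of "X s" "Y s"] norm_snd_le[of "Y s" "X s"] by auto
      have m: "\<bar>\<epsilon> * p\<bar> \<le> \<bar>\<epsilon>\<bar> * (L * (2 * norm (X s, Y s)))" if "\<bar>p\<bar> \<le> L * (\<bar>X s\<bar> + \<bar>Y s\<bar>)" for p
      proof -
        have "L * (\<bar>X s\<bar> + \<bar>Y s\<bar>) \<le> L * (2 * norm (X s, Y s))" using n L by (intro mult_left_mono) auto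
        thus ?thesis unfolding abs_mult using that by (intro mult_left_mono) auto
      qed
      have "norm (Y s + \<epsilon> * pa s, - X s + \<epsilon> * pb s) \<le> \<bar>Y s + \<epsilon> * pa s\<bar> + \<bar>- X s + \<epsilon> * pb s\<bar>"
        using norm_Pair_le[of "Y s + \<epsilon> * pa s" "- X s + \<epsilon> * pb s"] by simp
      also have "\<dots> \<le> (\<bar>Y s\<bar> + \<bar>\<epsilon> * pa s\<bar>) + (\<bar>X s\<bar> + \<bar>\<epsilon> * pb s\<bar>)" by simp
      also have "\<dots> \<le> 2 * norm (X s, Y s) + 2 * (\<bar>\<epsilon>\<bar> * (L * (2 * norm (X s, Y s))))"
        using n m[OF pab(1)[of s]] m[OF pab(2)[of s]] by linarith
      also have "\<dots> = (2 + 4 * \<bar>\<epsilon>\<bar> * L) * norm (X s, Y s)" by (simp add: algebra_simps)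
      finally show "norm (Y s + \<epsilon> * pa s, - X s + \<epsilon> * pb s) \<le> (2 + 4 * \<bar>\<epsilon>\<bar> * L) * norm (X s, Y s)" .
    qed (use z in \<open>simp add: zero_prod_def\<close>)
    hence "\<gamma> s = (x0, y0)" for s by (simp add: \<gamma> X_def Y_def zero_prod_def)
    thus False using nonc by simp
  qed
  \<comment> \<open>\<open>Y\<close> is the real part because the angle is measured so that X is the
    sine component and Y the cosine component.\<close>
  define \<zeta> where "\<zeta> t = Complex (Y t) (X t)" for t
  define \<zeta>' where "\<zeta>' t = Complex (- X t + \<epsilon> * pb t) (Y t + \<epsilon> * pa t)" for t
  have \<zeta>nz: "\<zeta> t \<noteq> 0" for t using nz[of t] by (auto simp: \<zeta>_def complex_eq_iff)
  have Complex_eq': "Complex u v = of_real u + of_real v * \<i>" for u v by (simp add: complex_eq_iff)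
  have d\<zeta>: "(\<zeta> has_vector_derivative \<zeta>' t) (at t)" for t
    unfolding \<zeta>_def[abs_def] \<zeta>'_def Complex_eq'
    using dX[of t] dY[of t] by (intro has_vector_derivative_add has_vector_derivative_mult_left has_vector_derivative_of_real) 
      (auto simp: has_real_derivative_iff_has_vector_derivative)
  have contXY: "continuous_on UNIV x" "continuous_on UNIV y"
  proof -
    have "continuous_on UNIV \<gamma>" using der\<gamma> by (meson continuous_at_imp_continuous_on has_vector_derivative_continuous)
    thus "continuous_on UNIV x" "continuous_on UNIV y"
      unfolding x_def[abs_def] y_def[abs_def] by (auto intro: continuous_intros)
  qed
  have fac: "1 - \<alpha> * x t \<noteq> 0" "\<bar>1 - \<alpha> * x t\<bar> \<ge> \<delta>'" if "\<alpha> = \<alpha>1 \<or> \<alpha> = \<alpha>2" for t \<alpha>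
  proof -
    have "\<bar>1 - \<alpha> * x t\<bar> = norm (1 - of_real \<alpha> * of_real (x t) :: complex)"
      by (metis norm_of_real of_real_1 of_real_diff of_real_mult)
    thus "\<bar>1 - \<alpha> * x t\<bar> \<ge> \<delta>'" using wd'[of t] that by (auto simp: pole_free_box_def)
    thus "1 - \<alpha> * x t \<noteq> 0" using \<delta> by auto
  qed
  have cont\<zeta>': "continuous_on UNIV \<zeta>'"
    unfolding \<zeta>'_def[abs_def] X_def Y_def pa_def pb_def rquot_def den_def split_beta Complex_eq'
    by (intro continuous_intros contXY) (use fac in auto)
  have cont\<zeta>: "continuous_on UNIV \<zeta>"
    using d\<zeta> by (meson continuous_at_imp_continuous_on has_vector_derivative_continuous)
  \<comment> \<open>A primitive of \<zeta>'/\<zeta> is a logarithm of \<zeta> t / \<zeta> 0. Its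
    imaginary part lifts the angle to the whole time axis without branch cuts.\<close>
  obtain \<Lambda> where \<Lambda>: "\<And>t. (\<Lambda> has_vector_derivative \<zeta>' t / \<zeta> t) (at t)" "\<Lambda> 0 = 0"
    by (rule continuous_antiderivative_UNIV[of "\<lambda>t. \<zeta>' t / \<zeta> t"]) (use \<zeta>nz cont\<zeta> cont\<zeta>' in \<open>auto intro!: continuous_intros\<close>)
  have \<zeta>_exp: "\<zeta> t = \<zeta> 0 * exp (\<Lambda> t)" for t
  proof -
    have "((\<lambda>t. \<zeta> t * exp (- \<Lambda> t)) has_vector_derivative 0) (at t within UNIV)" for t
    proof -
      have "((\<lambda>t. exp (- \<Lambda> t)) has_vector_derivative (- (\<zeta>' t / \<zeta> t)) * exp (- \<Lambda> t)) (at t)"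
        using field_vector_diff_chain_at[of "\<lambda>t. - \<Lambda> t" "- (\<zeta>' t / \<zeta> t)" t exp "exp (- \<Lambda> t)"] \<Lambda>(1)[of t] DERIV_exp[of "- \<Lambda> t"]
        by (auto simp: o_def intro: has_vector_derivative_minus)
      from has_vector_derivative_mult[OF d\<zeta>[of t] this] show ?thesis using \<zeta>nz[of t] by simp
    qed
    then obtain c where "\<And>t. t \<in> UNIV \<Longrightarrow> \<zeta> t * exp (- \<Lambda> t) = c"
      using has_vector_derivative_zero_constant[of UNIV "\<lambda>t. \<zeta> t * exp (- \<Lambda> t)"] by auto
    hence "\<zeta> t * exp (- \<Lambda> t) = \<zeta> 0 * exp (- \<Lambda> 0)" by simp
    thus ?thesis by (simp add: exp_minus \<Lambda>(2) field_simps)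
  qed
  define \<rho> where "\<rho> t = norm (\<zeta> t)" for t
  define \<theta> where "\<theta> t = Arg (\<zeta> 0) + Im (\<Lambda> t)" for t
  have \<rho>pos: "\<rho> t > 0" for t using \<zeta>nz by (simp add: \<rho>_def)
  have \<rho>_exp: "\<rho> t = \<rho> 0 * exp (Re (\<Lambda> t))" for t
    unfolding \<rho>_def by (subst \<zeta>_exp) (simp add: norm_mult)
  have \<zeta>_polar: "\<zeta> t = rcis (\<rho> t) (\<theta> t)" for t
  proof -
    have "\<zeta> t = rcis (\<rho> 0) (Arg (\<zeta> 0)) * rcis (exp (Re (\<Lambda> t))) (Im (\<Lambda> t))"
      unfolding \<zeta>_exp[of t] by (simp add: \<rho>_def rcis_cmod_Arg) (simp add: rcis_def exp_eq_polar)
    thus ?thesis by (simp add: rcis_mult \<rho>_exp[of t] \<theta>_def)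
  qed
  have XY: "X t = \<rho> t * sin (\<theta> t)" "Y t = \<rho> t * cos (\<theta> t)" for t
    using arg_cong[OF \<zeta>_polar[of t], of Im] arg_cong[OF \<zeta>_polar[of t], of Re] by (simp_all add: \<zeta>_def)
  have x_polar: "x t = x0 + \<rho> t * sin (\<theta> t)" "y t = y0 + \<rho> t * cos (\<theta> t)" for t
    using XY[of t] by (simp_all add: X_def Y_def)
  define Sr Tr where "Sr t = sin (\<theta> t) * pa t + cos (\<theta> t) * pb t" and "Tr t = cos (\<theta> t) * pa t - sin (\<theta> t) * pb t" for t
  have F_real: "F (\<theta> t) (of_real (\<rho> t)) = of_real (\<epsilon> * (\<rho> t * Sr t / (\<rho> t + \<epsilon> * Tr t)))" for t
  proof -
    have "of_real x0 + of_real (\<rho> t) * of_real (sin (\<theta> t)) = complex_of_real (x t)" 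
      "of_real y0 + of_real (\<rho> t) * of_real (cos (\<theta> t)) = complex_of_real (y t)" by (simp_all add: x_polar)
    hence "Na (\<theta> t) (of_real (\<rho> t)) = of_real (pa t)" "Nb (\<theta> t) (of_real (\<rho> t)) = of_real (pb t)"
      by (simp_all add: Na_def Nb_def cquot_of_real pa_def pb_def)
    thus ?thesis by (simp add: F_def S_def T_def Sr_def Tr_def)
  qed
  have Re_Im: "Re (\<zeta>' t / \<zeta> t) = \<epsilon> * Sr t / \<rho> t" "Im (\<zeta>' t / \<zeta> t) = 1 + \<epsilon> * Tr t / \<rho> t" for t
  proof -
    have n2: "(Re (\<zeta> t))\<^sup>2 + (Im (\<zeta> t))\<^sup>2 = (\<rho> t)\<^sup>2" by (simp add: \<rho>_def cmod_def)
    have sc: "(sin (\<theta> t))\<^sup>2 + (cos (\<theta> t))\<^sup>2 = 1" by simp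
    have "Re (\<zeta>' t / \<zeta> t) = ((- X t + \<epsilon> * pb t) * Y t + (Y t + \<epsilon> * pa t) * X t) / (\<rho> t)\<^sup>2"
      unfolding Re_divide n2 by (simp add: \<zeta>_def \<zeta>'_def)
    also have "(- X t + \<epsilon> * pb t) * Y t + (Y t + \<epsilon> * pa t) * X t = \<epsilon> * Sr t * \<rho> t"
      unfolding XY Sr_def by (simp add: algebra_simps)
    finally show "Re (\<zeta>' t / \<zeta> t) = \<epsilon> * Sr t / \<rho> t" using \<rho>pos[of t] by (simp add: power2_eq_square)
    have "Im (\<zeta>' t / \<zeta> t) = ((Y t + \<epsilon> * pa t) * Y t - (- X t + \<epsilon> * pb t) * X t) / (\<rho> t)\<^sup>2"
      unfolding Im_divide n2 by (simp add: \<zeta>_def \<zeta>'_def)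
    also have "(Y t + \<epsilon> * pa t) * Y t - (- X t + \<epsilon> * pb t) * X t = (\<rho> t)\<^sup>2 + \<epsilon> * Tr t * \<rho> t"
      unfolding XY Tr_def using sc by algebra
    finally show "Im (\<zeta>' t / \<zeta> t) = 1 + \<epsilon> * Tr t / \<rho> t" using \<rho>pos[of t] by (simp add: power2_eq_square add_divide_distrib)
  qed
  have STr: "\<bar>Sr t\<bar> \<le> 4 * L * \<rho> t" "\<bar>Tr t\<bar> \<le> 4 * L * \<rho> t" for t
  proof -
    have "\<bar>X t\<bar> \<le> \<rho> t" "\<bar>Y t\<bar> \<le> \<rho> t" unfolding XY using \<rho>pos[of t] by (simp_all add: abs_mult mult_left_le)
    hence "L * (\<bar>X t\<bar> + \<bar>Y t\<bar>) \<le> L * (2 * \<rho> t)" using L by (intro mult_left_mono) auto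
    hence p: "\<bar>pa t\<bar> \<le> 2 * L * \<rho> t" "\<bar>pb t\<bar> \<le> 2 * L * \<rho> t" using pab[of t] by linarith+
    have sc: "\<bar>sin (\<theta> t) * v\<bar> \<le> \<bar>v\<bar>" "\<bar>cos (\<theta> t) * v\<bar> \<le> \<bar>v\<bar>" for v
      by (simp_all add: abs_mult mult_left_le_one_le)
    show "\<bar>Sr t\<bar> \<le> 4 * L * \<rho> t" "\<bar>Tr t\<bar> \<le> 4 * L * \<rho> t"
      unfolding Sr_def Tr_def using sc[of "pa t"] sc[of "pb t"] p by linarith+
  qed
  have eTr: "\<bar>\<epsilon> * Tr t\<bar> \<le> \<rho> t / 2" for t
  proof -
    have "\<bar>\<epsilon> * Tr t\<bar> \<le> \<bar>\<epsilon>\<bar> * (4 * L * \<rho> t)" unfolding abs_mult by (intro mult_left_mono STr) auto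
    also have "\<dots> = (8 * L * \<bar>\<epsilon>\<bar>) * (\<rho> t / 2)" by simp
    also have "\<dots> \<le> 1 * (\<rho> t / 2)" using small(1) \<rho>pos[of t] by (intro mult_right_mono) auto
    finally show ?thesis by simp
  qed
  have d\<Lambda>: "((\<lambda>t. Re (\<Lambda> t)) has_real_derivative \<epsilon> * Sr t / \<rho> t) (at t)"
    "((\<lambda>t. Im (\<Lambda> t)) has_real_derivative 1 + \<epsilon> * Tr t / \<rho> t) (at t)" for t
    unfolding has_real_derivative_iff_has_vector_derivative Re_Im[symmetric]
    using bounded_linear.has_vector_derivative[OF bounded_linear_Re \<Lambda>(1)[of t]]
      bounded_linear.has_vector_derivative[OF bounded_linear_Im \<Lambda>(1)[of t]] by auto
  have d\<theta>: "(\<theta> has_real_derivative 1 + \<epsilon> * Tr t / \<rho> t) (at t)" for t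
    unfolding \<theta>_def[abs_def] using DERIV_add[OF DERIV_const d\<Lambda>(2)[of t], of "Arg (\<zeta> 0)"] by simp
  have d\<rho>: "(\<rho> has_real_derivative \<epsilon> * Sr t) (at t)" for t
  proof -
    have "((\<lambda>t. \<rho> 0 * exp (Re (\<Lambda> t))) has_real_derivative \<rho> 0 * (exp (Re (\<Lambda> t)) * (\<epsilon> * Sr t / \<rho> t))) (at t)"
      by (rule DERIV_cmult[OF DERIV_chain2[OF DERIV_exp d\<Lambda>(1)]])
    moreover have "\<rho> 0 * (exp (Re (\<Lambda> t)) * (\<epsilon> * Sr t / \<rho> t)) = \<epsilon> * Sr t"
    proof -
      have "\<rho> 0 * (exp (Re (\<Lambda> t)) * (\<epsilon> * Sr t / \<rho> t)) = \<rho> t * (\<epsilon> * Sr t / \<rho> t)"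
        unfolding mult.assoc[symmetric] \<rho>_exp[of t, symmetric] ..
      thus ?thesis using \<rho>pos[of t] by simp
    qed
    moreover have "(\<lambda>t. \<rho> 0 * exp (Re (\<Lambda> t))) = \<rho>" by (rule ext) (rule \<rho>_exp[symmetric])
    ultimately show ?thesis by simp
  qed
  have \<theta>ge: "1 + \<epsilon> * Tr t / \<rho> t \<ge> 1 / 2" for t
  proof -
    have "- (\<epsilon> * Tr t) / \<rho> t \<le> 1 / 2" using eTr[of t] \<rho>pos[of t] by (simp add: field_simps)
    thus ?thesis by simp
  qed
  obtain \<tau> where \<tau>: "\<And>v. \<theta> (\<tau> v) = v" "\<And>t. \<tau> (\<theta> t) = t" "\<And>v. (\<tau> has_real_derivative inverse (1 + \<epsilon> * Tr (\<tau> v) / \<rho> (\<tau> v))) (at v)"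
    using inverse_of_expanding[OF d\<theta> \<theta>ge] by blast
  define r where "r v = \<rho> (\<tau> v)" for v
  define r' where "r' v = \<epsilon> * (r v * Sr (\<tau> v) / (r v + \<epsilon> * Tr (\<tau> v)))" for v
  have rpos: "r v > 0" for v by (simp add: r_def \<rho>pos)
  have dr: "(r has_real_derivative r' v) (at v)" for v
  proof -
    have "(r has_real_derivative \<epsilon> * Sr (\<tau> v) * inverse (1 + \<epsilon> * Tr (\<tau> v) / \<rho> (\<tau> v))) (at v)"
      unfolding r_def[abs_def] by (rule DERIV_chain2[OF d\<rho> \<tau>(3)])
    moreover have "\<epsilon> * Sr (\<tau> v) * inverse (1 + \<epsilon> * Tr (\<tau> v) / \<rho> (\<tau> v)) = r' v"
      using \<rho>pos[of "\<tau> v"] by (simp add: r'_def r_def divide_simps)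
    ultimately show ?thesis by simp
  qed
  have F_r: "F v (of_real (r v)) = of_real (r' v)" for v
    using F_real[of "\<tau> v"] by (simp add: r_def r'_def \<tau>(1))
  have ode: "((\<lambda>v. complex_of_real (r v)) has_vector_derivative F v (of_real (r v))) (at v)" for v
    unfolding F_r by (rule has_vector_derivative_of_real) (use dr[of v] in \<open>simp add: has_real_derivative_iff_has_vector_derivative\<close>)
  have C_r: "C = range (\<lambda>v. (x0 + r v * sin v, y0 + r v * cos v))"
  proof -
    have "\<gamma> (\<tau> v) = (x0 + r v * sin v, y0 + r v * cos v)" for v
      by (simp add: \<gamma> x_polar \<tau>(1) r_def)
    moreover have "range \<gamma> = range (\<lambda>v. \<gamma> (\<tau> v))" using \<tau>(2) by (metis (no_types) image_image surjI)
    ultimately show ?thesis by (simp add: C)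
  qed
  \<comment> \<open>A crude bound from the box; it enters only the variation of the radius over a
    turn, where a factor \<epsilon> makes it harmless.\<close>
  have r_le: "r v \<le> 4 * R" for v
  proof -
    have xb: "\<bar>x t\<bar> \<le> R" "\<bar>y t\<bar> \<le> R" "\<bar>x0\<bar> \<le> R" "\<bar>y0\<bar> \<le> R" for t
      using wd[of t] center_Wd by (auto simp: pole_free_box_def)
    have b: "\<bar>X (\<tau> v)\<bar> \<le> 2 * R" "\<bar>Y (\<tau> v)\<bar> \<le> 2 * R"
      using abs_triangle_ineq4[of "x (\<tau> v)" x0] abs_triangle_ineq4[of "y (\<tau> v)" y0] xb(1,2)[of "\<tau> v"] xb(3,4)
      unfolding X_def Y_def by linarith+
    have "r v \<le> \<bar>Y (\<tau> v)\<bar> + \<bar>X (\<tau> v)\<bar>"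
      unfolding r_def \<rho>_def using cmod_le[of "\<zeta> (\<tau> v)"] by (simp add: \<zeta>_def)
    thus ?thesis using b by linarith
  qed
  have r'_le: "\<bar>r' v\<bar> \<le> 32 * L * \<bar>\<epsilon>\<bar> * R" for v
  proof -
    have dn: "r v + \<epsilon> * Tr (\<tau> v) \<ge> r v / 2" using eTr[of "\<tau> v"] by (simp add: r_def abs_le_iff)
    have "\<bar>r' v\<bar> = \<bar>\<epsilon>\<bar> * (r v * \<bar>Sr (\<tau> v)\<bar> / (r v + \<epsilon> * Tr (\<tau> v)))"
      using rpos[of v] dn by (simp add: r'_def abs_mult abs_divide)
    also have "\<dots> \<le> \<bar>\<epsilon>\<bar> * (r v * (4 * L * r v) / (r v / 2))"
      using rpos[of v] dn STr(1)[of "\<tau> v"] L by (intro mult_left_mono frac_le) (auto simp: r_def)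
    also have "\<dots> = 8 * L * \<bar>\<epsilon>\<bar> * r v" using rpos[of v] by simp
    also have "\<dots> \<le> 8 * L * \<bar>\<epsilon>\<bar> * (4 * R)" using L by (intro mult_left_mono r_le) auto
    finally show ?thesis by simp
  qed
  obtain \<alpha> where \<alpha>: "\<alpha> = \<alpha>1 \<or> \<alpha> = \<alpha>2" "\<bar>\<alpha>\<bar> * \<sigma> = 1" by (rule sigma_alpha)
  \<comment> \<open>At angle 0 the orbit has x = x0, which is on the origin's side of the nearer
    line. The orbit never meets the line and therefore stays on that side.\<close>
  have fac_pos: "1 - \<alpha> * (x0 + r v * sin v) > 0" for v
  proof (rule nonvanishing_continuous_sign[of "\<lambda>v. 1 - \<alpha> * (x0 + r v * sin v)" 0])
    have "continuous_on UNIV r" using dr by (meson DERIV_isCont continuous_at_imp_continuous_on)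
    thus "continuous_on UNIV (\<lambda>v. 1 - \<alpha> * (x0 + r v * sin v))" by (intro continuous_intros)
    show "1 - \<alpha> * (x0 + r v * sin v) \<noteq> 0" for v
      using fac(1)[OF \<alpha>(1), of "\<tau> v"] by (simp add: x_polar \<tau>(1) r_def)
    have "\<bar>x0\<bar> < \<sigma>" using \<rho> by linarith
    hence "\<bar>\<alpha>\<bar> * \<bar>x0\<bar> < \<bar>\<alpha>\<bar> * \<sigma>" using \<alpha>(1) \<alpha>_nz by (intro mult_strict_left_mono) auto
    hence "\<bar>\<alpha> * x0\<bar> < 1" using \<alpha>(2) by (simp add: abs_mult)
    thus "1 - \<alpha> * (x0 + r 0 * sin 0) > 0" by simp
  qed
  have r_lt: "r v < \<rho>0" for v
  proof -
    \<comment> \<open>The direction of the nearer line: there \<alpha> x = \<alpha> x0 + |\<alpha>|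
      r, and the margin \<delta>' bounds r directly. Rounding up in \<open>k\<close> gives an
      equivalent angle \<open>w\<close> at most one turn after \<open>v\<close>, and the bound on r'
      carries the estimate back to \<open>v\<close>.\<close>
    define s where "s = sgn \<alpha> * pi / 2"
    define k where "k = \<lceil>(v - s) / (2 * pi)\<rceil>"
    define w where "w = s + 2 * pi * of_int k"
    have "(v - s) / (2 * pi) \<le> of_int k" "of_int k < (v - s) / (2 * pi) + 1"
      unfolding k_def by linarith+
    hence "v - s \<le> 2 * pi * of_int k" "2 * pi * of_int k < v - s + 2 * pi" by (simp_all add: field_simps)
    hence w: "v \<le> w" "w \<le> v + 2 * pi" by (auto simp: w_def)
    have "sin w = sin s" unfolding w_def sin_add by (simp only: sin_int_2pin cos_int_2pin)
    moreover have "\<alpha> * sin s = \<bar>\<alpha>\<bar>" using \<alpha>(1) \<alpha>_nz by (auto simp: s_def sgn_if abs_if)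
    ultimately have sw: "\<alpha> * sin w = \<bar>\<alpha>\<bar>" by simp
    have "\<bar>1 - \<alpha> * (x0 + r w * sin w)\<bar> \<ge> \<delta>'"
      using fac(2)[OF \<alpha>(1), of "\<tau> w"] by (simp add: x_polar \<tau>(1) r_def)
    hence "\<delta>' \<le> 1 - \<alpha> * (x0 + r w * sin w)" using fac_pos[of w] by simp
    also have "\<dots> = 1 - \<alpha> * x0 - r w * \<bar>\<alpha>\<bar>" unfolding sw[symmetric] by (simp add: algebra_simps)
    finally have "\<bar>\<alpha>\<bar> * r w \<le> 1 - \<delta>' + \<bar>\<alpha>\<bar> * \<bar>x0\<bar>"
      using abs_ge_minus_self[of "\<alpha> * x0"] by (simp add: abs_mult mult.commute)
    hence "\<sigma> * (\<bar>\<alpha>\<bar> * r w) \<le> \<sigma> * (1 - \<delta>' + \<bar>\<alpha>\<bar> * \<bar>x0\<bar>)" using sigma_pos by (intro mult_left_mono) auto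
    hence "(\<bar>\<alpha>\<bar> * \<sigma>) * r w \<le> (1 - \<delta>') * \<sigma> + (\<bar>\<alpha>\<bar> * \<sigma>) * \<bar>x0\<bar>" by (simp add: algebra_simps)
    hence rw: "r w \<le> (1 - \<delta>') * \<sigma> + \<bar>\<epsilon>\<bar> * L" using \<alpha>(2) equil(1) by simp
    have "\<bar>r v - r w\<bar> \<le> (32 * L * \<bar>\<epsilon>\<bar> * R) * \<bar>v - w\<bar>"
    proof (cases "v = w")
      case False
      hence "v < w" using w by simp
      from MVT2[OF this, of r r'] dr obtain z where "r w - r v = (w - v) * r' z" by auto
      moreover have "(w - v) * \<bar>r' z\<bar> \<le> (w - v) * (32 * L * \<bar>\<epsilon>\<bar> * R)" using w by (intro mult_left_mono r'_le) auto
      ultimately have "\<bar>r w - r v\<bar> \<le> (w - v) * (32 * L * \<bar>\<epsilon>\<bar> * R)" using w by (simp add: abs_mult)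
      thus ?thesis using w by (simp add: abs_minus_commute mult.commute)
    qed simp
    also have "\<dots> \<le> (32 * L * \<bar>\<epsilon>\<bar> * R) * (2 * pi)"
    proof (rule mult_left_mono)
      show "0 \<le> 32 * L * \<bar>\<epsilon>\<bar> * R" using r'_le[of v] abs_ge_zero[of "r' v"] by linarith
    qed (use w in auto)
    finally have "r v \<le> r w + 64 * pi * L * \<bar>\<epsilon>\<bar> * R" by (simp add: mult_ac)
    thus ?thesis using rw small2 by linarith
  qed
  have period: "r (v + 2 * pi) = r v" for v
  proof (rule ccontr)
    assume ne: "r (v + 2 * pi) \<noteq> r v"
    \<comment> \<open>A period of the orbit covers k turns, and k might exceed 1. By uniqueness
      \<open>g\<close> has no zero, hence one sign, so the radius would change monotonically from
      turn to turn and could not return after k of them.\<close>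
    define g where "g u = r (u + 2 * pi) - r u" for u
    have dg: "((\<lambda>u. complex_of_real (g u)) has_vector_derivative F u (of_real (r (u + 2 * pi))) - F u (of_real (r u))) (at u)" for u
    proof -
      have "((\<lambda>u. complex_of_real (r (u + 2 * pi))) has_vector_derivative F u (of_real (r (u + 2 * pi)))) (at u)"
      proof -
        have "((\<lambda>u. u + 2 * pi) has_vector_derivative 1) (at u)"
          using DERIV_add[OF DERIV_ident DERIV_const, of "2 * pi" u UNIV] by (simp add: has_real_derivative_iff_has_vector_derivative)
        from vector_diff_chain_at[OF this ode[of "u + 2 * pi"]] show ?thesis by (simp add: o_def F_periodic)
      qed
      from has_vector_derivative_diff[OF this ode[of u]] show ?thesis by (simp add: g_def)
    qed
    have gnz: "g u \<noteq> 0" for u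
    proof
      assume u: "g u = 0"
      have "complex_of_real (g v) = 0"
      proof (rule linear_growth_eq_zero_UNIV[OF dg, of Lip u])
        fix s
        have "complex_of_real (r s) \<in> ball 0 \<rho>2" "complex_of_real (r (s + 2 * pi)) \<in> ball 0 \<rho>2"
          using rpos[of s] r_lt[of s] rpos[of "s + 2 * pi"] r_lt[of "s + 2 * pi"] \<rho> \<rho>0 by auto
        from F_lip[OF this(2,1), of s] show "norm (F s (of_real (r (s + 2 * pi))) - F s (of_real (r s))) \<le> Lip * norm (complex_of_real (g s))"
          by (simp add: g_def)
      qed (use u in simp)
      thus False using ne by (simp add: g_def)
    qed
    have cg: "continuous_on UNIV g"
    proof -
      have "continuous_on UNIV r" using dr by (meson DERIV_isCont continuous_at_imp_continuous_on)
      moreover from this have "continuous_on UNIV (\<lambda>u. r (u + 2 * pi))"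
        by (rule continuous_on_compose2) (auto intro!: continuous_intros)
      ultimately show ?thesis unfolding g_def[abs_def] by (intro continuous_on_diff)
    qed
    have \<zeta>P: "\<zeta> P = \<zeta> 0" using per[of 0] by (simp add: \<zeta>_def X_def Y_def x_def y_def)
    hence \<rho>P: "\<rho> P = \<rho> 0" by (simp add: \<rho>_def)
    have "rcis (\<rho> 0) (\<theta> P) = rcis (\<rho> 0) (\<theta> 0)"
      using \<zeta>P unfolding \<zeta>_polar \<rho>P .
    hence cis: "cis (\<theta> P) = cis (\<theta> 0)" using \<rho>pos[of 0] by (simp add: rcis_def)
    from cis obtain k :: int where k: "\<theta> P = \<theta> 0 + 2 * pi * of_int k"
      using sin_cos_eq_iff[of "\<theta> P" "\<theta> 0"] by (auto simp: complex_eq_iff mult_ac)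
    have "\<theta> P > \<theta> 0"
    proof -
      obtain z where "\<theta> P - \<theta> 0 = (P - 0) * (1 + \<epsilon> * Tr z / \<rho> z)" using MVT2[OF P, of \<theta>, OF d\<theta>] by blast
      moreover have "(P - 0) * (1 + \<epsilon> * Tr z / \<rho> z) > 0" 
      proof (rule mult_pos_pos)
        show "0 < 1 + \<epsilon> * Tr z / \<rho> z" by (rule less_le_trans[OF _ \<theta>ge]) simp
      qed (use P in simp)
      ultimately show ?thesis by simp
    qed
    hence "0 < of_int k * (2 * pi)" using k by (simp add: mult.commute)
    hence "k > 0" using pi_gt_zero by (simp add: zero_less_mult_iff)
    then obtain j where j: "k = int (Suc j)" by (metis gr0_implies_Suc zero_less_imp_eq_int)
    have e: "\<theta> 0 + 2 * pi * real (Suc j) = \<theta> P" unfolding k j by simp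
    have "r (\<theta> 0 + 2 * pi * real (Suc j)) = r (\<theta> 0)" unfolding e r_def \<tau>(2) by (rule \<rho>P)
    moreover have "r (u + 2 * pi * real (Suc j)) - r u \<noteq> 0" for u
    proof -
      define \<iota> where "\<iota> = sgn (g v)"
      have sg: "\<iota> * g w > 0" for w
        by (rule nonvanishing_continuous_sign[of "\<lambda>w. \<iota> * g w" v])
          (use gnz in \<open>auto intro!: continuous_on_mult continuous_on_minus continuous_on_const cg simp: \<iota>_def sgn_mult mult_sgn_abs linorder_neq_iff sgn_if\<close>)
      have "\<iota> * (r (u + 2 * pi * real (Suc j)) - r u) > 0"
      proof (induction j)
        case 0 thus ?case using sg[of u] by (simp add: g_def)
      next
        case (Suc j)
        thus ?case using sg[of "u + 2 * pi * real (Suc j)"] by (simp add: g_def algebra_simps)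
      qed
      thus ?thesis by auto
    qed
    ultimately show False by simp
  qed
  show ?thesis by (rule that[OF rpos r_lt period ode C_r])
qed


lemma ode_solution_eq:
  assumes r: "\<And>t. r t > 0" "\<And>t. r t < \<rho>0"
      "\<And>t. ((\<lambda>t. complex_of_real (r t)) has_vector_derivative F t (of_real (r t))) (at t)"
    and s: "\<And>t. s t > 0" "\<And>t. s t < \<rho>0"
      "\<And>t. ((\<lambda>t. complex_of_real (s t)) has_vector_derivative F t (of_real (s t))) (at t)"
    and eq: "r t0 = s t0"
  shows "r = s"
proof
  fix t
  have "complex_of_real (r t) - of_real (s t) = 0"
  proof (rule linear_growth_eq_zero_UNIV[of "\<lambda>t. complex_of_real (r t) - of_real (s t)" "\<lambda>t. F t (of_real (r t)) - F t (of_real (s t))" Lip t0])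
    show "norm (F t (of_real (r t)) - F t (of_real (s t))) \<le> Lip * norm (complex_of_real (r t) - of_real (s t))" for t
      using r(1,2)[of t] s(1,2)[of t] \<rho> \<rho>0 by (intro F_lip) auto
  qed (use eq in \<open>auto intro!: has_vector_derivative_diff r(3) s(3)\<close>)
  thus "r t = s t" by simp
qed

text \<open>The nodes are the radii at angle 0, the negated radii at angle pi, and 0 from the factor
  z. Different orbits give different nodes because radial solutions that agree at one angle
  coincide.\<close>

lemma displacement_zeros:
  assumes fin: "finite \<C>" and po: "\<And>C. C \<in> \<C> \<Longrightarrow> periodic_orbit field W C"
    and CV: "\<And>C x y. C \<in> \<C> \<Longrightarrow> (x, y) \<in> C \<Longrightarrow> (of_real x, of_real y) \<in> pole_free_box \<delta>' R"
  obtains d Z where "d holomorphic_on ball 0 \<rho>1"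
    "\<And>z. z \<in> ball 0 \<rho>1 \<Longrightarrow> norm (d z - of_real \<epsilon> * cmelnikov a b z) \<le> Cd * \<epsilon>\<^sup>2"
    "finite Z" "Z \<subseteq> cball 0 \<rho>0" "card Z = 2 * card \<C> + 1" "\<And>z. z \<in> Z \<Longrightarrow> z * d z = 0"
proof -
  obtain \<phi> where \<phi>: "\<And>t. t \<in> {0..2 * pi} \<Longrightarrow> \<phi> t holomorphic_on ball 0 \<rho>1"
    "\<And>t z. t \<in> {0..2 * pi} \<Longrightarrow> z \<in> ball 0 \<rho>1 \<Longrightarrow> \<phi> t z \<in> ball 0 \<rho>2"
    "\<And>t z. t \<in> {0..2 * pi} \<Longrightarrow> z \<in> ball 0 \<rho>1 \<Longrightarrow>
           ((\<lambda>s. \<phi> s z) has_vector_derivative F t (\<phi> t z)) (at t within {0..2 * pi})"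
    "\<And>z. z \<in> ball 0 \<rho>1 \<Longrightarrow> \<phi> 0 z = z"
    "\<And>z. z \<in> ball 0 \<rho>1 \<Longrightarrow> norm (\<phi> (2 * pi) z - z - of_real \<epsilon> * cmelnikov a b z) \<le> Cd * \<epsilon>\<^sup>2"
    using poincare_flow by blast
  \<comment> \<open>Identifies the Picard flow, constructed for one turn only, with the global
    radial solutions that come from orbits.\<close>
  have unique: "\<phi> (2 * pi) (u 0) = u (2 * pi)"
    if u: "\<And>t. (u has_vector_derivative F t (u t)) (at t)" "\<And>t. norm (u t) < \<rho>0" for u
  proof -
    have u0: "u 0 \<in> ball 0 \<rho>1" using u(2)[of 0] \<rho>0 by simp
    have "\<phi> (2 * pi) (u 0) - u (2 * pi) = 0"
    proof (rule linear_growth_eq_zero[of 0 "2 * pi" "\<lambda>t. \<phi> t (u 0) - u t" "\<lambda>t. F t (\<phi> t (u 0)) - F t (u t)" Lip 0])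
      fix t assume t: "t \<in> {0..2 * pi}"
      show "((\<lambda>t. \<phi> t (u 0) - u t) has_vector_derivative F t (\<phi> t (u 0)) - F t (u t)) (at t within {0..2 * pi})"
        by (intro has_vector_derivative_diff \<phi>(3) t u0 has_vector_derivative_at_within[OF u(1)])
      show "norm (F t (\<phi> t (u 0)) - F t (u t)) \<le> Lip * norm (\<phi> t (u 0) - u t)"
        by (rule F_lip[OF \<phi>(2)[OF t u0]]) (use u(2)[of t] \<rho> \<rho>0 in auto)
    qed (use \<phi>(4)[OF u0] in auto)
    thus ?thesis by simp
  qed
  have "\<forall>C\<in>\<C>. \<exists>r. (\<forall>t. r t > 0) \<and> (\<forall>t. r t < \<rho>0) \<and> (\<forall>t. r (t + 2 * pi) = r t) \<and>
    (\<forall>t. ((\<lambda>t. complex_of_real (r t)) has_vector_derivative F t (of_real (r t))) (at t)) \<and>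
    C = range (\<lambda>t. (x0 + r t * sin t, y0 + r t * cos t))"
  proof
    fix C assume C: "C \<in> \<C>"
    show "\<exists>r. (\<forall>t. r t > 0) \<and> (\<forall>t. r t < \<rho>0) \<and> (\<forall>t. r (t + 2 * pi) = r t) \<and>
    (\<forall>t. ((\<lambda>t. complex_of_real (r t)) has_vector_derivative F t (of_real (r t))) (at t)) \<and>
    C = range (\<lambda>t. (x0 + r t * sin t, y0 + r t * cos t))"
    proof (rule periodic_orbit_polar[OF po[OF C]])
      show "(of_real x, of_real y) \<in> pole_free_box \<delta>' R" if "(x, y) \<in> C" for x y by (rule CV[OF C that])
      fix r :: "real \<Rightarrow> real"
      assume h: "\<And>\<theta>. r \<theta> > 0" "\<And>\<theta>. r \<theta> < \<rho>0" "\<And>\<theta>. r (\<theta> + 2 * pi) = r \<theta>"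
      "\<And>\<theta>. ((\<lambda>\<theta>. complex_of_real (r \<theta>)) has_vector_derivative F \<theta> (of_real (r \<theta>))) (at \<theta>)"
      "C = range (\<lambda>\<theta>. (x0 + r \<theta> * sin \<theta>, y0 + r \<theta> * cos \<theta>))"
      show ?thesis by (intro exI[of _ r] conjI allI h)
    qed
  qed
  from bchoice[OF this] obtain r where R: "\<forall>C\<in>\<C>. (\<forall>t. r C t > 0) \<and> (\<forall>t. r C t < \<rho>0) \<and> (\<forall>t. r C (t + 2 * pi) = r C t) \<and>
    (\<forall>t. ((\<lambda>t. complex_of_real (r C t)) has_vector_derivative F t (of_real (r C t))) (at t)) \<and>
    C = range (\<lambda>t. (x0 + r C t * sin t, y0 + r C t * cos t))" by (elim exE)
  have r: "r C t > 0" "r C t < \<rho>0" "r C (t + 2 * pi) = r C t"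
    "((\<lambda>t. complex_of_real (r C t)) has_vector_derivative F t (of_real (r C t))) (at t)" if "C \<in> \<C>" for C t
    using R that by blast+
  have rC: "C = range (\<lambda>t. (x0 + r C t * sin t, y0 + r C t * cos t))" if "C \<in> \<C>" for C
    using R that by blast
  have inj: "C = D" if "C \<in> \<C>" "D \<in> \<C>" "r C t0 = r D t0" for C D t0
  proof -
    have eq: "r C = r D" by (rule ode_solution_eq[of "r C" "r D" t0]) (rule r that)+
    have "C = range (\<lambda>t. (x0 + r C t * sin t, y0 + r C t * cos t))" by (rule rC[OF that(1)])
    also have "\<dots> = range (\<lambda>t. (x0 + r D t * sin t, y0 + r D t * cos t))" by (simp only: eq)
    also have "\<dots> = D" by (rule rC[OF that(2), symmetric])
    finally show ?thesis .
  qed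
  define A where "A = (\<lambda>C. complex_of_real (r C 0)) ` \<C>"
  define B where "B = (\<lambda>C. - complex_of_real (r C pi)) ` \<C>"
  have cA: "card A = card \<C>" unfolding A_def by (rule card_image, rule inj_onI, rule inj[of _ _ 0]) simp_all
  have cB: "card B = card \<C>" unfolding B_def by (rule card_image, rule inj_onI, rule inj[of _ _ pi]) simp_all
  have sgn: "Re z > 0" if "z \<in> A" for z using that r(1) by (auto simp: A_def)
  have sgn': "Re z < 0" if "z \<in> B" for z using that r(1) by (auto simp: B_def)
  have finAB: "finite A" "finite B" using fin by (auto simp: A_def B_def)
  have disj: "A \<inter> B = {}" "0 \<notin> A \<union> B" using sgn sgn' by fastforce+
  have zero: "\<phi> (2 * pi) z - z = 0" if "z \<in> A \<union> B" for z
    using that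
  proof
    assume "z \<in> A"
    then obtain C where C: "C \<in> \<C>" "z = of_real (r C 0)" by (auto simp: A_def)
    have "\<phi> (2 * pi) (of_real (r C 0)) = of_real (r C (2 * pi))"
      by (rule unique[of "\<lambda>t. of_real (r C t)"]) (use r(1,2,4)[OF C(1)] in \<open>auto simp: abs_of_pos\<close>)
    thus ?thesis using r(3)[OF C(1), of 0] C(2) by simp
  next
    assume "z \<in> B"
    then obtain C where C: "C \<in> \<C>" "z = - of_real (r C pi)" by (auto simp: B_def)
    \<comment> \<open>By \<open>F_antisym\<close> the function - r (t + pi) solves the radial
      equation, and it starts at the negated radius at angle pi. The addend 0 displays its initial
      value in the form that \<open>unique\<close> expects.\<close>
    have "\<phi> (2 * pi) (- of_real (r C (0 + pi))) = - of_real (r C (2 * pi + pi))"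
    proof (rule unique[of "\<lambda>t. - of_real (r C (t + pi))"])
      fix t
      have "((\<lambda>u. u + pi) has_vector_derivative 1) (at t)"
        using DERIV_add[OF DERIV_ident DERIV_const, of pi t UNIV] by (simp add: has_real_derivative_iff_has_vector_derivative)
      from has_vector_derivative_minus[OF vector_diff_chain_at[OF this r(4)[OF C(1), of "t + pi"]]]
      show "((\<lambda>t. - complex_of_real (r C (t + pi))) has_vector_derivative F t (- of_real (r C (t + pi)))) (at t)"
        using F_antisym[of t "- of_real (r C (t + pi))"] by (simp add: o_def)
      show "norm (- complex_of_real (r C (t + pi))) < \<rho>0"
        using r(1,2)[OF C(1), of "t + pi"] by (simp add: abs_of_pos)
    qed
    thus ?thesis using r(3)[OF C(1), of pi] C(2) by (simp add: add.commute)
  qed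
  show ?thesis
  proof (rule that[of "\<lambda>z. \<phi> (2 * pi) z - z" "insert 0 (A \<union> B)"])
    show "(\<lambda>z. \<phi> (2 * pi) z - z) holomorphic_on ball 0 \<rho>1" by (intro holomorphic_intros \<phi>(1)) simp
    show "insert 0 (A \<union> B) \<subseteq> cball 0 \<rho>0"
      using r(1,2) \<rho>0 by (auto simp: A_def B_def abs_of_pos less_imp_le)
    have "card (insert 0 (A \<union> B)) = Suc (card (A \<union> B))" using finAB disj by (intro card_insert_disjoint) auto
    also have "card (A \<union> B) = card \<C> + card \<C>" using card_Un_disjoint[OF finAB disj(1)] cA cB by simp
    finally show "card (insert 0 (A \<union> B)) = 2 * card \<C> + 1" by simp
  qed (use finAB zero \<phi>(5) in auto)
qed

end

section \<open>Counting periodic orbits\<close>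

lemma ex_small_factor:
  fixes c d :: real
  assumes "d > 0"
  obtains e1 where "e1 > 0" "\<And>e. 0 \<le> e \<Longrightarrow> e < e1 \<Longrightarrow> c * e < d"
proof (rule that[of "d / (\<bar>c\<bar> + 1)"])
  fix e assume e: "0 \<le> e" "e < d / (\<bar>c\<bar> + 1)"
  have "c * e \<le> (\<bar>c\<bar> + 1) * e" using e by (intro mult_right_mono) auto
  also have "\<dots> < d" using e by (simp add: pos_less_divide_eq mult.commute)
  finally show "c * e < d" .
qed (use assms in simp)

section \<open>Uniform margins and the equilibrium\<close>

context melnikov_params begin

lemma Omega_compact_bounds:
  assumes V: "compact V" "V \<subseteq> Omega m1 m2 \<alpha>1 \<alpha>2"
  obtains d R where "0 < d" "d < 1" "\<And>x y. (x, y) \<in> V \<Longrightarrow> (of_real x, of_real y) \<in> pole_free_box d R"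
proof (cases "V = {}")
  case True thus ?thesis using that[of "1/2" 0] by simp
next
  case False
  let ?g = "\<lambda>p. min \<bar>1 - \<alpha>1 * fst p\<bar> \<bar>1 - \<alpha>2 * fst p\<bar>"
  have "continuous_on V ?g" by (intro continuous_intros)
  then obtain p where p: "p \<in> V" "\<And>p'. p' \<in> V \<Longrightarrow> ?g p \<le> ?g p'"
    using continuous_attains_inf[OF V(1) False] by blast
  have "den m1 m2 \<alpha>1 \<alpha>2 (fst p) \<noteq> 0" using p(1) V(2) by (auto simp: Omega_def)
  hence gp: "?g p > 0" using m by (auto simp: den_def)
  obtain R where R: "\<And>p. p \<in> V \<Longrightarrow> norm p \<le> R" using compact_imp_bounded[OF V(1)] by (auto simp: bounded_iff)
  \<comment> \<open>The cap 1/2 ensures e < 1, so that the radius (1 - e) \<sigma> is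
    positive.\<close>
  define e where "e = min (?g p) (1 / 2)"
  have e_le: "e \<le> ?g p" by (simp only: e_def min.cobounded1)
  show ?thesis
  proof (rule that[of e R])
    show "0 < e" "e < 1" using gp by (auto simp: e_def)
    fix x y assume xy: "(x, y) \<in> V"
    have "norm (1 - of_real \<alpha> * of_real x :: complex) = \<bar>1 - \<alpha> * x\<bar>" for \<alpha>
      by (metis norm_of_real of_real_1 of_real_diff of_real_mult)
    moreover have "\<bar>x\<bar> \<le> R" "\<bar>y\<bar> \<le> R"
      using R[OF xy] norm_fst_le[of x y] norm_snd_le[of y x] by auto
    moreover have "e \<le> ?g (x, y)" using e_le p(2)[OF xy] by (rule order_trans)
    hence "e \<le> \<bar>1 - \<alpha>1 * x\<bar>" "e \<le> \<bar>1 - \<alpha>2 * x\<bar>" by simp_all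
    ultimately show "(of_real x, of_real y) \<in> pole_free_box e R" unfolding pole_free_box_def by simp
  qed
qed

text \<open>The product |\<alpha>| \<sigma> is at most 1, since otherwise 1/|\<alpha>| would be an
  admissible radius; hence |\<alpha> x| \<le> 1 - d.\<close>

lemma pole_free_box_disc:
  assumes d: "0 < d" "d < 1" and x: "norm x \<le> (1 - d) * \<sigma>" and R: "(1 - d) * \<sigma> \<le> R" "norm y \<le> R"
  shows "(x, y) \<in> pole_free_box d R"
proof -
  have "d \<le> norm (1 - of_real \<alpha> * x)" if "\<And>r. 0 \<le> r \<Longrightarrow> r < \<sigma> \<Longrightarrow> \<bar>\<alpha>\<bar> * r < 1" for \<alpha>
  proof -
    have le1: "\<bar>\<alpha>\<bar> * \<sigma> \<le> 1"
    proof (rule ccontr)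
      assume "\<not> \<bar>\<alpha>\<bar> * \<sigma> \<le> 1"
      hence g: "\<bar>\<alpha>\<bar> * \<sigma> > 1" by simp
      hence "\<bar>\<alpha>\<bar> > 0" using sigma_pos by (metis abs_ge_zero less_le mult_zero_left not_one_less_zero)
      moreover from this have "1 / \<bar>\<alpha>\<bar> < \<sigma>" using g by (simp add: divide_less_eq mult.commute)
      ultimately show False using that[of "1 / \<bar>\<alpha>\<bar>"] by simp
    qed
    have "norm (of_real \<alpha> * x) \<le> \<bar>\<alpha>\<bar> * ((1 - d) * \<sigma>)" unfolding norm_mult norm_of_real by (intro mult_left_mono x) simp
    also have "\<dots> = (1 - d) * (\<bar>\<alpha>\<bar> * \<sigma>)" by simp
    also have "\<dots> \<le> (1 - d) * 1" using d le1 by (intro mult_left_mono) auto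
    finally show ?thesis using norm_triangle_ineq2[of 1 "of_real \<alpha> * x"] by simp
  qed
  from this[OF alpha_sigma(1)] this[OF alpha_sigma(2)] show ?thesis using x R by (auto simp: pole_free_box_def)
qed

text \<open>By linearity the difference is the integral for the coefficient differences, with
  integrand at most 2 \<kappa> L over a length of 2 pi. It carries the estimates from one
  coefficient pair to its neighbours.\<close>

lemma cmelnikov_diff_le:
  assumes c: "\<And>i j. i + j \<le> n \<Longrightarrow> \<bar>a i j - a' i j\<bar> \<le> \<kappa>" "\<And>i j. i + j \<le> n \<Longrightarrow> \<bar>b i j - b' i j\<bar> \<le> \<kappa>"
    and bound: "\<And>c \<kappa> x y. (\<And>i j. i + j \<le> n \<Longrightarrow> \<bar>c i j\<bar> \<le> \<kappa>) \<Longrightarrow> (x, y) \<in> pole_free_box \<delta> R \<Longrightarrow> norm (cquot c x y) \<le> \<kappa> * L"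
    and z: "norm z < \<sigma>" "\<And>t. (z * of_real (sin t), z * of_real (cos t)) \<in> pole_free_box \<delta> R"
  shows "norm (cmelnikov a b z - cmelnikov a' b' z) \<le> 4 * pi * \<kappa> * L"
proof -
  let ?g = "\<lambda>a b t. of_real (sin t) * cquot a (z * of_real (sin t)) (z * of_real (cos t)) +
                   of_real (cos t) * cquot b (z * of_real (sin t)) (z * of_real (cos t))"
  have "(?g a b has_integral cmelnikov a b z) {0..2 * pi}" for a b
  proof -
    have "continuous_on {0..2 * pi} (\<lambda>t. (t, z))" by (intro continuous_intros)
    from continuous_on_compose2[OF cmelnikov_integrand_continuous[of a b] this]
    have "continuous_on {0..2 * pi} (?g a b)" using z(1) by (simp add: image_subset_iff)
    thus ?thesis unfolding cmelnikov_def by (rule integrable_integral[OF integrable_continuous_real])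
  qed
  note d = has_integral_diff[OF this[of a b] this[of a' b']]
  have k: "0 \<le> \<kappa> * L" using bound[of "\<lambda>i j. a i j - a' i j" \<kappa>, OF c(1) z(2)[of 0]] norm_ge_zero order_trans by blast
  have "norm (cmelnikov a b z - cmelnikov a' b' z) \<le> (2 * (\<kappa> * L)) * measure lborel {0..2 * pi}"
  proof (rule has_integral_bound_real[OF _ finite.emptyI d])
    fix t
    let ?x = "z * of_real (sin t)" and ?y = "z * of_real (cos t)"
    have eq: "?g a b t - ?g a' b' t = of_real (sin t) * cquot (\<lambda>i j. a i j - a' i j) ?x ?y + of_real (cos t) * cquot (\<lambda>i j. b i j - b' i j) ?x ?y"
      unfolding cquot_diff by (simp add: algebra_simps)
    have A: "norm (cquot (\<lambda>i j. a i j - a' i j) ?x ?y) \<le> \<kappa> * L" by (rule bound[OF _ z(2)]) (rule c(1))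
    have B: "norm (cquot (\<lambda>i j. b i j - b' i j) ?x ?y) \<le> \<kappa> * L" by (rule bound[OF _ z(2)]) (rule c(2))
    have "norm (of_real (sin t) * u + of_real (cos t) * v) \<le> 2 * (\<kappa> * L)" if "norm u \<le> \<kappa> * L" "norm v \<le> \<kappa> * L" for u v :: complex
      using norm_triangle_ineq[of "of_real (sin t) * u" "of_real (cos t) * v"] norm_mult_sin_cos_le[of u t] norm_mult_sin_cos_le[of v t] that
      by (simp add: mult.commute)
    from this[OF A B] show "norm (?g a b t - ?g a' b' t) \<le> 2 * (\<kappa> * L)" unfolding eq .
  qed (use k in simp)
  thus ?thesis by (simp add: mult_ac)
qed

text \<open>Brouwer's theorem on the square |x|, |y| \<le> |\<epsilon>| L: an equilibrium is a fixed
  point of the map with components \<epsilon> \<open>rquot b\<close> and - \<epsilon>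
  \<open>rquot a\<close>, and the bound \<open>L\<close> on both quotients sends the square into
  itself. The condition \<open>small\<close> keeps the square off the singular lines.\<close>

lemma equilibrium_exists:
  assumes L: "\<And>x y. \<bar>x\<bar> \<le> \<bar>\<epsilon>\<bar> * L \<Longrightarrow> \<bar>y\<bar> \<le> \<bar>\<epsilon>\<bar> * L \<Longrightarrow> \<bar>rquot a x y\<bar> \<le> L \<and> \<bar>rquot b x y\<bar> \<le> L"
    and L0: "L \<ge> 0" and small: "\<bar>\<epsilon>\<bar> * L < \<sigma>"
  obtains x0 y0 where "\<bar>x0\<bar> \<le> \<bar>\<epsilon>\<bar> * L" "\<bar>y0\<bar> \<le> \<bar>\<epsilon>\<bar> * L" "y0 + \<epsilon> * rquot a x0 y0 = 0" "- x0 + \<epsilon> * rquot b x0 y0 = 0"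
proof -
  define e where "e = \<bar>\<epsilon>\<bar> * L"
  have e: "e \<ge> 0" using L0 by (simp add: e_def)
  define S where "S = cbox (- e, - e) (e, e)"
  have S: "p \<in> S \<longleftrightarrow> \<bar>fst p\<bar> \<le> e \<and> \<bar>snd p\<bar> \<le> e" for p
    by (cases p) (auto simp: S_def cbox_Pair_eq abs_le_iff)
  let ?g = "\<lambda>p. (\<epsilon> * rquot b (fst p) (snd p), - (\<epsilon> * rquot a (fst p) (snd p)))"
  have nz: "1 - \<alpha>1 * fst p \<noteq> 0" "1 - \<alpha>2 * fst p \<noteq> 0" if "p \<in> S" for p
  proof -
    have "\<bar>fst p\<bar> < \<sigma>" using that S small by (auto simp: e_def)
    from alpha_sigma[OF this] have "\<bar>\<alpha>1 * fst p\<bar> < 1" "\<bar>\<alpha>2 * fst p\<bar> < 1" by (simp_all add: abs_mult)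
    thus "1 - \<alpha>1 * fst p \<noteq> 0" "1 - \<alpha>2 * fst p \<noteq> 0" by auto
  qed
  have "continuous_on S ?g"
    unfolding rquot_def den_def split_beta by (intro continuous_intros) (use nz in auto)
  moreover have "?g \<in> S \<rightarrow> S"
  proof
    fix p assume p: "p \<in> S"
    hence "\<bar>\<epsilon> * rquot a (fst p) (snd p)\<bar> \<le> e" "\<bar>\<epsilon> * rquot b (fst p) (snd p)\<bar> \<le> e"
      unfolding abs_mult e_def using L[of "fst p" "snd p"] S[of p] by (auto simp: e_def intro!: mult_left_mono)
    thus "?g p \<in> S" by (simp add: S)
  qed
  moreover have "(0, 0) \<in> S" using e by (simp add: S)
  moreover have "compact S" "convex S" by (simp_all add: S_def)
  ultimately obtain p where p: "p \<in> S" "?g p = p"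
    using brouwer[of S ?g] by blast
  show ?thesis
  proof (rule that[of "fst p" "snd p"])
    show "\<bar>fst p\<bar> \<le> \<bar>\<epsilon>\<bar> * L" "\<bar>snd p\<bar> \<le> \<bar>\<epsilon>\<bar> * L" using p(1) S by (auto simp: e_def)
    show "snd p + \<epsilon> * rquot a (fst p) (snd p) = 0" "- fst p + \<epsilon> * rquot b (fst p) (snd p) = 0"
      using arg_cong[OF p(2), of fst] arg_cong[OF p(2), of snd] by simp_all
  qed
qed

section \<open>The bound near one coefficient pair\<close>

text \<open>Everything is measured against the polynomial of the central pair (a', b'), at one point
  where it does not vanish. The interpolation bound there is a part proportional to \<epsilon> plus
  a part proportional to \<kappa>, and each is made smaller than half of the modulus at that
  point.\<close>

lemma local_bound:
  assumes V: "compact V" "V \<subseteq> Omega m1 m2 \<alpha>1 \<alpha>2" and K: "K > 0"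
    and h0: "0 \<le> h0" "h0 < H" "melnikov m1 m2 \<alpha>1 \<alpha>2 n a' b' h0 \<noteq> 0"
  shows "\<exists>\<kappa>>0. \<exists>\<epsilon>1>0. \<forall>a b \<epsilon> \<C>. (\<forall>i j. i + j \<le> n \<longrightarrow> \<bar>a i j\<bar> \<le> K \<and> \<bar>b i j\<bar> \<le> K \<and> \<bar>a i j - a' i j\<bar> \<le> \<kappa> \<and> \<bar>b i j - b' i j\<bar> \<le> \<kappa>) \<and>
     0 < \<bar>\<epsilon>\<bar> \<and> \<bar>\<epsilon>\<bar> < \<epsilon>1 \<and>
     (\<forall>C\<in>\<C>. periodic_orbit (perturbed_field m1 m2 \<alpha>1 \<alpha>2 n a b \<epsilon>) W C \<and> C \<subseteq> V) \<longrightarrow>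
     card \<C> < 4 * (q + m1 + m2) - 6"
proof -
  obtain d R1 where d: "0 < d" "d < 1" and VW: "\<And>x y. (x, y) \<in> V \<Longrightarrow> (of_real x, of_real y) \<in> pole_free_box d R1"
    using Omega_compact_bounds[OF V] by blast
  \<comment> \<open>Five equal steps lead from \<sigma> down to (1 - d) \<sigma>. The four radii use
    the first four, and the last absorbs the terms of \<open>small2\<close> that carry
    \<epsilon>.\<close>
  define u where "u = d * \<sigma> / 5"
  have u: "u > 0" using d sigma_pos by (simp add: u_def)
  have u5: "5 * u < \<sigma>" using d sigma_pos by (simp add: u_def)
  define \<rho>0 \<rho>1 \<rho>2 \<rho>3 where "\<rho>0 = \<sigma> - 4 * u" and "\<rho>1 = \<sigma> - 3 * u" and "\<rho>2 = \<sigma> - 2 * u" and "\<rho>3 = \<sigma> - u"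
  have \<rho>: "0 < \<rho>0" "\<rho>0 < \<rho>1" "\<rho>1 < \<rho>2" "\<rho>2 < \<rho>3" "\<rho>3 < \<sigma>"
    using u u5 by (simp_all add: \<rho>0_def \<rho>1_def \<rho>2_def \<rho>3_def)
  \<comment> \<open>A tenth of \<open>d\<close> makes (1 - \<delta>) \<sigma> = \<sigma> - u/2. This
    leaves u/2 beyond \<rho>3 for the shift of the centre.\<close>
  define \<delta> where "\<delta> = d / 10"
  have \<delta>: "0 < \<delta>" "\<delta> < 1" "\<delta> \<le> d" "(1 - \<delta>) * \<sigma> = \<sigma> - u / 2" using d by (simp_all add: \<delta>_def u_def algebra_simps)
  define R where "R = max R1 (2 * \<sigma>)"
  have VWR: "(of_real x, of_real y) \<in> pole_free_box d R" if "(x, y) \<in> V" for x y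
    using VW[OF that] by (auto simp: pole_free_box_def R_def)
  have in_Wd: "(x, y) \<in> pole_free_box \<delta> R" if "norm x \<le> \<sigma> - u / 2" "norm y \<le> 2 * \<sigma>" for x y
    using that u sigma_pos by (intro pole_free_box_disc \<delta>) (auto simp: R_def \<delta>(4))
  obtain L0 where L0: "L0 > 0"
    and cfb: "\<And>c \<kappa> x y. (\<And>i j. i + j \<le> n \<Longrightarrow> \<bar>c i j\<bar> \<le> \<kappa>) \<Longrightarrow> (x, y) \<in> pole_free_box \<delta> R \<Longrightarrow> norm (cquot c x y) \<le> \<kappa> * L0"
    and cfl: "\<And>c \<kappa> x y x' y'. (\<And>i j. i + j \<le> n \<Longrightarrow> \<bar>c i j\<bar> \<le> \<kappa>) \<Longrightarrow> (x, y) \<in> pole_free_box \<delta> R \<Longrightarrow> (x', y') \<in> pole_free_box \<delta> R \<Longrightarrow>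
        norm (cquot c x y - cquot c x' y') \<le> \<kappa> * L0 * (norm (x - x') + norm (y - y'))"
    by (rule cquot_bounds[OF \<delta>(1), of R]) blast
  define L where "L = K * L0"
  have L: "L > 0" using K L0 by (simp add: L_def)
  obtain P :: "complex poly" and G where P: "P \<noteq> 0" "degree P \<le> 2 * (4 * (q + m1 + m2) - 6)"
    "G holomorphic_on ball 0 \<sigma>" "\<And>z. z \<in> ball 0 \<sigma> \<Longrightarrow> poly P z = z * cmelnikov a' b' z * G z"
    using norm_polynomial_complex[OF h0] by blast
  define Q where "Q = 4 * (q + m1 + m2) - 6"
  have "bounded (G ` cball 0 \<rho>1)"
    by (intro compact_imp_bounded compact_continuous_image compact_cball
      continuous_on_subset[OF holomorphic_on_imp_continuous_on[OF P(3)]]) (use \<rho> in auto)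
  then obtain BG where BG: "BG > 0" "\<And>z. z \<in> cball 0 \<rho>1 \<Longrightarrow> norm (G z) \<le> BG"
    by (auto simp: bounded_pos)
  obtain Ci where Ci: "Ci \<ge> 0" "\<And>(f :: complex \<Rightarrow> complex) P \<eta> S z. \<lbrakk>f holomorphic_on ball 0 \<rho>1; degree P < 2 * Q + 1; finite S; S \<subseteq> cball 0 \<rho>0; card S = 2 * Q + 1;
      \<And>z. z \<in> S \<Longrightarrow> f z = 0; \<And>z. z \<in> ball 0 \<rho>1 \<Longrightarrow> norm (f z - poly P z) \<le> \<eta>; z \<in> cball 0 \<rho>0\<rbrakk>
      \<Longrightarrow> norm (poly P z) \<le> Ci * \<eta>"
    by (rule poly_small_if_many_approx_zeros[of \<rho>0 \<rho>1 "2 * Q + 1"]) (use \<rho> in auto)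
  \<comment> \<open>A nonzero polynomial has finitely many roots, so some point of the disc is no
    root; the final contradiction takes place at this point.\<close>
  obtain z1 where z1: "z1 \<in> cball 0 \<rho>0" "poly P z1 \<noteq> 0"
  proof (rule ccontr)
    assume "\<not> thesis"
    hence "of_real ` {0..\<rho>0} \<subseteq> {z. poly P z = 0}" using that by force
    hence "finite (complex_of_real ` {0..\<rho>0})" using poly_roots_finite[OF P(1)] finite_subset by blast
    hence "finite {0..\<rho>0}" by (rule finite_imageD) (simp add: inj_on_def)
    thus False using infinite_Icc[OF \<rho>(1)] by blast
  qed
  define p1 where "p1 = norm (poly P z1)"
  have p1: "p1 > 0" using z1 by (simp add: p1_def)
  define Cd where "Cd = perturbation.Cd L \<rho>3"
  \<comment> \<open>\<open>Ci\<close> is the loss by interpolation, and \<sigma> * BG bounds z G z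
    on the disc of radius \<rho>1.\<close>
  define M where "M = Ci * (\<sigma> * BG)"
  have pos: "0 < p1 / 2" "0 < \<rho>2 - \<rho>1" "0 < (1 / 2 :: real)" "0 < u / 2" using p1 \<rho> u by simp_all
  obtain \<kappa>1 where \<kappa>1: "\<kappa>1 > 0" "\<And>e. 0 \<le> e \<Longrightarrow> e < \<kappa>1 \<Longrightarrow> M * (4 * pi * L0) * e < p1 / 2"
    by (rule ex_small_factor[OF pos(1), of "M * (4 * pi * L0)"]) blast
  define \<kappa> where "\<kappa> = \<kappa>1 / 2"
  have \<kappa>: "\<kappa> > 0" "M * (4 * pi * L0) * \<kappa> < p1 / 2"
    using \<kappa>1(1) \<kappa>1(2)[of \<kappa>] by (simp_all add: \<kappa>_def)
  obtain e1 where e1: "e1 > 0" "\<And>e. 0 \<le> e \<Longrightarrow> e < e1 \<Longrightarrow> M * Cd * e < p1 / 2"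
    by (rule ex_small_factor[OF pos(1), of "M * Cd"]) blast
  obtain e2 where e2: "e2 > 0" "\<And>e. 0 \<le> e \<Longrightarrow> e < e2 \<Longrightarrow> 8 * L * e < 1"
    by (rule ex_small_factor[OF zero_less_one, of "8 * L"]) blast
  obtain e3 where e3: "e3 > 0" "\<And>e. 0 \<le> e \<Longrightarrow> e < e3 \<Longrightarrow> (16 * pi * L * \<rho>3) * e < \<rho>2 - \<rho>1"
    by (rule ex_small_factor[OF pos(2), of "16 * pi * L * \<rho>3"]) blast
  obtain e4 where e4: "e4 > 0" "\<And>e. 0 \<le> e \<Longrightarrow> e < e4 \<Longrightarrow> (2 * pi * (2 * (8 * L * \<rho>3) / (\<rho>3 - \<rho>2))) * e < 1 / 2"
    by (rule ex_small_factor[OF pos(3), of "2 * pi * (2 * (8 * L * \<rho>3) / (\<rho>3 - \<rho>2))"]) blast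
  obtain e5 where e5: "e5 > 0" "\<And>e. 0 \<le> e \<Longrightarrow> e < e5 \<Longrightarrow> L * e < u / 2"
    by (rule ex_small_factor[OF pos(4), of "L"]) blast
  obtain e6 where e6: "e6 > 0" "\<And>e. 0 \<le> e \<Longrightarrow> e < e6 \<Longrightarrow> (L + 64 * pi * L * R) * e < u"
    by (rule ex_small_factor[OF u, of "L + 64 * pi * L * R"]) blast
  define \<epsilon>1 where "\<epsilon>1 = Min {e1, e2, e3, e4, e5, e6}"
  have \<epsilon>1: "\<epsilon>1 > 0" "\<epsilon>1 \<le> e1" "\<epsilon>1 \<le> e2" "\<epsilon>1 \<le> e3" "\<epsilon>1 \<le> e4" "\<epsilon>1 \<le> e5" "\<epsilon>1 \<le> e6"
    using e1(1) e2(1) e3(1) e4(1) e5(1) e6(1) by (simp_all add: \<epsilon>1_def)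
  show ?thesis
  proof (rule exI[of _ \<kappa>], rule conjI[OF \<kappa>(1)], rule exI[of _ \<epsilon>1], rule conjI[OF \<epsilon>1(1)], intro allI impI, elim conjE)
    fix a b \<epsilon> \<C>
    assume co: "\<forall>i j. i + j \<le> n \<longrightarrow> \<bar>a i j\<bar> \<le> K \<and> \<bar>b i j\<bar> \<le> K \<and> \<bar>a i j - a' i j\<bar> \<le> \<kappa> \<and> \<bar>b i j - b' i j\<bar> \<le> \<kappa>"
      and \<epsilon>: "0 < \<bar>\<epsilon>\<bar>" "\<bar>\<epsilon>\<bar> < \<epsilon>1"
      and po: "\<forall>C\<in>\<C>. periodic_orbit (perturbed_field m1 m2 \<alpha>1 \<alpha>2 n a b \<epsilon>) W C \<and> C \<subseteq> V"
    have aK: "\<And>i j. i + j \<le> n \<Longrightarrow> \<bar>a i j\<bar> \<le> K" and bK: "\<And>i j. i + j \<le> n \<Longrightarrow> \<bar>b i j\<bar> \<le> K" using co by auto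
    have s1: "M * Cd * \<bar>\<epsilon>\<bar> < p1 / 2" by (rule e1(2)) (use \<epsilon> \<epsilon>1 in auto)
    have s2: "8 * L * \<bar>\<epsilon>\<bar> < 1" by (rule e2(2)) (use \<epsilon> \<epsilon>1 in auto)
    have s3: "(16 * pi * L * \<rho>3) * \<bar>\<epsilon>\<bar> < \<rho>2 - \<rho>1" by (rule e3(2)) (use \<epsilon> \<epsilon>1 in auto)
    have s4: "(2 * pi * (2 * (8 * L * \<rho>3) / (\<rho>3 - \<rho>2))) * \<bar>\<epsilon>\<bar> < 1 / 2" by (rule e4(2)) (use \<epsilon> \<epsilon>1 in auto)
    have s5: "L * \<bar>\<epsilon>\<bar> < u / 2" by (rule e5(2)) (use \<epsilon> \<epsilon>1 in auto)
    have s6: "(L + 64 * pi * L * R) * \<bar>\<epsilon>\<bar> < u" by (rule e6(2)) (use \<epsilon> \<epsilon>1 in auto)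
    have cfa: "norm (cquot a x y) \<le> L" if "(x, y) \<in> pole_free_box \<delta> R" for x y unfolding L_def by (rule cfb[OF _ that]) (rule aK)
    have cfb': "norm (cquot b x y) \<le> L" if "(x, y) \<in> pole_free_box \<delta> R" for x y unfolding L_def by (rule cfb[OF _ that]) (rule bK)
    obtain x0 y0 where eq: "\<bar>x0\<bar> \<le> \<bar>\<epsilon>\<bar> * L" "\<bar>y0\<bar> \<le> \<bar>\<epsilon>\<bar> * L" "y0 + \<epsilon> * rquot a x0 y0 = 0" "- x0 + \<epsilon> * rquot b x0 y0 = 0"
    proof (rule equilibrium_exists[of \<epsilon> L a b])
      fix x y assume "\<bar>x\<bar> \<le> \<bar>\<epsilon>\<bar> * L" "\<bar>y\<bar> \<le> \<bar>\<epsilon>\<bar> * L"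
      hence "\<bar>x\<bar> \<le> \<sigma> - u / 2" "\<bar>y\<bar> \<le> 2 * \<sigma>" using s5 u5 u by (simp_all add: mult.commute)
      hence "(complex_of_real x, complex_of_real y) \<in> pole_free_box \<delta> R" by (intro in_Wd) auto
      thus "\<bar>rquot a x y\<bar> \<le> L \<and> \<bar>rquot b x y\<bar> \<le> L" using cfa cfb' by (metis cquot_of_real norm_of_real)
    qed (use L s5 u5 u in \<open>auto simp: mult.commute\<close>)
    have x0: "\<bar>x0\<bar> \<le> u / 2" "\<bar>y0\<bar> \<le> u / 2" using eq(1,2) s5 by (simp_all add: mult.commute)
    interpret sp: small_perturbation m1 m2 n \<alpha>1 \<alpha>2 a b \<epsilon> x0 y0 L \<delta> R \<rho>1 \<rho>2 \<rho>3 \<rho>0 d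
    proof unfold_locales
      show "norm (cquot a x y - cquot a x' y') \<le> L * (norm (x - x') + norm (y - y')) \<and>
        norm (cquot b x y - cquot b x' y') \<le> L * (norm (x - x') + norm (y - y'))" if "(x, y) \<in> pole_free_box \<delta> R" "(x', y') \<in> pole_free_box \<delta> R" for x y x' y'
      proof
        show "norm (cquot a x y - cquot a x' y') \<le> L * (norm (x - x') + norm (y - y'))" unfolding L_def by (rule cfl[OF _ that]) (rule aK)
        show "norm (cquot b x y - cquot b x' y') \<le> L * (norm (x - x') + norm (y - y'))" unfolding L_def by (rule cfl[OF _ that]) (rule bK)
      qed
      fix r t assume r: "r \<in> ball (0::complex) \<rho>3"
      have n: "norm (r * of_real (sin t)) \<le> \<sigma> - u" "norm (r * of_real (cos t)) \<le> \<sigma> - u"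
        using norm_mult_sin_cos_le[of r t] r by (auto simp: \<rho>3_def)
      show "(r * of_real (sin t), r * of_real (cos t)) \<in> pole_free_box \<delta> R" using n u sigma_pos by (intro in_Wd) auto
      show "(of_real x0 + r * of_real (sin t), of_real y0 + r * of_real (cos t)) \<in> pole_free_box \<delta> R"
        using n x0 u sigma_pos u5 norm_triangle_ineq[of "of_real x0" "r * of_real (sin t)"] norm_triangle_ineq[of "of_real y0" "r * of_real (cos t)"]
        by (intro in_Wd) auto
    next
      show "\<bar>x0\<bar> + \<rho>3 \<le> \<sigma>" using x0 u by (simp add: \<rho>3_def)
      show "16 * pi * L * \<bar>\<epsilon>\<bar> * \<rho>3 < \<rho>2 - \<rho>1" using s3 by (simp add: mult_ac)
      show "2 * pi * (2 * (8 * L * \<bar>\<epsilon>\<bar> * \<rho>3) / (\<rho>3 - \<rho>2)) \<le> 1 / 2" using s4 by (simp add: mult_ac)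
      have "(1 - d) * \<sigma> = \<sigma> - 5 * u" by (simp add: u_def algebra_simps)
      thus "(1 - d) * \<sigma> + \<bar>\<epsilon>\<bar> * L + 64 * pi * L * \<bar>\<epsilon>\<bar> * R < \<rho>0"
        using s6 by (simp add: \<rho>0_def algebra_simps)
    qed (use L \<rho> eq s2 d \<delta> in auto)
    show "card \<C> < 4 * (q + m1 + m2) - 6"
    proof (rule ccontr)
      assume "\<not> card \<C> < 4 * (q + m1 + m2) - 6"
      then obtain \<D> where \<D>: "\<D> \<subseteq> \<C>" "card \<D> = Q" "finite \<D>"
        using obtain_subset_with_card_n[of Q \<C>] by (auto simp: Q_def)
      obtain dd Z where dZ: "dd holomorphic_on ball 0 \<rho>1"
        "\<And>z. z \<in> ball 0 \<rho>1 \<Longrightarrow> norm (dd z - of_real \<epsilon> * cmelnikov a b z) \<le> sp.Cd * \<epsilon>\<^sup>2"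
        "finite Z" "Z \<subseteq> cball 0 \<rho>0" "card Z = 2 * card \<D> + 1" "\<And>z. z \<in> Z \<Longrightarrow> z * dd z = 0"
      proof (rule sp.displacement_zeros[OF \<D>(3), of W])
        show "periodic_orbit sp.field W C" if "C \<in> \<D>" for C using po that \<D> by blast
        show "(of_real x, of_real y) \<in> pole_free_box d R" if "C \<in> \<D>" "(x, y) \<in> C" for C x y
          using po that \<D> by (intro VWR) blast
      qed blast
      have Cd: "sp.Cd = Cd" by (simp add: Cd_def)
      \<comment> \<open>Multiplication by \<open>G z\<close> keeps the zeros of z d z. To first
        order d / \<epsilon> is the complex Melnikov function of (a, b), and for (a', b') the
        product z \<open>cmelnikov\<close> G is exactly \<open>P\<close>.\<close>
      define f where "f z = z * dd z * G z / of_real \<epsilon>" for z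
      define \<eta> where "\<eta> = \<sigma> * BG * (Cd * \<bar>\<epsilon>\<bar> + 4 * pi * \<kappa> * L0)"
      have "norm (poly P z1) \<le> Ci * \<eta>"
      proof (rule Ci(2))
        show "f holomorphic_on ball 0 \<rho>1" unfolding f_def[abs_def]
          by (intro holomorphic_intros dZ(1) holomorphic_on_subset[OF P(3)]) (use \<epsilon> \<rho> in auto)
        show "degree P < 2 * Q + 1" using P(2) by (simp add: Q_def)
        show "card Z = 2 * Q + 1" using dZ(5) \<D> by simp
        show "f z = 0" if "z \<in> Z" for z using dZ(6)[OF that] by (auto simp: f_def)
        fix z :: complex assume z: "z \<in> ball 0 \<rho>1"
        have z\<sigma>: "norm z < \<sigma>" using z \<rho> by simp
        define e where "e = dd z / of_real \<epsilon> - cmelnikov a b z"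
        have "dd z - of_real \<epsilon> * cmelnikov a b z = of_real \<epsilon> * e" using \<epsilon> by (simp add: e_def field_simps)
        hence "\<bar>\<epsilon>\<bar> * norm e \<le> Cd * \<epsilon>\<^sup>2" using dZ(2)[OF z] by (simp add: norm_mult Cd)
        also have "Cd * \<epsilon>\<^sup>2 = \<bar>\<epsilon>\<bar> * (Cd * \<bar>\<epsilon>\<bar>)" by (simp add: power2_eq_square flip: abs_mult)
        finally have e: "norm e \<le> Cd * \<bar>\<epsilon>\<bar>" using \<epsilon> by simp
        have dM: "norm (cmelnikov a b z - cmelnikov a' b' z) \<le> 4 * pi * \<kappa> * L0"
        proof (rule cmelnikov_diff_le[where \<delta> = \<delta> and R = R])
          show "(z * of_real (sin t), z * of_real (cos t)) \<in> pole_free_box \<delta> R" for t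
            using norm_mult_sin_cos_le[of z t] z\<sigma> z \<rho> u sigma_pos by (intro in_Wd) (auto simp: \<rho>1_def)
          show "norm (cquot c x y) \<le> \<kappa> * L0" if "\<And>i j. i + j \<le> n \<Longrightarrow> \<bar>c i j\<bar> \<le> \<kappa>" "(x, y) \<in> pole_free_box \<delta> R" for c \<kappa> x y
            by (rule cfb[OF _ that(2)]) (rule that(1))
        qed (use co z\<sigma> in auto)
        have feq: "f z - poly P z = z * G z * (e + (cmelnikov a b z - cmelnikov a' b' z))"
          unfolding f_def e_def using P(4)[of z] z\<sigma> by (simp add: algebra_simps)
        have "norm (f z - poly P z) = norm z * norm (G z) * norm (e + (cmelnikov a b z - cmelnikov a' b' z))"
          unfolding feq by (simp add: norm_mult)
        also have "\<dots> \<le> \<sigma> * BG * (Cd * \<bar>\<epsilon>\<bar> + 4 * pi * \<kappa> * L0)"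
        proof (intro mult_mono)
          show "norm (G z) \<le> BG" using BG(2)[of z] z by simp
          show "norm (e + (cmelnikov a b z - cmelnikov a' b' z)) \<le> Cd * \<bar>\<epsilon>\<bar> + 4 * pi * \<kappa> * L0"
            using norm_triangle_ineq[of e "cmelnikov a b z - cmelnikov a' b' z"] e dM by linarith
        qed (use z\<sigma> sigma_pos BG in auto)
        finally show "norm (f z - poly P z) \<le> \<eta>" by (simp add: \<eta>_def)
      qed (use dZ z1 in auto)
      also have "Ci * \<eta> = M * Cd * \<bar>\<epsilon>\<bar> + M * (4 * pi * L0) * \<kappa>" by (simp add: \<eta>_def M_def algebra_simps)
      also have "\<dots> < p1" using s1 \<kappa>(2) by linarith
      finally show False by (simp add: p1_def)
    qed
  qed
qed

end

section \<open>Compactness of the coefficient set\<close>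

theorem theorem2p1:
  fixes m1 m2 n :: nat and \<alpha>1 \<alpha>2 K :: real
    and V :: "(real \<times> real) set"
    and D :: "((nat \<Rightarrow> nat \<Rightarrow> real) \<times> (nat \<Rightarrow> nat \<Rightarrow> real)) set"
  assumes "m1 \<ge> 1" and "m2 \<ge> 1"
    and "\<alpha>1 * \<alpha>2 \<noteq> 0" and "\<alpha>1 \<noteq> \<alpha>2"
    and "K > 0"
    and "compact V" and "V \<subseteq> Omega m1 m2 \<alpha>1 \<alpha>2"
    and "compact D" and "D \<subseteq> coeff_box n K"
    and "\<And>a b. (a, b) \<in> D \<Longrightarrow> \<exists>h. 0 \<le> h \<and> h < H0 \<alpha>1 \<alpha>2 \<and> melnikov m1 m2 \<alpha>1 \<alpha>2 n a b h \<noteq> 0"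
  shows "\<exists>\<epsilon>0>0. \<forall>\<epsilon>. 0 < \<bar>\<epsilon>\<bar> \<and> \<bar>\<epsilon>\<bar> < \<epsilon>0 \<longrightarrow>
    (\<forall>(a, b)\<in>D.
      finite {C. limit_cycle (perturbed_field m1 m2 \<alpha>1 \<alpha>2 n a b \<epsilon>) (Omega m1 m2 \<alpha>1 \<alpha>2) C \<and> C \<subseteq> V} \<and>
      card {C. limit_cycle (perturbed_field m1 m2 \<alpha>1 \<alpha>2 n a b \<epsilon>) (Omega m1 m2 \<alpha>1 \<alpha>2) C \<and> C \<subseteq> V}
        \<le> 4 * ((n + 1) div 2 + m1 + m2) - 7)"
proof -
  interpret melnikov_params m1 m2 n \<alpha>1 \<alpha>2
    by unfold_locales (use assms in auto)
  let ?W = "Omega m1 m2 \<alpha>1 \<alpha>2"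
  define good where "good p \<kappa> \<epsilon>1 \<longleftrightarrow> (\<forall>a b \<epsilon> \<C>. (\<forall>i j. i + j \<le> n \<longrightarrow> \<bar>a i j\<bar> \<le> K \<and> \<bar>b i j\<bar> \<le> K \<and>
       \<bar>a i j - fst p i j\<bar> \<le> \<kappa> \<and> \<bar>b i j - snd p i j\<bar> \<le> \<kappa>) \<and>
     0 < \<bar>\<epsilon>\<bar> \<and> \<bar>\<epsilon>\<bar> < \<epsilon>1 \<and>
     (\<forall>C\<in>\<C>. periodic_orbit (perturbed_field m1 m2 \<alpha>1 \<alpha>2 n a b \<epsilon>) ?W C \<and> C \<subseteq> V) \<longrightarrow>
     card \<C> < 4 * (q + m1 + m2) - 6)"
    for p :: "(nat \<Rightarrow> nat \<Rightarrow> real) \<times> (nat \<Rightarrow> nat \<Rightarrow> real)" and \<kappa> \<epsilon>1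
  have "\<exists>\<kappa> \<epsilon>1. 0 < \<kappa> \<and> 0 < \<epsilon>1 \<and> good p \<kappa> \<epsilon>1" if p: "p \<in> D" for p
  proof -
    obtain h where "0 \<le> h" "h < H" "melnikov m1 m2 \<alpha>1 \<alpha>2 n (fst p) (snd p) h \<noteq> 0"
      using assms(10)[of "fst p" "snd p"] p by (auto simp: H_def)
    from local_bound[OF assms(6,7,5) this, of ?W] show ?thesis unfolding good_def by blast
  qed
  then obtain \<kappa> \<epsilon>1 where ke: "\<And>p. p \<in> D \<Longrightarrow> 0 < \<kappa> p" "\<And>p. p \<in> D \<Longrightarrow> 0 < \<epsilon>1 p" "\<And>p. p \<in> D \<Longrightarrow> good p (\<kappa> p) (\<epsilon>1 p)"
    by metis
  \<comment> \<open>The condition restricts finitely many coordinates, so it is open in the product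
    topology, and it supplies the closeness that \<open>good\<close> asks for.\<close>
  define U where "U p = (\<Inter>s\<in>index_set n. {p'. \<bar>fst p' (fst s) (snd s) - fst p (fst s) (snd s)\<bar> < \<kappa> p} \<inter>
      {p'. \<bar>snd p' (fst s) (snd s) - snd p (fst s) (snd s)\<bar> < \<kappa> p})" for p :: "(nat \<Rightarrow> nat \<Rightarrow> real) \<times> (nat \<Rightarrow> nat \<Rightarrow> real)"
  have openU: "open (U p)" for p
  proof -
    have c: "continuous_on UNIV (\<lambda>f. f i j)" for i j :: nat
      by (rule continuous_on_product_then_coordinatewise) (rule continuous_on_product_coordinates)
    have "continuous_on UNIV (\<lambda>p :: (nat \<Rightarrow> nat \<Rightarrow> real) \<times> (nat \<Rightarrow> nat \<Rightarrow> real). fst p i j)"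
      "continuous_on UNIV (\<lambda>p :: (nat \<Rightarrow> nat \<Rightarrow> real) \<times> (nat \<Rightarrow> nat \<Rightarrow> real). snd p i j)" for i j
      by (rule continuous_on_compose2[OF c continuous_on_fst[OF continuous_on_id]] continuous_on_compose2[OF c continuous_on_snd[OF continuous_on_id]], simp)+
    thus ?thesis
      unfolding U_def by (intro open_INT finite_index_set ballI open_Int open_Collect_less continuous_on_rabs continuous_on_diff continuous_on_const)
  qed
  have "p \<in> U p" if "p \<in> D" for p using ke(1)[OF that] by (auto simp: U_def)
  hence cover: "D \<subseteq> (\<Union>p\<in>D. U p)" by blast
  obtain D' where D': "D' \<subseteq> D" "finite D'" "D \<subseteq> (\<Union>p\<in>D'. U p)"
    by (rule compactE_image[OF assms(8) openU cover])
  \<comment> \<open>The inserted 1 gives \<open>Min\<close> a nonempty set when \<open>D'\<close> is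
    empty.\<close>
  define \<epsilon>0 where "\<epsilon>0 = Min (insert 1 (\<epsilon>1 ` D'))"
  have \<epsilon>0: "\<epsilon>0 > 0" "\<And>p. p \<in> D' \<Longrightarrow> \<epsilon>0 \<le> \<epsilon>1 p"
    using D' ke(2) by (auto simp: \<epsilon>0_def)
  show ?thesis
  proof (intro exI[of _ \<epsilon>0] conjI[OF \<epsilon>0(1)] allI impI ballI, clarify)
    fix \<epsilon> a b
    assume \<epsilon>: "0 < \<bar>\<epsilon>\<bar>" "\<bar>\<epsilon>\<bar> < \<epsilon>0" and ab: "(a, b) \<in> D"
    let ?F = "perturbed_field m1 m2 \<alpha>1 \<alpha>2 n a b \<epsilon>"
    obtain p where p: "p \<in> D'" "(a, b) \<in> U p" using D' ab by blast
    have near: "\<forall>i j. i + j \<le> n \<longrightarrow> \<bar>a i j\<bar> \<le> K \<and> \<bar>b i j\<bar> \<le> K \<and> \<bar>a i j - fst p i j\<bar> \<le> \<kappa> p \<and> \<bar>b i j - snd p i j\<bar> \<le> \<kappa> p"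
      using p(2) ab assms(9) by (fastforce simp: U_def coeff_box_def index_set_def)
    have g: "good p (\<kappa> p) (\<epsilon>1 p)" and e: "\<bar>\<epsilon>\<bar> < \<epsilon>1 p" using ke(3)[OF subsetD[OF D'(1) p(1)]] \<epsilon>0(2)[OF p(1)] \<epsilon>(2) by auto
    show "finite {C. limit_cycle ?F ?W C \<and> C \<subseteq> V} \<and> card {C. limit_cycle ?F ?W C \<and> C \<subseteq> V} \<le> 4 * ((n + 1) div 2 + m1 + m2) - 7"
    proof (rule finite_if_finite_subsets_card_bdd)
      \<comment> \<open>Since \<open>card\<close> is 0 on infinite sets, the bound is applied to
        finite subfamilies; their common bound yields finiteness as well as the count.\<close>
      fix \<C> assume \<C>: "\<C> \<subseteq> {C. limit_cycle ?F ?W C \<and> C \<subseteq> V}" "finite \<C>"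
      have "card \<C> < 4 * (q + m1 + m2) - 6"
        by (rule g[unfolded good_def, THEN spec, THEN spec, THEN spec, THEN spec, THEN mp, OF conjI[OF near conjI[OF \<epsilon>(1) conjI[OF e]]]])
          (use \<C>(1) in \<open>auto simp: limit_cycle_def\<close>)
      thus "card \<C> \<le> 4 * ((n + 1) div 2 + m1 + m2) - 7" by (simp add: q_def)
    qed
  qed
qed

end
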